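(* Let $(M,d)$ be a stable metric space. Let $(\rho,\omega)\in\mathcal P\times\Omega$ be such that $\rho$ and $\omega$ are non-decreasing and the maps $t\mapsto\frac{\rho(t)}{t}$, $t\mapsto\frac{\omega(t)}{t}$ are non-increasing on $(0,\infty)$. Then there exist a reflexive Banach space $(Y,\|\cdot\|)$ and a map $f\colon M\to Y$ such that for all $x,y\in M$, $$\rho(d(x,y))\le\|f(x)-f(y)\|\le\omega(d(x,y)).$$
   Context: A metric space $(X,d_X)$ is stable if for any two bounded sequences $(x_n)_{n=1}^\infty$, $(y_n)_{n=1}^\infty$ in $X$ and any two non-principal ultrafilters $\mathcal U,\mathcal V$ on $\mathbb N$, one has $\lim_{m,\mathcal U}\lim_{n,\mathcal V}d_X(x_m,y_n)=\lim_{n,\mathcal V}\lim_{m,\mathcal U}d_X(x_m,y_n)$. $\mathcal P$ is the set of continuous functions $\rho\colon[0,\infty)\to[0,\infty)$ such that $\rho(t)=t$ for all $t\in[0,1]$, $\rho(t)\le t$ for all $t\ge1$, and $\lim_{t\to+\infty}\frac{\rho(t)}{t}=0$. $\Omega$ is the set of continuous functions $\omega\colon[0,\infty)\to[0,\infty)$ such that $\omega(0)=0$, $t\le\omega(t)$ for all $t\in[0,1]$, $\lim_{t\to0}\frac{\omega(t)}{t}=\infty$, and $\omega(t)=t$ for all $t\ge1$. *)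

theory Defs
  imports "HOL-Analysis.Analysis" "HOL-Algebra.Module"
begin

definition ultrafilter :: "'i filter \<Rightarrow> bool"
  where "ultrafilter \<U> \<longleftrightarrow> \<U> \<noteq> bot \<and> (\<forall>P. eventually P \<U> \<or> eventually (\<lambda>i. \<not> P i) \<U>)"

definition nonprincipal_ultrafilter :: "'i filter \<Rightarrow> bool"
  where "nonprincipal_ultrafilter \<U> \<longleftrightarrow> ultrafilter \<U> \<and> (\<forall>i. \<U> \<noteq> principal {i})"

text \<open>For bounded sequences the double sequence of distances is bounded, so all the limits along
  ultrafilters below exist and \<^const>\<open>Lim\<close> is never applied to a divergent function.\<close>

definition stable :: "'a::metric_space itself \<Rightarrow> bool"
  where "stable TYPE('a) \<longleftrightarrow>
    (\<forall>(x :: nat \<Rightarrow> 'a) (y :: nat \<Rightarrow> 'a) (\<U> :: nat filter) (\<V> :: nat filter).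
      bounded (range x) \<longrightarrow> bounded (range y) \<longrightarrow>
      nonprincipal_ultrafilter \<U> \<longrightarrow> nonprincipal_ultrafilter \<V> \<longrightarrow>
      Lim \<U> (\<lambda>m. Lim \<V> (\<lambda>n. dist (x m) (y n))) =
      Lim \<V> (\<lambda>n. Lim \<U> (\<lambda>m. dist (x m) (y n))))"

text \<open>Functions on \<open>[0,\<infinity>)\<close> are represented by functions of type \<^typ>\<open>real \<Rightarrow> real\<close> whose values at
  negative arguments are irrelevant.\<close>

definition class_P :: "(real \<Rightarrow> real) set"
  where "class_P = {\<rho>. continuous_on {0..} \<rho> \<and> (\<forall>t\<ge>0. 0 \<le> \<rho> t) \<and>
    (\<forall>t\<in>{0..1}. \<rho> t = t) \<and> (\<forall>t\<ge>1. \<rho> t \<le> t) \<and>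
    ((\<lambda>t. \<rho> t / t) \<longlongrightarrow> 0) at_top}"

definition class_Omega :: "(real \<Rightarrow> real) set"
  where "class_Omega = {\<omega>. continuous_on {0..} \<omega> \<and> (\<forall>t\<ge>0. 0 \<le> \<omega> t) \<and>
    \<omega> 0 = 0 \<and> (\<forall>t\<in>{0..1}. t \<le> \<omega> t) \<and>
    filterlim (\<lambda>t. \<omega> t / t) at_top (at_right 0) \<and> (\<forall>t\<ge>1. \<omega> t = t)}"

definition real_field :: "real ring"
  where "real_field = \<lparr>carrier = UNIV, mult = (*), one = 1, zero = 0, add = (+)\<rparr>"

text \<open>Type classes do not allow an existential quantifier over Banach spaces, so a normed space is a
  structure with an explicit carrier. The fields \<^const>\<open>mult\<close> and \<^const>\<open>one\<close> inherited from the
  ring record are unused.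

  To assert that some Banach space \<open>Y\<close> and map \<open>f\<close> from a metric space of type \<open>'a\<close> to \<open>Y\<close> with
  given bounds exist, one has to choose a type for the vectors. The type
  \<open>('a \<Rightarrow> real) \<Rightarrow> real\<close> entails no loss of generality: reflexivity passes to the closed
  linear span of the range of \<open>f\<close>, whose cardinality is at most that of the continuum if \<open>'a\<close> is
  finite and at most that of \<open>'a \<Rightarrow> real\<close> otherwise, so that an isomorphic copy of it can be
  carried by a subset of that type. The operations and the norm on the carrier are arbitrary;
  they need not be pointwise.\<close>

record 'v normed_structure = "(real, 'v) module" +
  nrm :: "'v \<Rightarrow> real"

locale normed_space = Module.module real_field Y for Y :: "'v normed_structure" (structure) +
  assumes nrm_nonneg: "x \<in> carrier Y \<Longrightarrow> 0 \<le> nrm Y x"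
    and nrm_eq_0_iff: "x \<in> carrier Y \<Longrightarrow> nrm Y x = 0 \<longleftrightarrow> x = \<zero>"
    and nrm_smult: "x \<in> carrier Y \<Longrightarrow> nrm Y (c \<odot>\<^bsub>Y\<^esub> x) = \<bar>c\<bar> * nrm Y x"
    and nrm_triangle: "x \<in> carrier Y \<Longrightarrow> y \<in> carrier Y \<Longrightarrow> nrm Y (x \<oplus> y) \<le> nrm Y x + nrm Y y"

locale banach_space = normed_space +
  assumes complete: "\<And>s :: nat \<Rightarrow> _. range s \<subseteq> carrier Y \<Longrightarrow>
    (\<forall>e>0. \<exists>N. \<forall>m\<ge>N. \<forall>n\<ge>N. nrm Y (s m \<ominus> s n) < e) \<Longrightarrow>
    \<exists>l\<in>carrier Y. (\<lambda>n. nrm Y (s n \<ominus> l)) \<longlonglongrightarrow> 0"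

definition bounded_functional :: "'v normed_structure \<Rightarrow> ('v \<Rightarrow> real) \<Rightarrow> bool"
  where "bounded_functional Y \<phi> \<longleftrightarrow>
    (\<forall>x\<in>carrier Y. \<forall>y\<in>carrier Y. \<phi> (x \<oplus>\<^bsub>Y\<^esub> y) = \<phi> x + \<phi> y) \<and>
    (\<forall>c. \<forall>x\<in>carrier Y. \<phi> (c \<odot>\<^bsub>Y\<^esub> x) = c * \<phi> x) \<and>
    (\<exists>C. \<forall>x\<in>carrier Y. \<bar>\<phi> x\<bar> \<le> C * nrm Y x)"

text \<open>Functionals are restricted to the carrier (\<^const>\<open>extensional\<close>), so that equality of
  elements of the dual space is equality of functions.\<close>

definition dual_space :: "'v normed_structure \<Rightarrow> ('v \<Rightarrow> real) normed_structure"
  where "dual_space Y =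
    \<lparr>carrier = {\<phi> \<in> extensional (carrier Y). bounded_functional Y \<phi>},
     mult = undefined, one = undefined,
     zero = (\<lambda>x\<in>carrier Y. 0),
     add = (\<lambda>\<phi> \<psi>. \<lambda>x\<in>carrier Y. \<phi> x + \<psi> x),
     smult = (\<lambda>c \<phi>. \<lambda>x\<in>carrier Y. c * \<phi> x),
     nrm = (\<lambda>\<phi>. SUP x\<in>{x \<in> carrier Y. nrm Y x \<le> 1}. \<bar>\<phi> x\<bar>)\<rparr>"

definition canonical_embedding :: "'v normed_structure \<Rightarrow> 'v \<Rightarrow> ('v \<Rightarrow> real) \<Rightarrow> real"
  where "canonical_embedding Y x = (\<lambda>\<phi>\<in>carrier (dual_space Y). \<phi> x)"

definition reflexive :: "'v normed_structure \<Rightarrow> bool"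
  where "reflexive Y \<longleftrightarrow>
    canonical_embedding Y ` carrier Y = carrier (dual_space (dual_space Y))"

end

theory Submission
  imports Defs "HOL-Analysis.Finite_Function_Topology"
begin

text \<open>
  For points \<open>p, q\<close> with \<open>t = d(p, q)\<close> put \<open>g\<^sub>p\<^sub>q(x) = \<rho>(t)/t * max (t - d(q, x)) 0\<close>. The vectors
  \<open>a\<^sub>x\<^sub>y = (g\<^sub>p\<^sub>q(x) - g\<^sub>p\<^sub>q(y))\<^sub>p\<^sub>q / \<omega>(d(x, y))\<close> lie in the unit ball of the bounded functions on the
  set of pairs, and \<open>\<bar>g\<^sub>x\<^sub>y(x) - g\<^sub>x\<^sub>y(y)\<bar> = \<rho>(d(x, y))\<close>. Stability, together with \<open>\<rho>(t)/t \<rightarrow> 0\<close> at infinity and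
  \<open>\<omega>(t)/t \<rightarrow> \<infinity>\<close> at zero, says that the set \<open>A\<close> of these vectors satisfies Grothendieck's
  double limit condition, i.e. is relatively weakly compact. Interpolating between the convex hull of
  \<open>A\<close> and the unit ball as in the Davis-Figiel-Johnson-Pelczynski construction, with weights chosen so
  that no constant is lost, gives a reflexive space \<open>Y\<close> whose norm dominates the supremum norm and
  is at most \<open>1\<close> on \<open>A\<close>; the embedding is \<open>f(x) = (g\<^sub>p\<^sub>q(x) - g\<^sub>p\<^sub>q(b))\<^sub>p\<^sub>q\<close> for a base point \<open>b\<close>.

  The gauges defining \<open>Y\<close> are expressed by duality as suprema over finitely supported functionals, and
  the double limit condition shows that these functionals are dense in the dual of \<open>Y\<close>. So an
  element of the bidual is evaluation at the vector of its values on the coordinate functionals,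
  which lies in \<open>Y\<close> by the duality.
\<close>

text \<open>Stability speaks of bounded sequences only, and this dictates the coordinates: the tent
  at \<open>q\<close> is supported in the ball of radius \<open>t\<close> around \<open>q\<close>,
  so tents of bounded height vanish on points that run away from them. Two degenerate situations
  remain, pairs \<open>p\<close>, \<open>q\<close> getting far apart and points \<open>x\<close>,
  \<open>y\<close> getting close together. These are exactly where \<open>\<rho>(t)/t\<close> and
  \<open>t/\<omega>(t)\<close> are small. No constant is lost because \<open>A\<close> lies in the
  unit ball: every interpolating set \<open>(1 - \<theta>\<^sub>n) conv (A \<union> -A) +
  \<theta>\<^sub>n B\<close> contains \<open>A\<close> and is contained in \<open>B\<close>, so its
  gauge is at most 1 on \<open>A\<close> and at least the supremum norm. The squared weights of the
  l2-sum of these gauges are again the \<open>\<theta>\<^sub>n\<close>, which add up to 1, so both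
  estimates survive. Weak topologies never appear. Compactness enters through one pattern: if a
  statement failed, two sequences could be chosen in turn, each new term with regard to all earlier
  ones, and their iterated limits along a fixed ultrafilter would differ. The pattern occurs twice,
  for passing to convex hulls and for turning approximation on finite sets into uniform
  approximation.\<close>

lemma ultrafilter_below:
  fixes F :: "'i filter"
  assumes "F \<noteq> bot"
  shows "\<exists>U\<le>F. ultrafilter U"
proof -
  let ?A = "{G. G \<noteq> bot \<and> G \<le> F}"
  \<comment> \<open>The order is reversed because a filter with more eventual properties is smaller:
    a maximal element for \<open>?R\<close> is a minimal proper filter.\<close>
  let ?R = "relation_of (\<lambda>G H. H \<le> G) ?A"
  have "partial_order_on ?A ?R"
    by (rule partial_order_on_relation_ofI) auto
  moreover have "\<exists>u\<in>?A. \<forall>G\<in>C. u \<le> G" if C: "C \<in> Chains ?R" for C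
  proof (cases "C = {}")
    case True
    then show ?thesis
      using assms by auto
  next
    case False
    have CA: "C \<subseteq> ?A" and tot: "\<And>G H. G \<in> C \<Longrightarrow> H \<in> C \<Longrightarrow> G \<le> H \<or> H \<le> G"
      using C by (auto simp: Chains_def relation_of_def)
    \<comment> \<open>An infimum of filters is proper once all its finite subinfima are, and in a
      chain a nonempty finite infimum has a proper member below it.\<close>
    have "Inf X \<noteq> bot" if "finite X" "X \<subseteq> C" for X
    proof (cases "X = {}")
      case True
      then show ?thesis by (simp add: trivial_limit_def eventually_top)
    next
      case False
      have "\<exists>m\<in>X. \<forall>G\<in>X. m \<le> G"
        using that(1) False that(2)
      proof (induction X rule: finite_ne_induct)
        case (insert G X)
        then obtain m where m: "m \<in> X" "\<forall>H\<in>X. m \<le> H" by auto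
        have "m \<le> G \<or> G \<le> m"
          using insert.prems m tot by blast
        then show ?case
        proof (elim disjE)
          show "\<exists>n\<in>insert G X. \<forall>H\<in>insert G X. n \<le> H" if "G \<le> m"
            using that m order_trans[of G m] by (intro bexI[of _ G]) auto
        qed (use m insert.prems in auto)
      qed auto
      then obtain m where "m \<in> X" "\<forall>G\<in>X. m \<le> G" by blast
      then have "m \<le> Inf X" "m \<noteq> bot"
        using CA that by (auto intro: Inf_greatest)
      then show ?thesis
        using bot.extremum_uniqueI[of m] by auto
    qed
    then have "Inf C \<noteq> bot"
      by (rule Inf_filter_not_bot)
    moreover have "Inf C \<le> F"
    proof -
      obtain G where "G \<in> C" using False by blast
      then show ?thesis
        using CA by (intro Inf_lower2[of G]) auto
    qed
    ultimately show ?thesis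
      by (intro bexI[of _ "Inf C"]) (auto intro: Inf_lower)
  qed
  ultimately have "\<exists>U\<in>?A. \<forall>G\<in>?A. G \<le> U \<longrightarrow> G = U"
    by (rule predicate_Zorn)
  then obtain U where U: "U \<noteq> bot" "U \<le> F"
    and "\<forall>G\<in>?A. G \<le> U \<longrightarrow> G = U"
    by blast
  then have min: "G = U" if "G \<noteq> bot" "G \<le> U" for G
    using that order_trans[OF that(2) \<open>U \<le> F\<close>] by simp
  \<comment> \<open>Minimality is tested on the trace of \<open>U\<close> on
    \<open>{i. P i}\<close>: an improper trace makes the complement eventual, and a proper one
    equals \<open>U\<close>.\<close>
  have "eventually P U \<or> eventually (\<lambda>i. \<not> P i) U" for P
  proof (cases "inf U (principal {i. P i}) = bot")
    case True
    then show ?thesis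
      by (simp add: trivial_limit_def eventually_inf_principal)
  next
    case False
    then have "inf U (principal {i. P i}) = U"
      by (rule min) simp
    then have "U \<le> principal {i. P i}"
      by (metis inf.cobounded2)
    then show ?thesis
      by (auto simp: le_principal)
  qed
  with U show ?thesis
    by (auto simp: ultrafilter_def)
qed

section \<open>Interchange of limits along an ultrafilter\<close>

text \<open>A single ultrafilter serves for both iterated limits. The contradictions below come from
  two sequences with a common index set, and what they need of \<open>U\<close> is that it contains
  every tail of the natural numbers.\<close>

locale free_ultrafilter =
  fixes U :: "nat filter"
  assumes ultra: "ultrafilter U"
    and le_sequentially: "U \<le> sequentially"
begin

lemma U_neq_bot [simp]: "U \<noteq> bot"
  using ultra by (simp add: ultrafilter_def)

lemma not_eventually_U: "\<not> eventually P U \<longleftrightarrow> eventually (\<lambda>n. \<not> P n) U"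
proof
  assume "\<not> eventually P U"
  then show "eventually (\<lambda>n. \<not> P n) U"
    using ultra by (auto simp: ultrafilter_def)
next
  assume *: "eventually (\<lambda>n. \<not> P n) U"
  show "\<not> eventually P U"
  proof
    assume "eventually P U"
    then have "eventually (\<lambda>n. False) U"
      using * by eventually_elim auto
    then show False by simp
  qed
qed

lemma eventually_U_gt: "eventually (\<lambda>n. n > N) U"
  using le_sequentially eventually_gt_at_top[of N] filter_leD by blast

lemma eventually_U_ex: "eventually P U \<Longrightarrow> \<exists>n. P n"
  using eventually_happens[of P U] by simp

lemma nonprincipal: "nonprincipal_ultrafilter U"
  unfolding nonprincipal_ultrafilter_def
proof (intro conjI allI notI ultra)
  fix i assume "U = principal {i}"
  then show False
    using eventually_U_gt[of i] by (simp add: eventually_principal)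
qed

text \<open>\<open>Lim\<close> is a definite description, so the value is meaningful only where the
  limit exists. Along an ultrafilter boundedness guarantees this, whence the bounds in most of the
  rules below.\<close>

definition ulim :: "(nat \<Rightarrow> real) \<Rightarrow> real"
  where "ulim f = Lim U f"

lemma ulim_eqI: "(f \<longlongrightarrow> l) U \<Longrightarrow> ulim f = l"
  by (simp add: ulim_def tendsto_Lim)

lemma tendsto_ulim:
  assumes "eventually (\<lambda>n. \<bar>f n\<bar> \<le> B) U"
  shows "(f \<longlongrightarrow> ulim f) U"
proof -
  have "compact {-B..B}" by simp
  moreover have "filtermap f U \<noteq> bot"
    by (simp add: filtermap_bot_iff)
  moreover have "eventually (\<lambda>x. x \<in> {-B..B}) (filtermap f U)"
    using assms unfolding eventually_filtermap by eventually_elim auto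
  ultimately obtain l where l: "inf (nhds l) (filtermap f U) \<noteq> bot"
    unfolding compact_filter by blast
  \<comment> \<open>A cluster point of an ultrafilter is its limit: if the preimage of a
    neighbourhood is not in \<open>U\<close>, the preimage of the complement is.\<close>
  have "(f \<longlongrightarrow> l) U"
  proof (rule topological_tendstoI, rule ccontr)
    fix S assume S: "open S" "l \<in> S" "\<not> eventually (\<lambda>n. f n \<in> S) U"
    then have "eventually (\<lambda>n. f n \<notin> S) U"
      by (simp add: not_eventually_U)
    then have "eventually (\<lambda>x. x \<notin> S) (filtermap f U)"
      by (simp add: eventually_filtermap)
    moreover have "eventually (\<lambda>x. x \<in> S) (nhds l)"
      using S by (simp add: eventually_nhds_in_open)
    ultimately have "eventually (\<lambda>x. False) (inf (nhds l) (filtermap f U))"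
      unfolding eventually_inf by blast
    with l show False by simp
  qed
  then show ?thesis
    using ulim_eqI by blast
qed

lemma tendsto_ulim': "(\<And>n. \<bar>f n\<bar> \<le> B) \<Longrightarrow> (f \<longlongrightarrow> ulim f) U"
  by (rule tendsto_ulim[of _ B]) simp

lemma ulim_cong: "eventually (\<lambda>n. f n = g n) U \<Longrightarrow> ulim f = ulim g"
  unfolding ulim_def Topological_Spaces.Lim_def
  by (rule arg_cong[of _ _ The]) (rule ext, rule tendsto_cong)

lemma ulim_mono:
  assumes "\<And>n. \<bar>f n\<bar> \<le> B" "\<And>n. \<bar>g n\<bar> \<le> C" "eventually (\<lambda>n. f n \<le> g n) U"
  shows "ulim f \<le> ulim g"
  using tendsto_le[OF U_neq_bot tendsto_ulim'[OF assms(2)] tendsto_ulim'[OF assms(1)] assms(3)] .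

lemma ulim_le:
  assumes "\<And>n. \<bar>f n\<bar> \<le> B" "eventually (\<lambda>n. f n \<le> c) U"
  shows "ulim f \<le> c"
  using tendsto_upperbound[OF tendsto_ulim'[OF assms(1)] assms(2)] by simp

lemma ulim_ge:
  assumes "\<And>n. \<bar>f n\<bar> \<le> B" "eventually (\<lambda>n. c \<le> f n) U"
  shows "c \<le> ulim f"
  using tendsto_lowerbound[OF tendsto_ulim'[OF assms(1)] assms(2)] by simp

lemma abs_ulim_le:
  assumes "\<And>n. \<bar>f n\<bar> \<le> B"
  shows "\<bar>ulim f\<bar> \<le> B"
proof -
  have "f n \<le> B" "-B \<le> f n" for n
    using assms[of n] by linarith+
  then show ?thesis
    using ulim_le[of f B B] ulim_ge[of f B "-B"] assms by (simp add: abs_le_iff)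
qed

lemma ulim_uminus: "(\<And>n. \<bar>f n\<bar> \<le> B) \<Longrightarrow> ulim (\<lambda>n. - f n) = - ulim f"
  by (rule ulim_eqI, rule tendsto_minus, rule tendsto_ulim')

lemma ulim_add:
  "(\<And>n. \<bar>f n\<bar> \<le> B) \<Longrightarrow> (\<And>n. \<bar>g n\<bar> \<le> C) \<Longrightarrow> ulim (\<lambda>n. f n + g n) = ulim f + ulim g"
  by (rule ulim_eqI, rule tendsto_add; rule tendsto_ulim')

lemma ulim_diff:
  "(\<And>n. \<bar>f n\<bar> \<le> B) \<Longrightarrow> (\<And>n. \<bar>g n\<bar> \<le> C) \<Longrightarrow> ulim (\<lambda>n. f n - g n) = ulim f - ulim g"
  by (rule ulim_eqI, rule tendsto_diff; rule tendsto_ulim')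

lemma ulim_mult:
  "(\<And>n. \<bar>f n\<bar> \<le> B) \<Longrightarrow> (\<And>n. \<bar>g n\<bar> \<le> C) \<Longrightarrow> ulim (\<lambda>n. f n * g n) = ulim f * ulim g"
  by (rule ulim_eqI, rule tendsto_mult; rule tendsto_ulim')

lemma ulim_cmult: "(\<And>n. \<bar>f n\<bar> \<le> B) \<Longrightarrow> ulim (\<lambda>n. c * f n) = c * ulim f"
  by (rule ulim_eqI, rule tendsto_mult_left, rule tendsto_ulim')

lemma ulim_const [simp]: "ulim (\<lambda>n. c) = c"
  by (rule ulim_eqI) simp

text \<open>Grothendieck's double limit condition, with both limits taken along
  \<open>U\<close>.\<close>

definition interchange :: "('x \<Rightarrow> 'y \<Rightarrow> real) \<Rightarrow> 'x set \<Rightarrow> 'y set \<Rightarrow> bool"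
  where "interchange k X Y \<longleftrightarrow> (\<forall>x y. range x \<subseteq> X \<longrightarrow> range y \<subseteq> Y \<longrightarrow>
    ulim (\<lambda>m. ulim (\<lambda>n. k (x m) (y n))) = ulim (\<lambda>n. ulim (\<lambda>m. k (x m) (y n))))"

lemma interchangeD:
  "interchange k X Y \<Longrightarrow> (\<And>m. x m \<in> X) \<Longrightarrow> (\<And>n. y n \<in> Y) \<Longrightarrow>
    ulim (\<lambda>m. ulim (\<lambda>n. k (x m) (y n))) = ulim (\<lambda>n. ulim (\<lambda>m. k (x m) (y n)))"
  unfolding interchange_def by blast

lemma interchange_flip: "interchange k X Y \<Longrightarrow> interchange (\<lambda>y x. k x y) Y X"
  unfolding interchange_def by (intro allI impI) (rule sym, blast)

lemma interchange_uminus: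
  assumes "interchange k X Y" and B: "\<And>x y. x \<in> X \<Longrightarrow> y \<in> Y \<Longrightarrow> \<bar>k x y\<bar> \<le> B"
  shows "interchange (\<lambda>x y. - k x y) X Y"
  unfolding interchange_def
proof (intro allI impI)
  fix x :: "nat \<Rightarrow> _" and y :: "nat \<Rightarrow> _" assume "range x \<subseteq> X" "range y \<subseteq> Y"
  then have xy: "x m \<in> X" "y n \<in> Y" for m n by auto
  then have "\<bar>k (x m) (y n)\<bar> \<le> B" for m n
    using B by blast
  then have "ulim (\<lambda>n. - k (x m) (y n)) = - ulim (\<lambda>n. k (x m) (y n))"
    "ulim (\<lambda>m. - k (x m) (y n)) = - ulim (\<lambda>m. k (x m) (y n))"
    "ulim (\<lambda>m. - ulim (\<lambda>n. k (x m) (y n))) = - ulim (\<lambda>m. ulim (\<lambda>n. k (x m) (y n)))"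
    "ulim (\<lambda>n. - ulim (\<lambda>m. k (x m) (y n))) = - ulim (\<lambda>n. ulim (\<lambda>m. k (x m) (y n)))" for m n
    by (intro ulim_uminus[of _ B] abs_ulim_le; simp)+
  then show "ulim (\<lambda>m. ulim (\<lambda>n. - k (x m) (y n))) = ulim (\<lambda>n. ulim (\<lambda>m. - k (x m) (y n)))"
    using interchangeD[OF assms(1) xy] by simp
qed

text \<open>For fixed \<open>j\<close> almost all \<open>i\<close> exceed \<open>j\<close>, and for
  fixed \<open>i\<close> almost all \<open>j\<close> exceed \<open>i\<close>. So one iterated limit
  is at least \<open>ulim g + b\<close> and the other at most \<open>ulim g + a\<close>. Both
  compactness arguments end by producing such sequences with \<open>a < b\<close>.\<close>

lemma interchange_no_order:
  fixes x :: "nat \<Rightarrow> 'x" and y :: "nat \<Rightarrow> 'y" and g :: "nat \<Rightarrow> real"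
  assumes "interchange k X Y" and B: "\<And>x y. x \<in> X \<Longrightarrow> y \<in> Y \<Longrightarrow> \<bar>k x y\<bar> \<le> B"
    and x: "\<And>i. x i \<in> X" and y: "\<And>j. y j \<in> Y" and C: "\<And>i. \<bar>g i\<bar> \<le> C"
    and lt: "\<And>i j. i < j \<Longrightarrow> k (x i) (y j) \<le> g i + a"
    and ge: "\<And>i j. j \<le> i \<Longrightarrow> g i + b \<le> k (x i) (y j)"
  shows "b \<le> a"
proof -
  have ga: "\<bar>g i + c\<bar> \<le> C + \<bar>c\<bar>" for i c
    using C[of i] by linarith
  have kB: "\<bar>k (x i) (y j)\<bar> \<le> B" "\<bar>ulim (\<lambda>i. k (x i) (y j))\<bar> \<le> B" "\<bar>ulim (\<lambda>j. k (x i) (y j))\<bar> \<le> B" for i j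
    by (intro abs_ulim_le B x y)+
  have gc: "ulim (\<lambda>i. g i + c) = ulim g + c" for c
    by (subst ulim_add[OF C, of _ "\<bar>c\<bar>"]) auto
  have "ulim g + b \<le> ulim (\<lambda>i. k (x i) (y j))" for j
    unfolding gc[symmetric]
  proof (rule ulim_mono[OF ga kB(1)])
    show "eventually (\<lambda>i. g i + b \<le> k (x i) (y j)) U"
      using eventually_U_gt[of j] by eventually_elim (simp add: ge)
  qed
  then have "ulim g + b \<le> ulim (\<lambda>j. ulim (\<lambda>i. k (x i) (y j)))"
    using kB(2) by (intro ulim_ge[of _ B]) auto
  also have "\<dots> = ulim (\<lambda>i. ulim (\<lambda>j. k (x i) (y j)))"
    using interchangeD[OF assms(1) x y] by simp
  also have "\<dots> \<le> ulim (\<lambda>i. g i + a)"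
  proof (rule ulim_mono[OF kB(3) ga], rule always_eventually, rule allI)
    fix i
    have "eventually (\<lambda>j. k (x i) (y j) \<le> g i + a) U"
      using eventually_U_gt[of i] by eventually_elim (simp add: lt)
    then show "ulim (\<lambda>j. k (x i) (y j)) \<le> g i + a"
      by (rule ulim_le[OF kB(1)])
  qed
  finally show ?thesis by (simp add: gc)
qed

end

lemma free_ultrafilter_exists: "\<exists>U. free_ultrafilter U"
  using ultrafilter_below[OF sequentially_bot] unfolding free_ultrafilter_def by blast

section \<open>Finitely supported combinations\<close>

abbreviation coeff :: "('x \<Rightarrow>\<^sub>0 real) \<Rightarrow> 'x \<Rightarrow> real"
  where "coeff \<equiv> Poly_Mapping.lookup"

text \<open>A finitely supported function is read either as a signed measure or as a formal linear
  combination. If its support consists of functions \<open>a\<close>, then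
  \<open>pairing \<alpha> (\<lambda>a. a w)\<close> is the value at \<open>w\<close> of that
  combination.\<close>

definition pairing :: "('x \<Rightarrow>\<^sub>0 real) \<Rightarrow> ('x \<Rightarrow> real) \<Rightarrow> real"
  where "pairing \<mu> f = (\<Sum>x\<in>Poly_Mapping.keys \<mu>. coeff \<mu> x * f x)"

text \<open>Formal absolutely convex combinations: for nonempty \<open>X\<close> they represent the
  points of conv (X \<union> -X).\<close>

definition l1_ball :: "'x set \<Rightarrow> ('x \<Rightarrow>\<^sub>0 real) set"
  where "l1_ball X = {\<mu>. Poly_Mapping.keys \<mu> \<subseteq> X \<and> norm \<mu> \<le> 1}"

lemma norm_poly_mapping_eq: "norm \<mu> = (\<Sum>x\<in>Poly_Mapping.keys \<mu>. \<bar>coeff \<mu> x\<bar>)"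
  for \<mu> :: "'x \<Rightarrow>\<^sub>0 real"
  by (simp add: norm_poly_mapping_def dist_poly_mapping_def)

lemma lookup_scaleR [simp]: "coeff (r *\<^sub>R \<mu>) x = r * coeff \<mu> x"
proof -
  have "finite {i. r * coeff \<mu> i \<noteq> 0}"
    by (rule finite_subset[OF _ finite_keys[of \<mu>]]) (auto simp: in_keys_iff)
  then show ?thesis
    by (simp add: scaleR_poly_mapping_def)
qed

lemma pairing_superset:
  assumes "finite F" "Poly_Mapping.keys \<mu> \<subseteq> F"
  shows "pairing \<mu> f = (\<Sum>x\<in>F. coeff \<mu> x * f x)"
  unfolding pairing_def by (rule sum.mono_neutral_left) (use assms in \<open>auto simp: in_keys_iff\<close>)

lemma norm_superset:
  fixes \<mu> :: "'x \<Rightarrow>\<^sub>0 real"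
  assumes "finite F" "Poly_Mapping.keys \<mu> \<subseteq> F"
  shows "norm \<mu> = (\<Sum>x\<in>F. \<bar>coeff \<mu> x\<bar>)"
  unfolding norm_poly_mapping_eq
  by (rule sum.mono_neutral_left) (use assms in \<open>auto simp: in_keys_iff\<close>)

lemma keys_scaleR: "Poly_Mapping.keys (r *\<^sub>R \<mu>) \<subseteq> Poly_Mapping.keys \<mu>" for \<mu> :: "'x \<Rightarrow>\<^sub>0 real"
  by (auto simp: in_keys_iff)

lemma pairing_add_left: "pairing (\<mu> + \<nu>) f = pairing \<mu> f + pairing \<nu> f"
proof -
  let ?F = "Poly_Mapping.keys \<mu> \<union> Poly_Mapping.keys \<nu>"
  have "Poly_Mapping.keys (\<mu> + \<nu>) \<subseteq> ?F"
    by (rule keys_add)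
  then show ?thesis
    by (simp add: pairing_superset[of ?F] lookup_add distrib_right sum.distrib)
qed

lemma pairing_scaleR_left: "pairing (r *\<^sub>R \<mu>) f = r * pairing \<mu> f"
  using keys_scaleR[of r \<mu>]
  by (simp add: pairing_superset[of "Poly_Mapping.keys \<mu>"] sum_distrib_left mult.assoc)

lemma pairing_zero_left [simp]: "pairing 0 f = 0"
  by (simp add: pairing_def)

lemma pairing_uminus_left: "pairing (- \<mu>) f = - pairing \<mu> f"
  using pairing_scaleR_left[of "-1" \<mu> f] by simp

lemma pairing_sum_left: "pairing (\<Sum>i\<in>I. \<mu> i) f = (\<Sum>i\<in>I. pairing (\<mu> i) f)"
  by (induction I rule: infinite_finite_induct) (auto simp: pairing_add_left)

lemma pairing_add_right: "pairing \<mu> (\<lambda>x. f x + g x) = pairing \<mu> f + pairing \<mu> g"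
  by (simp add: pairing_def distrib_left sum.distrib)

lemma pairing_diff_right: "pairing \<mu> (\<lambda>x. f x - g x) = pairing \<mu> f - pairing \<mu> g"
  by (simp add: pairing_def right_diff_distrib sum_subtractf)

lemma pairing_mult_right: "pairing \<mu> (\<lambda>x. c * f x) = c * pairing \<mu> f"
  by (simp add: pairing_def sum_distrib_left mult.left_commute)

lemma pairing_zero_right [simp]: "pairing \<mu> (\<lambda>x. 0) = 0"
  by (simp add: pairing_def)

lemma pairing_swap:
  "pairing \<mu> (\<lambda>x. pairing \<nu> (\<lambda>y. k x y)) = pairing \<nu> (\<lambda>y. pairing \<mu> (\<lambda>x. k x y))"
  unfolding pairing_def sum_distrib_left
  by (subst sum.swap) (simp add: mult.left_commute)

lemma pairing_single [simp]: "pairing (Poly_Mapping.single x r) f = r * f x"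
  by (cases "r = 0") (auto simp: pairing_def)

lemma pairing_cong: "(\<And>x. x \<in> Poly_Mapping.keys \<mu> \<Longrightarrow> f x = g x) \<Longrightarrow> pairing \<mu> f = pairing \<mu> g"
  by (simp add: pairing_def)

lemma norm_single [simp]: "norm (Poly_Mapping.single x r) = \<bar>r\<bar>" for r :: real
  by (cases "r = 0") (auto simp: norm_poly_mapping_eq)

lemma abs_pairing_le:
  assumes "\<And>x. x \<in> Poly_Mapping.keys \<mu> \<Longrightarrow> \<bar>f x\<bar> \<le> B"
  shows "\<bar>pairing \<mu> f\<bar> \<le> B * norm \<mu>"
proof -
  have "\<bar>pairing \<mu> f\<bar> \<le> (\<Sum>x\<in>Poly_Mapping.keys \<mu>. \<bar>coeff \<mu> x * f x\<bar>)"
    unfolding pairing_def by (rule sum_abs)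
  also have "\<dots> \<le> (\<Sum>x\<in>Poly_Mapping.keys \<mu>. B * \<bar>coeff \<mu> x\<bar>)"
    by (rule sum_mono) (use assms in \<open>simp add: abs_mult mult.commute mult_right_mono\<close>)
  finally show ?thesis
    by (simp add: norm_poly_mapping_eq sum_distrib_left)
qed

lemma abs_pairing_l1_ball_le:
  assumes "\<mu> \<in> l1_ball X" "\<And>x. x \<in> X \<Longrightarrow> \<bar>f x\<bar> \<le> B" "0 \<le> B"
  shows "\<bar>pairing \<mu> f\<bar> \<le> B"
proof -
  have "\<bar>pairing \<mu> f\<bar> \<le> B * norm \<mu>"
    using assms by (intro abs_pairing_le) (auto simp: l1_ball_def)
  also have "\<dots> \<le> B * 1"
    using assms by (intro mult_left_mono) (auto simp: l1_ball_def)
  finally show ?thesis by simp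
qed

lemma pairing_mono:
  assumes "\<And>x. 0 \<le> coeff \<mu> x" "\<And>x. x \<in> Poly_Mapping.keys \<mu> \<Longrightarrow> f x \<le> g x"
  shows "pairing \<mu> f \<le> pairing \<mu> g"
  unfolding pairing_def by (rule sum_mono) (simp add: assms mult_left_mono)

text \<open>The Jordan decomposition. It reduces the interchange of limits to nonnegative
  combinations, for which the induced set functions are monotone.\<close>

lemma l1_ball_decompose:
  assumes "\<mu> \<in> l1_ball X"
  obtains \<mu>p \<mu>n where "\<mu> = \<mu>p - \<mu>n" "\<mu>p \<in> l1_ball X" "\<mu>n \<in> l1_ball X"
    "\<And>x. 0 \<le> coeff \<mu>p x" "\<And>x. 0 \<le> coeff \<mu>n x"
proof -
  define \<mu>p where "\<mu>p = Poly_Mapping.map (\<lambda>r. max r 0) \<mu>"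
  define \<mu>n where "\<mu>n = Poly_Mapping.map (\<lambda>r. max (-r) 0) \<mu>"
  have p: "coeff \<mu>p x = max (coeff \<mu> x) 0" and n: "coeff \<mu>n x = max (- coeff \<mu> x) 0" for x
    by (auto simp: \<mu>p_def \<mu>n_def map.rep_eq when_def)
  have kp: "Poly_Mapping.keys \<mu>p \<subseteq> Poly_Mapping.keys \<mu>" and kn: "Poly_Mapping.keys \<mu>n \<subseteq> Poly_Mapping.keys \<mu>"
    by (auto simp: in_keys_iff p n)
  have "norm \<mu>p \<le> norm \<mu>"
    unfolding norm_superset[OF finite_keys kp] norm_poly_mapping_eq[of \<mu>]
    by (auto intro!: sum_mono simp: p)
  moreover have "norm \<mu>n \<le> norm \<mu>"
    unfolding norm_superset[OF finite_keys kn] norm_poly_mapping_eq[of \<mu>]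
    by (auto intro!: sum_mono simp: n)
  moreover have "\<mu> = \<mu>p - \<mu>n"
    by (rule poly_mapping_eqI) (simp add: lookup_minus p n)
  ultimately show ?thesis
    using assms kp kn by (intro that[of \<mu>p \<mu>n]) (auto simp: l1_ball_def p n)
qed

section \<open>Interchange of limits on absolutely convex hulls\<close>

context free_ultrafilter
begin

lemma pairing_ulim:
  assumes "\<And>x n. x \<in> Poly_Mapping.keys \<mu> \<Longrightarrow> \<bar>f n x\<bar> \<le> B"
  shows "ulim (\<lambda>n. pairing \<mu> (f n)) = pairing \<mu> (\<lambda>x. ulim (\<lambda>n. f n x))"
  unfolding pairing_def
  by (rule ulim_eqI, rule tendsto_sum, rule tendsto_mult_left, rule tendsto_ulim') (rule assms)

text \<open>This replaces the dominated convergence theorem for the finitely additive measure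
  \<open>mu = ulim \<mu>\<^sub>m\<close>: if \<open>k x (y\<^sub>n)\<close> exceeds its limit by \<open>\<epsilon>\<close> on sets \<open>S\<^sub>n\<close> of measure bounded below,
  then infinitely many of the \<open>S\<^sub>n\<close> have the finite intersection property, and points of
  the finite intersections violate the interchange of limits.\<close>

lemma interchange_pairing_aux:
  fixes k :: "'x \<Rightarrow> 'y \<Rightarrow> real" and \<mu> :: "nat \<Rightarrow> 'x \<Rightarrow>\<^sub>0 real"
  assumes k: "interchange k X Y" and B: "\<And>x y. x \<in> X \<Longrightarrow> y \<in> Y \<Longrightarrow> \<bar>k x y\<bar> \<le> B" "B > 0"
    and \<mu>: "\<And>m. \<mu> m \<in> l1_ball X" and pos: "\<And>m x. 0 \<le> coeff (\<mu> m) x" and y: "\<And>n. y n \<in> Y"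
  shows "ulim (\<lambda>n. ulim (\<lambda>m. pairing (\<mu> m) (\<lambda>x. k x (y n))))
    \<le> ulim (\<lambda>m. ulim (\<lambda>n. pairing (\<mu> m) (\<lambda>x. k x (y n))))"
proof (rule ccontr)
  define w where "w x = ulim (\<lambda>n. k x (y n))" for x
  define \<alpha> where "\<alpha> = ulim (\<lambda>m. pairing (\<mu> m) w)"
  define \<beta> where "\<beta> = (\<lambda>n. ulim (\<lambda>m. pairing (\<mu> m) (\<lambda>x. k x (y n))))"
  assume "\<not> ?thesis"
  moreover have keys: "x \<in> X" if "x \<in> Poly_Mapping.keys (\<mu> m)" for x m
    using \<mu>[of m] that by (auto simp: l1_ball_def)
  moreover have "ulim (\<lambda>n. pairing (\<mu> m) (\<lambda>x. k x (y n))) = pairing (\<mu> m) w" for m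
    unfolding w_def by (rule pairing_ulim[of _ _ B]) (use keys B y in auto)
  ultimately have less: "\<alpha> < ulim \<beta>"
    by (simp add: \<alpha>_def \<beta>_def)
  \<comment> \<open>A third of the gap: \<open>\<beta> n - \<alpha>\<close> exceeds
    \<open>2 * \<epsilon>\<close> for almost all \<open>n\<close>, and the points outside
    \<open>S n\<close> account for at most \<open>\<epsilon>\<close> of it. The other
    \<open>\<epsilon>\<close> forces \<open>S n\<close> to have measure at least
    \<open>\<epsilon> / (2 * B)\<close>.\<close>
  define \<epsilon> where "\<epsilon> = (ulim \<beta> - \<alpha>) / 3"
  have "\<epsilon> > 0" using less by (simp add: \<epsilon>_def)
  have kB: "\<bar>k x (y n)\<bar> \<le> B" if "x \<in> X" for x n
    using B y that by auto
  have wB: "\<bar>w x\<bar> \<le> B" if "x \<in> X" for x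
    unfolding w_def using kB that by (intro abs_ulim_le)
  have bnd: "\<bar>pairing (\<mu> m) f\<bar> \<le> C" if "\<And>x. x \<in> X \<Longrightarrow> \<bar>f x\<bar> \<le> C" "0 \<le> C" for m f C
    using abs_pairing_l1_ball_le[OF \<mu> that] .
  have \<beta>B: "\<bar>\<beta> n\<bar> \<le> B" for n
    unfolding \<beta>_def by (intro abs_ulim_le bnd kB) (use B in auto)
  define S where "S n = {x \<in> X. w x + \<epsilon> \<le> k x (y n)}" for n
  define mu where "mu T = ulim (\<lambda>m. pairing (\<mu> m) (indicator T))" for T
  \<comment> \<open>The measure that \<open>T\<close> keeps in common with almost every
    \<open>S n\<close>. It is again monotone and additive, and its positivity is the invariant under
    which \<open>T\<close> can be intersected with further sets \<open>S n\<close>.\<close>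
  define \<tau> where "\<tau> T = ulim (\<lambda>n. mu (T \<inter> S n))" for T
  have ind: "\<bar>pairing (\<mu> m) (indicator T)\<bar> \<le> 1" for m T
    by (rule bnd) (auto simp: indicator_def)
  have mu_le: "\<bar>mu T\<bar> \<le> 1" for T
    unfolding mu_def using ind by (rule abs_ulim_le)
  have mu_mono: "mu T \<le> mu T'" if "T \<subseteq> T'" for T T'
    unfolding mu_def
    by (rule ulim_mono[OF ind ind], rule always_eventually, rule allI, rule pairing_mono)
      (use pos that in \<open>auto simp: indicator_def\<close>)
  have mu_diff: "mu (T - T') = mu T - mu (T \<inter> T')" for T T'
  proof -
    have "pairing (\<mu> m) (indicator (T - T')) = pairing (\<mu> m) (indicator T) - pairing (\<mu> m) (indicator (T \<inter> T'))" for m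
      unfolding pairing_diff_right[symmetric]
      by (rule pairing_cong) (auto simp: indicator_def)
    then show ?thesis
      unfolding mu_def by (simp add: ulim_diff[OF ind ind])
  qed
  have mu_nonneg: "0 \<le> mu T" for T
    using mu_mono[of "{}" T] by (simp add: mu_def cong: pairing_cong)
  have \<tau>_le: "\<bar>\<tau> T\<bar> \<le> 1" for T
    unfolding \<tau>_def using mu_le by (rule abs_ulim_le)
  have \<tau>_mono: "\<tau> T \<le> \<tau> T'" if "T \<subseteq> T'" for T T'
    unfolding \<tau>_def using that
    by (intro ulim_mono[OF mu_le mu_le] always_eventually allI mu_mono) auto
  have \<tau>_diff: "\<tau> (T - T') = \<tau> T - \<tau> (T \<inter> T')" for T T'
  proof -
    have "mu ((T - T') \<inter> S n) = mu (T \<inter> S n) - mu (T \<inter> T' \<inter> S n)" for n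
    proof -
      have "(T - T') \<inter> S n = T \<inter> S n - T'" "T \<inter> T' \<inter> S n = T \<inter> S n \<inter> T'"
        by blast+
      then show ?thesis
        using mu_diff[of "T \<inter> S n" T'] by simp
    qed
    then show ?thesis
      unfolding \<tau>_def by (simp add: ulim_diff[OF mu_le mu_le])
  qed
  have \<tau>_nonneg: "0 \<le> \<tau> T" for T
    unfolding \<tau>_def by (rule ulim_ge[OF mu_le]) (simp add: mu_nonneg)

  have "eventually (\<lambda>n. \<alpha> + 2 * \<epsilon> < \<beta> n) U"
    using tendsto_ulim'[of \<beta>, OF \<beta>B] by (rule order_tendstoD) (use less in \<open>simp add: \<epsilon>_def field_simps\<close>)
  then have "eventually (\<lambda>n. \<epsilon> / (2 * B) \<le> mu (UNIV \<inter> S n)) U"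
  proof eventually_elim
    case (elim n)
    have "\<beta> n - \<alpha> = ulim (\<lambda>m. pairing (\<mu> m) (\<lambda>x. k x (y n) - w x))"
      unfolding \<beta>_def \<alpha>_def pairing_diff_right
      by (rule ulim_diff[symmetric]; rule bnd) (use kB wB B in auto)
    also have "\<dots> \<le> ulim (\<lambda>m. \<epsilon> + 2 * B * pairing (\<mu> m) (indicator (S n)))"
    proof (rule ulim_mono[of _ "2 * B" _ "\<epsilon> + 2 * B * 1"])
      show "\<bar>pairing (\<mu> m) (\<lambda>x. k x (y n) - w x)\<bar> \<le> 2 * B" for m
      proof (rule bnd)
        show "\<bar>k x (y n) - w x\<bar> \<le> 2 * B" if "x \<in> X" for x
          using kB[OF that, of n] wB[OF that] by linarith
      qed (use B in auto)
      show "\<bar>\<epsilon> + 2 * B * pairing (\<mu> m) (indicator (S n))\<bar> \<le> \<epsilon> + 2 * B * 1" for m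
      proof -
        have "0 \<le> pairing (\<mu> m) (indicator (S n))"
          using pairing_mono[OF pos, of m "\<lambda>x. 0" "indicator (S n)"] by simp
        moreover have "2 * B * pairing (\<mu> m) (indicator (S n)) \<le> 2 * B * 1"
          using ind[of m "S n"] B by (intro mult_left_mono) auto
        ultimately show ?thesis
          using \<open>\<epsilon> > 0\<close> B by (simp add: abs_of_nonneg)
      qed
      show "eventually (\<lambda>m. pairing (\<mu> m) (\<lambda>x. k x (y n) - w x) \<le> \<epsilon> + 2 * B * pairing (\<mu> m) (indicator (S n))) U"
      proof (rule always_eventually, rule allI)
        fix m
        have "pairing (\<mu> m) (\<lambda>x. k x (y n) - w x) \<le> pairing (\<mu> m) (\<lambda>x. \<epsilon> + 2 * B * indicator (S n) x)"
        proof (rule pairing_mono[OF pos])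
          fix x assume "x \<in> Poly_Mapping.keys (\<mu> m)"
          then have "x \<in> X" by (rule keys)
          then show "k x (y n) - w x \<le> \<epsilon> + 2 * B * indicator (S n) x"
            using kB[of x n] wB[of x] \<open>\<epsilon> > 0\<close> by (auto simp: S_def indicator_def)
        qed
        also have "\<dots> = pairing (\<mu> m) (\<lambda>x. \<epsilon>) + 2 * B * pairing (\<mu> m) (indicator (S n))"
          by (simp add: pairing_add_right pairing_mult_right)
        also have "pairing (\<mu> m) (\<lambda>x. \<epsilon>) \<le> \<epsilon>"
          using bnd[of "\<lambda>x. \<epsilon>" \<epsilon> m] \<open>\<epsilon> > 0\<close> by auto
        finally show "pairing (\<mu> m) (\<lambda>x. k x (y n) - w x) \<le> \<epsilon> + 2 * B * pairing (\<mu> m) (indicator (S n))"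
          by simp
      qed
    qed
    also have "\<dots> = \<epsilon> + 2 * B * mu (S n)"
    proof -
      have "\<bar>2 * B * pairing (\<mu> m) (indicator (S n))\<bar> \<le> 2 * B" for m
        using ind[of m "S n"] B by (simp add: abs_mult mult_left_le)
      then show ?thesis
        unfolding mu_def
        by (subst ulim_add[of _ "\<epsilon>" _ "2 * B"]) (use \<open>\<epsilon> > 0\<close> in \<open>auto simp: ulim_cmult[OF ind]\<close>)
    qed
    finally show ?case
      using elim B by (simp add: field_simps)
  qed
  then have "\<epsilon> / (2 * B) \<le> \<tau> UNIV"
    unfolding \<tau>_def by (rule ulim_ge[OF mu_le])
  then have \<tau>_UNIV: "\<tau> UNIV > 0"
    using \<open>\<epsilon> > 0\<close> B by (smt (verit) divide_pos_pos)

  \<comment> \<open>Exhaustion: otherwise a piece \<open>T' \<inter> S n\<close> of measure more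
    than \<open>\<tau> T / 2\<close> could be removed again and again without changing
    \<open>\<tau>\<close>, but the total measure is at most 1.\<close>
  have \<tau>_step: "eventually (\<lambda>n. \<tau> (T \<inter> S n) > 0) U" if T: "\<tau> T > 0" for T
  proof (rule ccontr)
    assume "\<not> ?thesis"
    then have ev0: "eventually (\<lambda>n. \<tau> (T \<inter> S n) = 0) U"
      unfolding not_eventually_U by eventually_elim (meson \<tau>_nonneg antisym linorder_not_less)
    have "\<exists>T'\<subseteq>T. \<tau> T' = \<tau> T \<and> mu T' \<le> 1 - j * (\<tau> T / 2)" for j :: nat
    proof (induction j)
      case 0
      then show ?case using mu_le[of T] by (intro exI[of _ T]) auto
    next
      case (Suc j)
      then obtain T' where T': "T' \<subseteq> T" "\<tau> T' = \<tau> T" "mu T' \<le> 1 - j * (\<tau> T / 2)" by blast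
      have "eventually (\<lambda>n. \<tau> T / 2 < mu (T' \<inter> S n)) U"
        using tendsto_ulim'[of "\<lambda>n. mu (T' \<inter> S n)", OF mu_le]
        by (rule order_tendstoD) (use T T' in \<open>simp add: \<tau>_def\<close>)
      then have "eventually (\<lambda>n. \<tau> T / 2 < mu (T' \<inter> S n) \<and> \<tau> (T \<inter> S n) = 0) U"
        using ev0 by eventually_elim simp
      then obtain n where n: "\<tau> T / 2 < mu (T' \<inter> S n)" "\<tau> (T \<inter> S n) = 0"
        using eventually_U_ex by blast
      have "\<tau> (T' \<inter> S n) \<le> \<tau> (T \<inter> S n)"
        using T'(1) by (intro \<tau>_mono) blast
      then have "\<tau> (T' \<inter> S n) = 0"
        using n(2) \<tau>_nonneg[of "T' \<inter> S n"] by simp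
      then have "\<tau> (T' - S n) = \<tau> T"
        using T' \<tau>_diff by simp
      moreover have "mu (T' - S n) \<le> 1 - Suc j * (\<tau> T / 2)"
        using n(1) T'(3) mu_diff[of T' "S n"] by (simp add: field_simps)
      ultimately show ?case
        using T'(1) by (intro exI[of _ "T' - S n"]) auto
    qed
    moreover obtain j :: nat where "j * (\<tau> T / 2) > 1"
      using reals_Archimedean3[of "\<tau> T / 2"] T by (meson half_gt_zero)
    ultimately obtain T' where "mu T' < 0"
      by (smt (verit, best))
    then show False
      using mu_nonneg[of T'] by simp
  qed

  \<comment> \<open>A state holds a set \<open>T\<close> inside every \<open>S n\<close> chosen so
    far, the finite set \<open>H\<close> of points chosen so far, and the newest index and point.
    The next index is taken so late that \<open>k h (y n')\<close> is close to its limit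
    \<open>w h\<close> for all old points, while the next point lies in all the chosen
    \<open>S n\<close>.\<close>
  define P where "P = (\<lambda>(T, H, n, x). \<tau> T > 0 \<and> finite H \<and> H \<subseteq> X \<and> T \<subseteq> S n \<and> x \<in> T \<and> x \<in> H)"
  define Q where "Q = (\<lambda>(T :: 'x set, H, n :: nat, x :: 'x) (T', H', n' :: nat, x' :: 'x).
    T' \<subseteq> T \<and> H \<subseteq> H' \<and> (\<forall>h\<in>H. k h (y n') < w h + \<epsilon> / 2))"
  have step: "\<exists>T' H' n' x'. P (T', H', n', x') \<and> Q (T, H, n, x) (T', H', n', x')"
    if T: "\<tau> T > 0" and H: "finite H" "H \<subseteq> X" for T H n x
  proof -
    have "eventually (\<lambda>n. k h (y n) < w h + \<epsilon> / 2) U" if "h \<in> H" for h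
    proof (rule order_tendstoD(2))
      show "((\<lambda>n. k h (y n)) \<longlongrightarrow> w h) U"
        unfolding w_def using kB H that by (intro tendsto_ulim') auto
    qed (use \<open>\<epsilon> > 0\<close> in simp)
    then have "eventually (\<lambda>n. \<forall>h\<in>H. k h (y n) < w h + \<epsilon> / 2) U"
      using H(1) by (intro eventually_ball_finite) auto
    then have "eventually (\<lambda>n. (\<forall>h\<in>H. k h (y n) < w h + \<epsilon> / 2) \<and> \<tau> (T \<inter> S n) > 0) U"
      using \<tau>_step[OF T] by eventually_elim simp
    then obtain n' where n': "\<forall>h\<in>H. k h (y n') < w h + \<epsilon> / 2" "\<tau> (T \<inter> S n') > 0"
      using eventually_U_ex by blast
    have "\<tau> {} = 0"
      using \<tau>_diff[of "{}" "{}"] by simp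
    then have "T \<inter> S n' \<noteq> {}"
      using n' by (metis less_irrefl)
    then obtain x' where "x' \<in> T \<inter> S n'" by blast
    then show ?thesis
      using n' H
      by (intro exI[of _ "T \<inter> S n'"] exI[of _ "insert x' H"] exI[of _ n'] exI[of _ x'])
        (auto simp: P_def Q_def S_def)
  qed
  have "\<exists>f. \<forall>i. P (f i) \<and> Q (f i) (f (Suc i))"
  proof (rule dependent_nat_choice)
    show "\<exists>s. P s"
      using step[OF \<tau>_UNIV, of "{}"] by blast
  next
    fix s i assume "P s"
    then show "\<exists>s'. P s' \<and> Q s s'"
      using step by (cases s) (auto simp: P_def)
  qed
  then obtain f where f: "\<And>i. P (f i)" "\<And>i. Q (f i) (f (Suc i))" by blast
  define T H n x where "T = (\<lambda>i. fst (f i))" and "H = (\<lambda>i. fst (snd (f i)))"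
    and "n = (\<lambda>i. fst (snd (snd (f i))))" and "x = (\<lambda>i. snd (snd (snd (f i))))"
  note defs = T_def H_def n_def x_def
  have P: "T i \<subseteq> S (n i)" "x i \<in> T i" "x i \<in> H i" "H i \<subseteq> X" for i
    using f(1)[of i] by (auto simp: P_def defs split: prod.splits)
  have Q: "T (Suc i) \<subseteq> T i" "H i \<subseteq> H (Suc i)" "\<And>h. h \<in> H i \<Longrightarrow> k h (y (n (Suc i))) < w h + \<epsilon> / 2" for i
    using f(2)[of i] by (auto simp: Q_def defs split: prod.splits)
  have xX: "x i \<in> X" for i
    using P by blast
  have "\<epsilon> \<le> \<epsilon> / 2"
  proof (rule interchange_no_order[OF k B(1), of x "\<lambda>i. y (n i)" "\<lambda>i. w (x i)" B])
    fix i j :: nat assume "i < j"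
    then obtain l where l: "j = Suc l" "i \<le> l"
      by (cases j) auto
    have "H i \<subseteq> H l"
      using lift_Suc_mono_le[of H, OF Q(2) l(2)] .
    then show "k (x i) (y (n j)) \<le> w (x i) + \<epsilon> / 2"
      using Q(3)[of "x i" l] P(3)[of i] l by (auto simp: less_imp_le)
  next
    fix i j :: nat assume "j \<le> i"
    then have "T i \<subseteq> T j"
      using lift_Suc_antimono_le[of T, OF Q(1)] by blast
    then show "w (x i) + \<epsilon> \<le> k (x i) (y (n j))"
      using P(1)[of j] P(2)[of i] by (auto simp: S_def)
  qed (use xX y wB in auto)
  then show False
    using \<open>\<epsilon> > 0\<close> by simp
qed

text \<open>The counterpart of Krein's theorem that weak compactness passes to closed convex hulls.
  The one-sided estimate for \<open>k\<close> and for \<open>- k\<close> gives equality for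
  nonnegative combinations, and the Jordan decomposition does the rest.\<close>

lemma interchange_l1_ball:
  fixes k :: "'x \<Rightarrow> 'y \<Rightarrow> real"
  assumes k: "interchange k X Y" and B: "\<And>x y. x \<in> X \<Longrightarrow> y \<in> Y \<Longrightarrow> \<bar>k x y\<bar> \<le> B" "B > 0"
  shows "interchange (\<lambda>\<mu> y. pairing \<mu> (\<lambda>x. k x y)) (l1_ball X) Y"
  unfolding interchange_def
proof (intro allI impI)
  fix \<mu> :: "nat \<Rightarrow> 'x \<Rightarrow>\<^sub>0 real" and y :: "nat \<Rightarrow> 'y"
  assume "range \<mu> \<subseteq> l1_ball X" "range y \<subseteq> Y"
  then have \<mu>: "\<And>m. \<mu> m \<in> l1_ball X" and y: "\<And>n. y n \<in> Y" by auto
  have bnd: "\<bar>pairing \<nu> (\<lambda>x. k x (y n))\<bar> \<le> B" if "\<nu> \<in> l1_ball X" for \<nu> n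
    by (rule abs_pairing_l1_ball_le[OF that]) (use B y in auto)
  have nonneg: "ulim (\<lambda>m. ulim (\<lambda>n. pairing (\<nu> m) (\<lambda>x. k x (y n)))) =
      ulim (\<lambda>n. ulim (\<lambda>m. pairing (\<nu> m) (\<lambda>x. k x (y n))))"
    if \<nu>: "\<And>m. \<nu> m \<in> l1_ball X" "\<And>m x. 0 \<le> coeff (\<nu> m) x" for \<nu>
  proof (rule antisym)
    show "ulim (\<lambda>n. ulim (\<lambda>m. pairing (\<nu> m) (\<lambda>x. k x (y n)))) \<le>
        ulim (\<lambda>m. ulim (\<lambda>n. pairing (\<nu> m) (\<lambda>x. k x (y n))))"
      by (rule interchange_pairing_aux[OF k B \<nu> y])
    have "ulim (\<lambda>n. ulim (\<lambda>m. pairing (\<nu> m) (\<lambda>x. - k x (y n)))) \<le>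
        ulim (\<lambda>m. ulim (\<lambda>n. pairing (\<nu> m) (\<lambda>x. - k x (y n))))"
      by (rule interchange_pairing_aux[OF interchange_uminus[OF k B(1)] _ B(2) \<nu> y]) (auto simp: B)
    moreover have "pairing (\<nu> m) (\<lambda>x. - k x (y n)) = - pairing (\<nu> m) (\<lambda>x. k x (y n))" for m n
      using pairing_mult_right[of "\<nu> m" "-1"] by simp
    moreover note ulim_uminus[of _ B] abs_ulim_le[of _ B] bnd[OF \<nu>(1)]
    ultimately show "ulim (\<lambda>m. ulim (\<lambda>n. pairing (\<nu> m) (\<lambda>x. k x (y n)))) \<le>
        ulim (\<lambda>n. ulim (\<lambda>m. pairing (\<nu> m) (\<lambda>x. k x (y n))))"
      by simp
  qed
  have "\<exists>\<nu> \<nu>'. \<mu> m = \<nu> - \<nu>' \<and> \<nu> \<in> l1_ball X \<and> \<nu>' \<in> l1_ball X \<and>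
      (\<forall>x. 0 \<le> coeff \<nu> x) \<and> (\<forall>x. 0 \<le> coeff \<nu>' x)" for m
    using l1_ball_decompose[OF \<mu>[of m]] by metis
  then obtain \<nu> \<nu>' where \<nu>: "\<And>m. \<mu> m = \<nu> m - \<nu>' m" "\<And>m. \<nu> m \<in> l1_ball X" "\<And>m. \<nu>' m \<in> l1_ball X"
    "\<And>m x. 0 \<le> coeff (\<nu> m) x" "\<And>m x. 0 \<le> coeff (\<nu>' m) x"
    by metis
  have split: "pairing (\<mu> m) f = pairing (\<nu> m) f - pairing (\<nu>' m) f" for m f
    using pairing_add_left[of "\<nu> m" "- \<nu>' m" f] by (simp add: \<nu>(1) pairing_uminus_left)
  show "ulim (\<lambda>m. ulim (\<lambda>n. pairing (\<mu> m) (\<lambda>x. k x (y n)))) =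
      ulim (\<lambda>n. ulim (\<lambda>m. pairing (\<mu> m) (\<lambda>x. k x (y n))))"
    using nonneg[OF \<nu>(2,4)] nonneg[OF \<nu>(3,5)]
    unfolding split
    by (simp add: ulim_diff[of _ B _ B] abs_ulim_le[of _ B] bnd \<nu>(2,3))
qed

end

section \<open>Separation and uniform approximation\<close>

text \<open>Hahn-Banach separation in the space of functions on \<open>F\<close>, by projection onto
  \<open>D\<close> in the Euclidean norm. As \<open>D\<close> need not be closed, an almost nearest
  point replaces the nearest one. Convexity is required only for the values on \<open>F\<close>,
  since in \<open>common_witness\<close> the combinations are controlled only there.\<close>

lemma finite_separation:
  fixes D :: "('i \<Rightarrow> real) set" and \<phi> :: "'i \<Rightarrow> real"
  assumes F: "finite F" and "D \<noteq> {}"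
    and conv: "\<And>d e t. d \<in> D \<Longrightarrow> e \<in> D \<Longrightarrow> 0 \<le> t \<Longrightarrow> t \<le> 1 \<Longrightarrow>
      \<exists>h\<in>D. \<forall>i\<in>F. h i = (1 - t) * d i + t * e i"
    and B: "\<And>d i. d \<in> D \<Longrightarrow> i \<in> F \<Longrightarrow> \<bar>d i\<bar> \<le> B"
    and sep: "\<And>c \<epsilon>. \<epsilon> > 0 \<Longrightarrow> \<exists>d\<in>D. (\<Sum>i\<in>F. c i * \<phi> i) \<le> (\<Sum>i\<in>F. c i * d i) + \<epsilon>"
    and "\<eta> > 0"
  shows "\<exists>d\<in>D. \<forall>i\<in>F. \<bar>d i - \<phi> i\<bar> \<le> \<eta>"
proof (rule ccontr)
  assume contra: "\<not> ?thesis"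
  define q where "q d = (\<Sum>i\<in>F. (d i - \<phi> i)\<^sup>2)" for d
  define s where "s = Inf (q ` D)"
  have q_ge: "\<eta>\<^sup>2 \<le> q d" if d: "d \<in> D" for d
  proof -
    obtain i where i: "i \<in> F" "\<bar>d i - \<phi> i\<bar> > \<eta>"
      using contra d by (meson not_le)
    then have "\<eta>\<^sup>2 \<le> (d i - \<phi> i)\<^sup>2"
      using \<open>\<eta> > 0\<close> power_mono[of \<eta> "\<bar>d i - \<phi> i\<bar>" 2] by simp
    also have "\<dots> \<le> q d"
      unfolding q_def using F i(1) by (intro member_le_sum) auto
    finally show ?thesis .
  qed
  have bdd: "bdd_below (q ` D)"
    using q_ge by (intro bdd_belowI[of _ "\<eta>\<^sup>2"]) auto
  have "\<eta>\<^sup>2 \<le> s"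
    unfolding s_def using \<open>D \<noteq> {}\<close> q_ge by (intro cInf_greatest) auto
  then have "s > 0"
    using zero_less_power[OF \<open>\<eta> > 0\<close>, of 2] by linarith
  have s_le: "s \<le> q d" if "d \<in> D" for d
    unfolding s_def using bdd that by (intro cInf_lower) auto
  define M where "M = real (card F) * (2 * B)\<^sup>2 + 1"
  have "M > 0" by (simp add: M_def add_nonneg_pos)
  have M: "(\<Sum>i\<in>F. (e i - d i)\<^sup>2) \<le> M" if "d \<in> D" "e \<in> D" for d e
  proof -
    have "(e i - d i)\<^sup>2 \<le> (2 * B)\<^sup>2" if "i \<in> F" for i
    proof -
      have "\<bar>e i - d i\<bar> \<le> \<bar>2 * B\<bar>"
        using B[OF \<open>d \<in> D\<close> that] B[OF \<open>e \<in> D\<close> that] by linarith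
      then show ?thesis
        by (simp add: abs_le_square_iff)
    qed
    then show ?thesis
      unfolding M_def using sum_bounded_above[of F "\<lambda>i. (e i - d i)\<^sup>2" "(2 * B)\<^sup>2"] by simp
  qed
  \<comment> \<open>Moving from \<open>d\<close> towards \<open>e\<close> by \<open>t\<close>
    changes \<open>q\<close> by a linear term and by at most \<open>t\<^sup>2 * M\<close>. With this
    \<open>t\<close>, the quadratic term and the slack allowed in the choice of \<open>d\<close> are
    each at most \<open>t * s / 2\<close>, which bounds the inner product of \<open>e - d\<close>
    and \<open>\<phi> - d\<close> by \<open>s / 2\<close>.\<close>
  define t where "t = min 1 (s / (2 * M))"
  have t: "0 < t" "t \<le> 1" "t * M \<le> s / 2"
  proof -
    show "t > 0" "t \<le> 1"
      using \<open>s > 0\<close> \<open>M > 0\<close> by (auto simp: t_def)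
    have "t \<le> s / (2 * M)" by (simp add: t_def)
    then show "t * M \<le> s / 2"
      using \<open>M > 0\<close> by (simp add: field_simps)
  qed
  have "Inf (q ` D) < s + t * s / 2"
    using t \<open>s > 0\<close> by (simp add: s_def)
  then obtain d where d: "d \<in> D" "q d < s + t * s / 2"
    using cInf_lessD[of "q ` D"] \<open>D \<noteq> {}\<close> by blast
  have half: "(\<Sum>i\<in>F. (e i - d i) * (\<phi> i - d i)) \<le> s / 2" if e: "e \<in> D" for e
  proof -
    obtain h where h: "h \<in> D" "\<And>i. i \<in> F \<Longrightarrow> h i = (1 - t) * d i + t * e i"
      using conv[OF d(1) e] t by (meson less_imp_le)
    have "q h = (\<Sum>i\<in>F. (d i - \<phi> i)\<^sup>2 - 2 * t * ((e i - d i) * (\<phi> i - d i)) + t\<^sup>2 * (e i - d i)\<^sup>2)"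
      unfolding q_def by (rule sum.cong) (auto simp: h(2) power2_eq_square algebra_simps)
    also have "\<dots> = q d - 2 * t * (\<Sum>i\<in>F. (e i - d i) * (\<phi> i - d i)) + t\<^sup>2 * (\<Sum>i\<in>F. (e i - d i)\<^sup>2)"
      by (simp add: q_def sum.distrib sum_subtractf sum_distrib_left)
    also have "\<dots> \<le> q d - 2 * t * (\<Sum>i\<in>F. (e i - d i) * (\<phi> i - d i)) + t\<^sup>2 * M"
      using M[OF d(1) e] by (simp add: mult_left_mono)
    also have "t\<^sup>2 * M \<le> t * (s / 2)"
      using t by (simp add: power2_eq_square mult.assoc)
    finally have "2 * t * (\<Sum>i\<in>F. (e i - d i) * (\<phi> i - d i)) \<le> 2 * t * (s / 2)"
      using s_le[OF h(1)] d(2) by (simp add: algebra_simps)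
    then show ?thesis
      using t by simp
  qed
  \<comment> \<open>The functional \<open>\<phi> - d\<close> would separate: testing with it gives
    \<open>q d \<le> s / 4 + s / 2\<close>, which is less than the infimum \<open>s\<close>.\<close>
  obtain e where e: "e \<in> D"
    "(\<Sum>i\<in>F. (\<phi> i - d i) * \<phi> i) \<le> (\<Sum>i\<in>F. (\<phi> i - d i) * e i) + s / 4"
    using sep[of "s / 4" "\<lambda>i. \<phi> i - d i"] \<open>s > 0\<close> by auto
  have "q d = (\<Sum>i\<in>F. (\<phi> i - d i) * \<phi> i - (\<phi> i - d i) * e i + (e i - d i) * (\<phi> i - d i))"
    unfolding q_def by (rule sum.cong) (auto simp: power2_eq_square algebra_simps)
  also have "\<dots> = (\<Sum>i\<in>F. (\<phi> i - d i) * \<phi> i) - (\<Sum>i\<in>F. (\<phi> i - d i) * e i) + (\<Sum>i\<in>F. (e i - d i) * (\<phi> i - d i))"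
    by (simp add: sum.distrib sum_subtractf)
  finally show False
    using e(2) half[OF e(1)] s_le[OF d(1)] \<open>s > 0\<close> by linarith
qed

text \<open>The setting is used for two different pairs: \<open>X\<close> the combinations of
  coordinates with \<open>S = A\<close>, and \<open>X\<close> the unit ball of the interpolation
  space with \<open>S\<close> the coordinates. Convexity of \<open>X\<close> is therefore phrased
  through the values that \<open>\<psi>\<close> and \<open>k\<close> can see, so that
  \<open>X\<close> needs no vector space structure.\<close>

context
  fixes k :: "'x \<Rightarrow> 's \<Rightarrow> real" and \<psi> :: "'x \<Rightarrow> real" and X :: "'x set" and S :: "'s set"
    and B C :: real
  assumes k_bound: "\<And>x s. x \<in> X \<Longrightarrow> s \<in> S \<Longrightarrow> \<bar>k x s\<bar> \<le> B" "B > 0"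
    and \<psi>_bound: "\<And>x. x \<in> X \<Longrightarrow> \<bar>\<psi> x\<bar> \<le> C"
    and nonempty: "X \<noteq> {}"
    and X_convex: "\<And>x x' t. x \<in> X \<Longrightarrow> x' \<in> X \<Longrightarrow> 0 \<le> t \<Longrightarrow> t \<le> 1 \<Longrightarrow>
      \<exists>z\<in>X. \<psi> z = (1 - t) * \<psi> x + t * \<psi> x' \<and> (\<forall>s\<in>S. k z s = (1 - t) * k x s + t * k x' s)"
begin

lemma pairing_affine:
  assumes "\<nu> \<in> l1_ball S" "\<forall>s\<in>S. k z s = a * k x s + b * k x' s"
  shows "pairing \<nu> (k z) = a * pairing \<nu> (k x) + b * pairing \<nu> (k x')"
  unfolding pairing_mult_right[symmetric] pairing_add_right[symmetric]
  by (rule pairing_cong) (use assms in \<open>auto simp: l1_ball_def\<close>)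

text \<open>If there were no common witness, separation in the finite-dimensional space of functions on \<open>\<Lambda>\<close>
  would produce a convex combination of \<open>\<Lambda>\<close> without a witness. Subtracting \<open>r\<close> makes the convex
  set \<open>D\<close> downward closed, which forces the separating coefficients to be nonnegative.\<close>

lemma common_witness:
  assumes bad: "\<And>\<nu>. \<nu> \<in> l1_ball S \<Longrightarrow> \<exists>x\<in>X. \<eta>' < pairing \<nu> (k x) - \<psi> x"
    and \<Lambda>: "finite \<Lambda>" "\<Lambda> \<subseteq> l1_ball S" and "\<eta> < \<eta>'"
  shows "\<exists>x\<in>X. \<forall>\<nu>\<in>\<Lambda>. \<eta> \<le> pairing \<nu> (k x) - \<psi> x"
proof -
  define v where "v x \<nu> = pairing \<nu> (k x) - \<psi> x" for x \<nu>
  \<comment> \<open>Large enough that \<open>v x \<nu> - R \<le> \<eta>'\<close> always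
    holds.\<close>
  define R where "R = B + C + \<bar>\<eta>'\<bar>"
  define D where "D = {\<lambda>\<nu>. v x \<nu> - r \<nu> | x r. x \<in> X \<and> (\<forall>\<nu>. 0 \<le> r \<nu> \<and> r \<nu> \<le> R)}"
  have v_bound: "\<bar>v x \<nu>\<bar> \<le> B + C" if "x \<in> X" "\<nu> \<in> \<Lambda>" for x \<nu>
  proof -
    have "\<bar>pairing \<nu> (k x)\<bar> \<le> B"
      using that \<Lambda> k_bound by (intro abs_pairing_l1_ball_le[of _ S]) auto
    then show ?thesis
      using \<psi>_bound[OF that(1)] by (simp add: v_def)
  qed
  obtain x0 where x0: "x0 \<in> X" using nonempty by blast
  have "B + C \<ge> 0" using \<psi>_bound[OF x0] k_bound(2) by linarith
  then have "R \<ge> 0" by (simp add: R_def)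
  have "\<exists>d\<in>D. \<forall>\<nu>\<in>\<Lambda>. \<bar>d \<nu> - \<eta>'\<bar> \<le> \<eta>' - \<eta>"
  proof (rule finite_separation[OF \<Lambda>(1)])
    have "(\<lambda>\<nu>. v x0 \<nu> - 0) \<in> D"
      unfolding D_def mem_Collect_eq using x0 \<open>R \<ge> 0\<close>
      by (intro exI[of _ x0] exI[of _ "\<lambda>_. 0"]) auto
    then show "D \<noteq> {}" by blast
    show "\<bar>d \<nu>\<bar> \<le> B + C + R" if d: "d \<in> D" and \<nu>: "\<nu> \<in> \<Lambda>" for d \<nu>
    proof -
      obtain x r where "x \<in> X" and r: "\<And>\<nu>. 0 \<le> r \<nu> \<and> r \<nu> \<le> R" and "d = (\<lambda>\<nu>. v x \<nu> - r \<nu>)"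
        using d unfolding D_def by blast
      then have "\<bar>v x \<nu>\<bar> \<le> B + C" "d \<nu> = v x \<nu> - r \<nu>"
        using v_bound \<nu> by auto
      moreover have "0 \<le> r \<nu>" "r \<nu> \<le> R"
        using r by blast+
      ultimately show ?thesis by linarith
    qed
    show "\<exists>h\<in>D. \<forall>\<nu>\<in>\<Lambda>. h \<nu> = (1 - t) * d \<nu> + t * e \<nu>"
      if de: "d \<in> D" "e \<in> D" and t: "0 \<le> t" "t \<le> 1" for d e t
    proof -
      obtain x r where x: "x \<in> X" and r: "\<And>\<nu>. 0 \<le> r \<nu> \<and> r \<nu> \<le> R" and d: "d = (\<lambda>\<nu>. v x \<nu> - r \<nu>)"
        using de unfolding D_def by blast
      obtain x' r' where x': "x' \<in> X" and r': "\<And>\<nu>. 0 \<le> r' \<nu> \<and> r' \<nu> \<le> R" and e: "e = (\<lambda>\<nu>. v x' \<nu> - r' \<nu>)"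
        using de unfolding D_def by blast
      obtain z where z: "z \<in> X" "\<psi> z = (1 - t) * \<psi> x + t * \<psi> x'"
        "\<forall>s\<in>S. k z s = (1 - t) * k x s + t * k x' s"
        using X_convex[OF x x' t] by blast
      define r'' where "r'' \<nu> = (1 - t) * r \<nu> + t * r' \<nu>" for \<nu>
      have "0 \<le> r'' \<nu> \<and> r'' \<nu> \<le> R" for \<nu>
      proof
        show "0 \<le> r'' \<nu>" using r r' t by (simp add: r''_def)
        show "r'' \<nu> \<le> R" unfolding r''_def using r r' t by (intro convex_bound_le) auto
      qed
      then have h1: "(\<lambda>\<nu>. v z \<nu> - r'' \<nu>) \<in> D"
        unfolding D_def mem_Collect_eq using z(1) by (intro exI[of _ z] exI[of _ r'']) auto
      have h2: "v z \<nu> - r'' \<nu> = (1 - t) * d \<nu> + t * e \<nu>" if "\<nu> \<in> \<Lambda>" for \<nu>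
      proof -
        have "\<nu> \<in> l1_ball S" using \<Lambda>(2) that by blast
        note eq = pairing_affine[OF this z(3)]
        show ?thesis
          unfolding v_def r''_def d e eq z(2) by (simp add: algebra_simps)
      qed
      show ?thesis
        by (rule bexI[OF _ h1]) (intro ballI h2)
    qed
    show "\<exists>d\<in>D. (\<Sum>\<nu>\<in>\<Lambda>. c \<nu> * \<eta>') \<le> (\<Sum>\<nu>\<in>\<Lambda>. c \<nu> * d \<nu>) + \<epsilon>" if "\<epsilon> > 0" for c \<epsilon>
    proof -
      \<comment> \<open>Only positive coefficients matter for the choice of \<open>x\<close>:
        normalised by their sum \<open>P\<close> they merge \<open>\<Lambda>\<close> into the single
        element \<open>\<nu>'\<close> of the ball, and a point that is bad for \<open>\<nu>'\<close>
        is bad for \<open>\<Lambda>\<close> on weighted average.\<close>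
      define P where "P = (\<Sum>\<nu>\<in>\<Lambda>. max (c \<nu>) 0)"
      have "P \<ge> 0" by (auto simp: P_def intro: sum_nonneg)
      have "\<exists>x\<in>X. P * \<eta>' \<le> (\<Sum>\<nu>\<in>\<Lambda>. max (c \<nu>) 0 * v x \<nu>)"
      proof (cases "P = 0")
        case True
        then have "max (c \<nu>) 0 = 0" if "\<nu> \<in> \<Lambda>" for \<nu>
          using that \<Lambda>(1) unfolding P_def by (subst (asm) sum_nonneg_eq_0_iff) auto
        then show ?thesis
          using True x0 by (intro bexI[of _ x0]) (simp_all add: sum.neutral)
      next
        case False
        then have "P > 0" using \<open>P \<ge> 0\<close> by simp
        define \<nu>' where "\<nu>' = (\<Sum>\<nu>\<in>\<Lambda>. (max (c \<nu>) 0 / P) *\<^sub>R \<nu>)"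
        have "norm \<nu>' \<le> (\<Sum>\<nu>\<in>\<Lambda>. norm ((max (c \<nu>) 0 / P) *\<^sub>R \<nu>))"
          unfolding \<nu>'_def by (rule norm_sum)
        also have "\<dots> \<le> (\<Sum>\<nu>\<in>\<Lambda>. max (c \<nu>) 0 / P)"
        proof (rule sum_mono)
          fix \<nu> assume "\<nu> \<in> \<Lambda>"
          then have "norm \<nu> \<le> 1" using \<Lambda>(2) by (auto simp: l1_ball_def)
          then show "norm ((max (c \<nu>) 0 / P) *\<^sub>R \<nu>) \<le> max (c \<nu>) 0 / P"
            using \<open>P > 0\<close> mult_left_le[of "norm \<nu>" "max (c \<nu>) 0 / P"] by simp
        qed
        also have "\<dots> = 1"
          using \<open>P > 0\<close> by (simp add: P_def sum_divide_distrib[symmetric])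
        finally have "norm \<nu>' \<le> 1" .
        moreover have "Poly_Mapping.keys \<nu>' \<subseteq> S"
        proof -
          have "Poly_Mapping.keys \<nu>' \<subseteq> (\<Union>\<nu>\<in>\<Lambda>. Poly_Mapping.keys ((max (c \<nu>) 0 / P) *\<^sub>R \<nu>))"
            unfolding \<nu>'_def by (rule Poly_Mapping.keys_sum)
          also have "\<dots> \<subseteq> (\<Union>\<nu>\<in>\<Lambda>. Poly_Mapping.keys \<nu>)"
            by (intro UN_mono order_refl keys_scaleR)
          finally show ?thesis
            using \<Lambda>(2) by (auto simp: l1_ball_def)
        qed
        ultimately obtain x where x: "x \<in> X" "\<eta>' < pairing \<nu>' (k x) - \<psi> x"
          using bad[of \<nu>'] by (auto simp: l1_ball_def)
        have "P * \<eta>' \<le> P * (pairing \<nu>' (k x) - \<psi> x)"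
          using x(2) \<open>P > 0\<close> by simp
        moreover have "P * pairing \<nu>' (k x) = (\<Sum>\<nu>\<in>\<Lambda>. max (c \<nu>) 0 * pairing \<nu> (k x))"
          unfolding \<nu>'_def pairing_sum_left pairing_scaleR_left sum_distrib_left
          using \<open>P > 0\<close> by (intro sum.cong) auto
        then have "P * (pairing \<nu>' (k x) - \<psi> x) = (\<Sum>\<nu>\<in>\<Lambda>. max (c \<nu>) 0 * v x \<nu>)"
          by (simp add: v_def right_diff_distrib sum_subtractf P_def sum_distrib_right)
        ultimately show ?thesis using x(1) by auto
      qed
      then obtain x where x: "x \<in> X" "P * \<eta>' \<le> (\<Sum>\<nu>\<in>\<Lambda>. max (c \<nu>) 0 * v x \<nu>)" by blast
      \<comment> \<open>Where the coefficient is not positive the coordinate is pushed down to at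
        most \<open>\<eta>'\<close>, so that these terms contribute with the right sign.\<close>
      define r where "r \<nu> = (if c \<nu> \<le> 0 then R else 0)" for \<nu>
      have "(\<lambda>\<nu>. v x \<nu> - r \<nu>) \<in> D"
        unfolding D_def mem_Collect_eq using x(1) \<open>R \<ge> 0\<close>
        by (intro exI[of _ x] exI[of _ r]) (auto simp: r_def)
      moreover have "(\<Sum>\<nu>\<in>\<Lambda>. c \<nu> * \<eta>') \<le> (\<Sum>\<nu>\<in>\<Lambda>. c \<nu> * (v x \<nu> - r \<nu>))"
      proof -
        have "c \<nu> * \<eta>' - max (c \<nu>) 0 * \<eta>' \<le> c \<nu> * (v x \<nu> - r \<nu>) - max (c \<nu>) 0 * v x \<nu>"
          if "\<nu> \<in> \<Lambda>" for \<nu>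
        proof (cases "c \<nu> \<le> 0")
          case True
          have "v x \<nu> - R \<le> \<eta>'"
            using v_bound[OF x(1) that] by (simp add: R_def)
          then show ?thesis
            using True by (simp add: r_def mult_left_mono_neg)
        qed (simp add: r_def)
        then have "(\<Sum>\<nu>\<in>\<Lambda>. c \<nu> * \<eta>' - max (c \<nu>) 0 * \<eta>') \<le> (\<Sum>\<nu>\<in>\<Lambda>. c \<nu> * (v x \<nu> - r \<nu>) - max (c \<nu>) 0 * v x \<nu>)"
          by (rule sum_mono)
        then show ?thesis
          using x(2) by (simp add: sum_subtractf P_def sum_distrib_right)
      qed
      ultimately show ?thesis
        using \<open>\<epsilon> > 0\<close> by (intro bexI[of _ "\<lambda>\<nu>. v x \<nu> - r \<nu>"]) auto
    qed
  qed (use assms in simp)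
  then obtain d where d: "d \<in> D" "\<And>\<nu>. \<nu> \<in> \<Lambda> \<Longrightarrow> \<bar>d \<nu> - \<eta>'\<bar> \<le> \<eta>' - \<eta>" by blast
  from d(1) obtain x r where x: "x \<in> X" and r: "\<And>\<nu>. 0 \<le> r \<nu> \<and> r \<nu> \<le> R" and dx: "d = (\<lambda>\<nu>. v x \<nu> - r \<nu>)"
    unfolding D_def by blast
  have "\<eta> \<le> v x \<nu>" if "\<nu> \<in> \<Lambda>" for \<nu>
  proof -
    have "0 \<le> r \<nu>" using r by blast
    then show ?thesis
      using d(2)[OF that] by (simp add: dx abs_le_iff)
  qed
  then show ?thesis
    using x by (auto simp: v_def)
qed

text \<open>Were the conclusion false, approximants on finite sets and common witnesses chosen in turn
  would have different iterated limits.\<close>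

lemma uniform_approximation:
  assumes U: "free_ultrafilter U"
    and ic: "free_ultrafilter.interchange U (\<lambda>x \<nu>. pairing \<nu> (k x)) X (l1_ball S)"
    and sym: "\<And>x. x \<in> X \<Longrightarrow> \<exists>z\<in>X. \<psi> z = - \<psi> x \<and> (\<forall>s\<in>S. k z s = - k x s)"
    and fin: "\<And>F. finite F \<Longrightarrow> F \<subseteq> X \<Longrightarrow> \<exists>\<nu>\<in>l1_ball S. \<forall>x\<in>F. \<bar>\<psi> x - pairing \<nu> (k x)\<bar> \<le> \<eta>"
    and "\<eta> < \<eta>'"
  shows "\<exists>\<nu>\<in>l1_ball S. \<forall>x\<in>X. \<bar>\<psi> x - pairing \<nu> (k x)\<bar> \<le> \<eta>'"
proof (rule ccontr)
  assume contra: "\<not> ?thesis"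
  have bad: "\<exists>x\<in>X. \<eta>' < pairing \<nu> (k x) - \<psi> x" if \<nu>: "\<nu> \<in> l1_ball S" for \<nu>
  proof -
    obtain x where x: "x \<in> X" "\<bar>\<psi> x - pairing \<nu> (k x)\<bar> > \<eta>'"
      using contra \<nu> by (meson not_le)
    obtain z where z: "z \<in> X" "\<psi> z = - \<psi> x" "\<forall>s\<in>S. k z s = - k x s"
      using sym[OF x(1)] by blast
    have "pairing \<nu> (k z) = - pairing \<nu> (k x)"
      using pairing_affine[OF \<nu>, of z "-1" x 0 x] z(3) by simp
    then have "\<eta>' < pairing \<nu> (k x) - \<psi> x \<or> \<eta>' < pairing \<nu> (k z) - \<psi> z"
      using x(2) z(2) by linarith
    then show ?thesis
      using x(1) z(1) by blast
  qed
  \<comment> \<open>Strict room on both sides: \<open>common_witness\<close> weakens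
    \<open>\<eta>'\<close> to \<open>\<eta>''\<close>, and the contradiction will be
    \<open>\<eta>'' \<le> \<eta>\<close>.\<close>
  define \<eta>'' where "\<eta>'' = (\<eta> + \<eta>') / 2"
  have "\<eta> < \<eta>''" "\<eta>'' < \<eta>'"
    using \<open>\<eta> < \<eta>'\<close> by (auto simp: \<eta>''_def)
  \<comment> \<open>\<open>\<Lambda>\<close> and \<open>F\<close> collect the combinations and
    points chosen so far. The new \<open>\<nu>'\<close> approximates \<open>\<psi>\<close> on the
    old \<open>F\<close> and joins \<open>\<Lambda>\<close> before the witness \<open>x'\<close> is
    chosen, so the lower bound also covers the diagonal \<open>i = j\<close>.\<close>
  define P where "P = (\<lambda>(\<Lambda>, F, \<nu>, x). finite \<Lambda> \<and> \<Lambda> \<subseteq> l1_ball S \<and> finite F \<and> F \<subseteq> X \<and> \<nu> \<in> \<Lambda> \<and> x \<in> F \<and>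
    (\<forall>\<nu>\<in>\<Lambda>. \<eta>'' \<le> pairing \<nu> (k x) - \<psi> x))"
  define Q where "Q = (\<lambda>(\<Lambda> :: ('s \<Rightarrow>\<^sub>0 real) set, F, \<nu> :: 's \<Rightarrow>\<^sub>0 real, x :: 'x) (\<Lambda>', F', \<nu>' :: 's \<Rightarrow>\<^sub>0 real, x' :: 'x).
    \<Lambda> \<subseteq> \<Lambda>' \<and> F \<subseteq> F' \<and> (\<forall>z\<in>F. \<bar>\<psi> z - pairing \<nu>' (k z)\<bar> \<le> \<eta>))"
  have step: "\<exists>\<Lambda>' F' \<nu>' x'. P (\<Lambda>', F', \<nu>', x') \<and> Q (\<Lambda>, F, \<nu>, x) (\<Lambda>', F', \<nu>', x')"
    if \<Lambda>: "finite \<Lambda>" "\<Lambda> \<subseteq> l1_ball S" and F: "finite F" "F \<subseteq> X" for \<Lambda> F \<nu> x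
  proof -
    obtain \<nu>' where \<nu>': "\<nu>' \<in> l1_ball S" "\<forall>z\<in>F. \<bar>\<psi> z - pairing \<nu>' (k z)\<bar> \<le> \<eta>"
      using fin[OF F] by blast
    obtain x' where "x' \<in> X" "\<forall>\<nu>\<in>insert \<nu>' \<Lambda>. \<eta>'' \<le> pairing \<nu> (k x') - \<psi> x'"
      using common_witness[OF bad _ _ \<open>\<eta>'' < \<eta>'\<close>, of "insert \<nu>' \<Lambda>"] \<Lambda> \<nu>' by auto
    then show ?thesis
      using \<Lambda> F \<nu>'
      by (intro exI[of _ "insert \<nu>' \<Lambda>"] exI[of _ "insert x' F"] exI[of _ \<nu>'] exI[of _ x'])
        (auto simp: P_def Q_def)
  qed
  have "\<exists>f. \<forall>i. P (f i) \<and> Q (f i) (f (Suc i))"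
  proof (rule dependent_nat_choice)
    show "\<exists>s. P s"
      using step[of "{}" "{}"] by blast
  next
    fix s i assume "P s"
    then show "\<exists>s'. P s' \<and> Q s s'"
      using step by (cases s) (auto simp: P_def)
  qed
  then obtain f where f: "\<And>i. P (f i)" "\<And>i. Q (f i) (f (Suc i))" by blast
  define \<Lambda> F \<nu> x where "\<Lambda> = (\<lambda>i. fst (f i))" and "F = (\<lambda>i. fst (snd (f i)))"
    and "\<nu> = (\<lambda>i. fst (snd (snd (f i))))" and "x = (\<lambda>i. snd (snd (snd (f i))))"
  note defs = \<Lambda>_def F_def \<nu>_def x_def
  have P: "\<Lambda> i \<subseteq> l1_ball S" "F i \<subseteq> X" "\<nu> i \<in> \<Lambda> i" "x i \<in> F i"
    "\<And>\<nu>. \<nu> \<in> \<Lambda> i \<Longrightarrow> \<eta>'' \<le> pairing \<nu> (k (x i)) - \<psi> (x i)" for i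
    using f(1)[of i] by (auto simp: P_def defs split: prod.splits)
  have Q: "\<Lambda> i \<subseteq> \<Lambda> (Suc i)" "F i \<subseteq> F (Suc i)"
    "\<And>z. z \<in> F i \<Longrightarrow> \<bar>\<psi> z - pairing (\<nu> (Suc i)) (k z)\<bar> \<le> \<eta>" for i
    using f(2)[of i] by (auto simp: Q_def defs split: prod.splits)
  have "\<eta>'' \<le> \<eta>"
  proof (rule free_ultrafilter.interchange_no_order[OF U ic, of B x \<nu> "\<lambda>i. \<psi> (x i)" C])
    show "\<bar>pairing \<nu> (k x)\<bar> \<le> B" if "x \<in> X" "\<nu> \<in> l1_ball S" for x \<nu>
      using that k_bound by (intro abs_pairing_l1_ball_le) auto
  next
    fix i j :: nat assume "i < j"
    then obtain l where l: "j = Suc l" "i \<le> l"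
      by (cases j) auto
    have "F i \<subseteq> F l"
      using lift_Suc_mono_le[of F, OF Q(2) l(2)] .
    then have "x i \<in> F l"
      using P(4)[of i] by blast
    then show "pairing (\<nu> j) (k (x i)) \<le> \<psi> (x i) + \<eta>"
      using Q(3)[of "x i" l] l by (simp add: abs_le_iff)
  next
    fix i j :: nat assume "j \<le> i"
    then have "\<Lambda> j \<subseteq> \<Lambda> i"
      using lift_Suc_mono_le[of \<Lambda>, OF Q(1)] by blast
    then have "\<nu> j \<in> \<Lambda> i"
      using P(3)[of j] by blast
    then show "\<psi> (x i) + \<eta>'' \<le> pairing (\<nu> j) (k (x i))"
      using P(5)[of "\<nu> j" i] by simp
  next
    show "x i \<in> X" "\<nu> i \<in> l1_ball S" for i
      using P by blast+
    then show "\<bar>\<psi> (x i)\<bar> \<le> C" for i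
      using \<psi>_bound by blast
  qed
  then show False
    using \<open>\<eta> < \<eta>''\<close> by simp
qed

end

section \<open>The interpolation space\<close>

locale interpolation =
  fixes A :: "('b \<Rightarrow> real) set"
  assumes A_nonempty: "A \<noteq> {}"
    and A_bound: "\<And>a w. a \<in> A \<Longrightarrow> \<bar>a w\<bar> \<le> 1"
begin

text \<open>Both the share of the unit ball in the \<open>n\<close>-th interpolating set and the
  squared weight of its gauge. The exponent \<open>Suc n\<close> makes the total 1 and keeps
  \<open>1 - \<theta> n\<close> positive; convergence to 0 is what makes the interpolation space
  reflexive.\<close>

definition \<theta> :: "nat \<Rightarrow> real"
  where "\<theta> n = (1 / 2) ^ Suc n"

lemma \<theta>_pos [simp]: "0 < \<theta> n" "0 \<le> \<theta> n" and \<theta>_le: "\<theta> n \<le> 1"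
  by (auto simp: \<theta>_def intro: power_le_one simp del: power_Suc)

lemma sum_\<theta>: "(\<Sum>n<N. \<theta> n) = 1 - (1 / 2) ^ N"
  by (induction N) (auto simp: \<theta>_def)

definition A_norm :: "('b \<Rightarrow>\<^sub>0 real) \<Rightarrow> real"
  where "A_norm \<nu> = (SUP a\<in>A. \<bar>pairing \<nu> a\<bar>)"

text \<open>The support function of the \<open>n\<close>-th interpolating set: \<open>A_norm\<close>
  is that of conv (A \<union> -A), the l1 norm is that of the unit ball of the supremum norm, and
  support functions add under Minkowski sums.\<close>

definition dnorm :: "nat \<Rightarrow> ('b \<Rightarrow>\<^sub>0 real) \<Rightarrow> real"
  where "dnorm n \<nu> = (1 - \<theta> n) * A_norm \<nu> + \<theta> n * norm \<nu>"

text \<open>By the bipolar theorem, \<open>gauge n\<close> is the gauge of the closure of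
  \<open>(1 - \<theta>\<^sub>n) conv (A \<union> -A) + \<theta>\<^sub>n B\<close>, where \<open>B\<close> is the unit ball of the supremum norm.\<close>

definition gauge :: "nat \<Rightarrow> ('b \<Rightarrow> real) \<Rightarrow> real"
  where "gauge n x = (SUP \<nu>\<in>{\<nu>. dnorm n \<nu> \<le> 1}. pairing \<nu> x)"

text \<open>Up to closure, \<open>sqrt (\<theta> n) * gauge n\<close> is the gauge of \<open>(1 -
  \<theta>\<^sub>n) / sqrt \<theta>\<^sub>n conv (A \<union> -A) + sqrt \<theta>\<^sub>n B\<close>.
  These are the classical sets \<open>2\<^sup>n W + 2\<^sup>-\<^sup>n B\<close> with
  \<open>sqrt \<theta>\<^sub>n\<close> in the role of the small factor.\<close>

definition partial_norm :: "nat \<Rightarrow> ('b \<Rightarrow> real) \<Rightarrow> real"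
  where "partial_norm N x = L2_set (\<lambda>n. sqrt (\<theta> n) * gauge n x) {..<N}"

definition space :: "('b \<Rightarrow> real) set"
  where "space = {x. bounded (range x) \<and> bdd_above (range (\<lambda>N. partial_norm N x))}"

definition inorm :: "('b \<Rightarrow> real) \<Rightarrow> real"
  where "inorm x = (SUP N. partial_norm N x)"

lemma abs_pairing_A_le: "a \<in> A \<Longrightarrow> \<bar>pairing \<nu> a\<bar> \<le> norm \<nu>"
  using abs_pairing_le[of \<nu> a 1] A_bound by auto

lemma bdd_above_A: "bdd_above ((\<lambda>a. \<bar>pairing \<nu> a\<bar>) ` A)"
  using abs_pairing_A_le by (intro bdd_aboveI[of _ "norm \<nu>"]) auto

lemma A_norm_upper: "a \<in> A \<Longrightarrow> \<bar>pairing \<nu> a\<bar> \<le> A_norm \<nu>"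
  unfolding A_norm_def using bdd_above_A by (intro cSUP_upper)

lemma A_norm_le: "A_norm \<nu> \<le> norm \<nu>"
  unfolding A_norm_def using A_nonempty abs_pairing_A_le by (intro cSUP_least)

lemma A_norm_nonneg: "0 \<le> A_norm \<nu>"
  using A_nonempty A_norm_upper by (metis abs_ge_zero ex_in_conv order_trans)

lemma A_norm_scaleR_le: "A_norm (r *\<^sub>R \<nu>) \<le> \<bar>r\<bar> * A_norm \<nu>"
  unfolding A_norm_def[of "r *\<^sub>R \<nu>"] using A_nonempty
  by (intro cSUP_least) (auto simp: pairing_scaleR_left abs_mult intro!: mult_left_mono A_norm_upper)

lemma dnorm_ge: "\<theta> n * norm \<nu> \<le> dnorm n \<nu>"
  using A_norm_nonneg[of \<nu>] \<theta>_le[of n] by (simp add: dnorm_def)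

lemma dnorm_nonneg: "0 \<le> dnorm n \<nu>"
  using dnorm_ge[of n \<nu>] by (smt (verit) \<theta>_pos(1) mult_nonneg_nonneg norm_ge_zero)

lemma dnorm_le: "dnorm n \<nu> \<le> norm \<nu>"
proof -
  have "(1 - \<theta> n) * A_norm \<nu> \<le> (1 - \<theta> n) * norm \<nu>"
    using A_norm_le \<theta>_le by (intro mult_left_mono) auto
  then show ?thesis
    by (simp add: dnorm_def algebra_simps)
qed

lemma dnorm_scaleR_le: "dnorm n (r *\<^sub>R \<nu>) \<le> \<bar>r\<bar> * dnorm n \<nu>"
  using mult_left_mono[OF A_norm_scaleR_le[of r \<nu>], of "1 - \<theta> n"] \<theta>_le[of n]
  by (simp add: dnorm_def algebra_simps)

lemma dnorm_zero [simp]: "dnorm n 0 = 0"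
  using dnorm_le[of n 0] dnorm_nonneg[of n 0] by simp

lemma pairing_le_of_dnorm_le:
  assumes "\<And>w. \<bar>x w\<bar> \<le> C" "dnorm n \<nu> \<le> 1"
  shows "pairing \<nu> x \<le> C / \<theta> n"
proof -
  have "0 \<le> C" using assms(1) by (meson abs_ge_zero order_trans)
  have "norm \<nu> \<le> 1 / \<theta> n"
    using dnorm_ge[of n \<nu>] assms(2) by (simp add: field_simps)
  then have "C * norm \<nu> \<le> C * (1 / \<theta> n)"
    using \<open>0 \<le> C\<close> by (rule mult_left_mono)
  then show ?thesis
    using abs_pairing_le[of \<nu> x C] assms(1) by (simp add: abs_le_iff)
qed

lemma gauge_le: "(\<And>\<nu>. dnorm n \<nu> \<le> 1 \<Longrightarrow> pairing \<nu> x \<le> c) \<Longrightarrow> gauge n x \<le> c"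
  unfolding gauge_def by (rule cSUP_least) (auto intro: exI[of _ 0])

lemma gauge_upper:
  assumes "bounded (range x)" "dnorm n \<nu> \<le> 1"
  shows "pairing \<nu> x \<le> gauge n x"
proof -
  obtain C where "\<And>w. \<bar>x w\<bar> \<le> C"
    using assms(1) by (auto simp: bounded_iff)
  then have "bdd_above ((\<lambda>\<nu>. pairing \<nu> x) ` {\<nu>. dnorm n \<nu> \<le> 1})"
    using pairing_le_of_dnorm_le[of x C n] by (intro bdd_aboveI[of _ "C / \<theta> n"]) auto
  then show ?thesis
    unfolding gauge_def using assms(2) by (intro cSUP_upper) auto
qed

lemma gauge_nonneg: "bounded (range x) \<Longrightarrow> 0 \<le> gauge n x"
  using gauge_upper[of x n 0] by simp

lemma pairing_le_gauge:
  assumes "bounded (range x)"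
  shows "pairing \<nu> x \<le> gauge n x * dnorm n \<nu>"
proof (cases "\<nu> = 0")
  case False
  then have "dnorm n \<nu> > 0"
    using dnorm_ge[of n \<nu>] by (smt (verit) \<theta>_pos(1) mult_pos_pos zero_less_norm_iff)
  then have "dnorm n ((1 / dnorm n \<nu>) *\<^sub>R \<nu>) \<le> 1"
    using dnorm_scaleR_le[of n "1 / dnorm n \<nu>" \<nu>] by simp
  then have "pairing ((1 / dnorm n \<nu>) *\<^sub>R \<nu>) x \<le> gauge n x"
    by (rule gauge_upper[OF assms])
  then show ?thesis
    using \<open>dnorm n \<nu> > 0\<close> by (simp add: pairing_scaleR_left field_simps)
qed simp

lemma gauge_le_sup: "(\<And>w. \<bar>x w\<bar> \<le> C) \<Longrightarrow> gauge n x \<le> C / \<theta> n"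
  by (intro gauge_le pairing_le_of_dnorm_le)

lemma bounded_range_add:
  "bounded (range x) \<Longrightarrow> bounded (range y) \<Longrightarrow> bounded (range (\<lambda>w. x w + y w))"
  for x y :: "'b \<Rightarrow> real"
  by (rule bounded_plus_comp)

lemma bounded_range_cmult: "bounded (range x) \<Longrightarrow> bounded (range (\<lambda>w. c * x w))"
  for x :: "'b \<Rightarrow> real"
  using bounded_scaling[of "range x" c] by (simp add: image_image)

lemma gauge_triangle:
  "bounded (range x) \<Longrightarrow> bounded (range y) \<Longrightarrow> gauge n (\<lambda>w. x w + y w) \<le> gauge n x + gauge n y"
  by (rule gauge_le) (simp add: pairing_add_right add_mono gauge_upper)

lemma gauge_cmult_le:
  assumes "bounded (range x)"
  shows "gauge n (\<lambda>w. c * x w) \<le> \<bar>c\<bar> * gauge n x"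
proof (rule gauge_le)
  fix \<nu> assume \<nu>: "dnorm n \<nu> \<le> 1"
  have "\<bar>sgn c\<bar> * dnorm n \<nu> \<le> 1"
    using \<nu> by (simp add: sgn_if)
  then have "pairing (sgn c *\<^sub>R \<nu>) x \<le> gauge n x"
    using dnorm_scaleR_le[of n "sgn c" \<nu>] by (intro gauge_upper[OF assms]) simp
  then have "\<bar>c\<bar> * pairing (sgn c *\<^sub>R \<nu>) x \<le> \<bar>c\<bar> * gauge n x"
    by (rule mult_left_mono) simp
  then show "pairing \<nu> (\<lambda>w. c * x w) \<le> \<bar>c\<bar> * gauge n x"
    by (simp add: pairing_mult_right pairing_scaleR_left mult.assoc[symmetric] abs_mult_sgn)
qed

lemma gauge_cmult:
  assumes "bounded (range x)"
  shows "gauge n (\<lambda>w. c * x w) = \<bar>c\<bar> * gauge n x"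
proof (cases "c = 0")
  case True
  then show ?thesis
    using gauge_cmult_le[OF assms, of n 0] gauge_nonneg[of "\<lambda>w. 0" n] by simp
next
  case False
  have "gauge n (\<lambda>w. (1 / c) * (c * x w)) \<le> \<bar>1 / c\<bar> * gauge n (\<lambda>w. c * x w)"
    by (rule gauge_cmult_le[OF bounded_range_cmult[OF assms]])
  then have "\<bar>c\<bar> * gauge n x \<le> gauge n (\<lambda>w. c * x w)"
    using False by (simp add: field_simps)
  then show ?thesis
    using gauge_cmult_le[OF assms, of n c] by simp
qed

text \<open>The dual form of the inclusion of the \<open>n\<close>-th set in the unit ball: a signed
  unit point mass has \<open>dnorm\<close> at most its l1 norm 1.\<close>

lemma abs_le_gauge:
  assumes "bounded (range x)"
  shows "\<bar>x w\<bar> \<le> gauge n x"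
proof -
  have "r * x w \<le> gauge n x" if "\<bar>r\<bar> = 1" for r
    using gauge_upper[OF assms, of n "Poly_Mapping.single w r"] dnorm_le[of n "Poly_Mapping.single w r"] that
    by simp
  from this[of 1] this[of "-1"] show ?thesis by simp
qed

text \<open>Since \<open>A\<close> lies in the unit ball, splitting \<open>a\<close> into
  \<open>(1 - \<theta> n) * a\<close> and \<open>\<theta> n * a\<close> puts one part into each
  summand of the interpolating set.\<close>

lemma gauge_A: "a \<in> A \<Longrightarrow> gauge n a \<le> 1"
proof (rule gauge_le)
  fix \<nu> assume a: "a \<in> A" and \<nu>: "dnorm n \<nu> \<le> 1"
  have "pairing \<nu> a = (1 - \<theta> n) * pairing \<nu> a + \<theta> n * pairing \<nu> a"
    by (simp add: algebra_simps)
  also have "\<dots> \<le> dnorm n \<nu>"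
    unfolding dnorm_def
    using A_norm_upper[OF a, of \<nu>] abs_pairing_A_le[OF a, of \<nu>] \<theta>_le[of n]
    by (intro add_mono mult_left_mono) auto
  finally show "pairing \<nu> a \<le> 1" using \<nu> by simp
qed

lemma partial_norm_nonneg [simp]: "0 \<le> partial_norm N x"
  by (simp add: partial_norm_def)

lemma partial_norm_triangle:
  assumes "bounded (range x)" "bounded (range y)"
  shows "partial_norm N (\<lambda>w. x w + y w) \<le> partial_norm N x + partial_norm N y"
proof -
  have "partial_norm N (\<lambda>w. x w + y w) \<le>
      L2_set (\<lambda>n. sqrt (\<theta> n) * gauge n x + sqrt (\<theta> n) * gauge n y) {..<N}"
    unfolding partial_norm_def distrib_left[symmetric]
    using assms by (intro L2_set_mono mult_left_mono gauge_triangle mult_nonneg_nonneg gauge_nonneg bounded_range_add) auto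
  also have "\<dots> \<le> partial_norm N x + partial_norm N y"
    unfolding partial_norm_def by (rule L2_set_triangle_ineq)
  finally show ?thesis .
qed

lemma partial_norm_cmult:
  assumes "bounded (range x)"
  shows "partial_norm N (\<lambda>w. c * x w) = \<bar>c\<bar> * partial_norm N x"
  unfolding partial_norm_def L2_set_right_distrib[OF abs_ge_zero]
  by (simp add: gauge_cmult[OF assms] mult.left_commute)

lemma partial_norm_mono: "N \<le> M \<Longrightarrow> partial_norm N x \<le> partial_norm M x"
  unfolding partial_norm_def L2_set_def by (intro real_sqrt_le_mono sum_mono2) auto

lemma gauge_le_partial_norm: "n < N \<Longrightarrow> sqrt (\<theta> n) * gauge n x \<le> partial_norm N x"
  unfolding partial_norm_def by (rule member_le_L2_set) auto

lemma spaceD: "x \<in> space \<Longrightarrow> bounded (range x)"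
  by (simp add: space_def)

lemma partial_norm_le_inorm: "x \<in> space \<Longrightarrow> partial_norm N x \<le> inorm x"
  unfolding inorm_def space_def by (auto intro: cSUP_upper)

lemma inorm_le:
  assumes "bounded (range x)" "\<And>N. partial_norm N x \<le> c"
  shows "x \<in> space" "inorm x \<le> c"
  using assms unfolding space_def inorm_def by (auto intro!: bdd_aboveI[of _ c] cSUP_least)

lemma inorm_nonneg: "x \<in> space \<Longrightarrow> 0 \<le> inorm x"
  using partial_norm_le_inorm[of x 0] partial_norm_nonneg[of 0 x] by linarith

lemma space_add:
  assumes "x \<in> space" "y \<in> space"
  shows "(\<lambda>w. x w + y w) \<in> space" and "inorm (\<lambda>w. x w + y w) \<le> inorm x + inorm y"
proof -
  have "partial_norm N (\<lambda>w. x w + y w) \<le> inorm x + inorm y" for N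
    using partial_norm_triangle[of x y N] partial_norm_le_inorm[OF assms(1), of N]
      partial_norm_le_inorm[OF assms(2), of N] assms by (simp add: spaceD)
  with assms show "(\<lambda>w. x w + y w) \<in> space" "inorm (\<lambda>w. x w + y w) \<le> inorm x + inorm y"
    by (auto intro!: inorm_le bounded_range_add dest: spaceD)
qed

lemma space_cmult:
  assumes "x \<in> space"
  shows "(\<lambda>w. c * x w) \<in> space" and "inorm (\<lambda>w. c * x w) = \<bar>c\<bar> * inorm x"
proof -
  have *: "(\<lambda>w. c * x w) \<in> space \<and> inorm (\<lambda>w. c * x w) \<le> \<bar>c\<bar> * inorm x" if "x \<in> space" for c x
  proof -
    have "partial_norm N (\<lambda>w. c * x w) \<le> \<bar>c\<bar> * inorm x" for N
      using that by (simp add: partial_norm_cmult spaceD mult_left_mono partial_norm_le_inorm)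
    then show ?thesis
      using that by (auto intro!: inorm_le bounded_range_cmult dest: spaceD)
  qed
  show c: "(\<lambda>w. c * x w) \<in> space"
    using * assms by blast
  show "inorm (\<lambda>w. c * x w) = \<bar>c\<bar> * inorm x"
  proof (cases "c = 0")
    case True
    then show ?thesis
      using *[OF assms, of 0] inorm_nonneg[of "\<lambda>w. 0"] by simp
  next
    case False
    have "inorm (\<lambda>w. (1 / c) * (c * x w)) \<le> \<bar>1 / c\<bar> * inorm (\<lambda>w. c * x w)"
      using *[OF c] by blast
    then have "\<bar>c\<bar> * inorm x \<le> inorm (\<lambda>w. c * x w)"
      using False by (simp add: field_simps)
    then show ?thesis
      using *[OF assms, of c] by simp
  qed
qed

lemma zero_in_space [simp]: "(\<lambda>w. 0) \<in> space" and inorm_zero [simp]: "inorm (\<lambda>w. 0) = 0"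
proof -
  have "partial_norm N (\<lambda>w. 0) \<le> 0" for N
    using partial_norm_cmult[of "\<lambda>w. 0" N 0] by simp
  then show "(\<lambda>w. 0) \<in> space" and "inorm (\<lambda>w. 0) = 0"
    using inorm_le[of "\<lambda>w. 0" 0] inorm_nonneg[of "\<lambda>w. 0"] by auto
qed

lemma space_uminus: "x \<in> space \<Longrightarrow> (\<lambda>w. - x w) \<in> space" "x \<in> space \<Longrightarrow> inorm (\<lambda>w. - x w) = inorm x"
  using space_cmult[of x "-1"] by auto

lemma space_diff: "x \<in> space \<Longrightarrow> y \<in> space \<Longrightarrow> (\<lambda>w. x w - y w) \<in> space"
  using space_add(1)[of x "\<lambda>w. - y w"] space_uminus(1) by simp

lemma space_sum: "(\<And>i. i \<in> I \<Longrightarrow> x i \<in> space) \<Longrightarrow> (\<lambda>w. \<Sum>i\<in>I. x i w) \<in> space"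
  by (induction I rule: infinite_finite_induct) (auto intro: space_add)

lemma A_in_space:
  assumes "a \<in> A"
  shows "a \<in> space" "inorm a \<le> 1"
proof -
  have a: "bounded (range a)"
    using A_bound[OF assms] by (auto simp: bounded_iff)
  have "partial_norm N a \<le> 1" for N
  proof -
    have "partial_norm N a \<le> L2_set (\<lambda>n. sqrt (\<theta> n)) {..<N}"
      unfolding partial_norm_def
      by (rule L2_set_mono) (simp_all add: mult_left_le gauge_A assms gauge_nonneg a)
    also have "\<dots> \<le> 1"
      by (simp add: L2_set_def sum_\<theta>)
    finally show ?thesis .
  qed
  with a show "a \<in> space" "inorm a \<le> 1"
    by (auto intro: inorm_le)
qed

text \<open>Every gauge dominates \<open>\<bar>x w\<bar>\<close>, and the first \<open>N\<close>
  squared weights sum to \<open>1 - (1 / 2) ^ N\<close>. Letting \<open>N\<close> grow removes the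
  last factor.\<close>

lemma abs_le_inorm:
  assumes "x \<in> space"
  shows "\<bar>x w\<bar> \<le> inorm x"
proof -
  have "\<bar>x w\<bar> * sqrt (1 - (1 / 2) ^ N) \<le> inorm x" for N
  proof -
    have "\<bar>x w\<bar> * sqrt (1 - (1 / 2) ^ N) = L2_set (\<lambda>n. sqrt (\<theta> n) * \<bar>x w\<bar>) {..<N}"
      unfolding L2_set_left_distrib[OF abs_ge_zero, symmetric] by (simp add: L2_set_def sum_\<theta> mult.commute)
    also have "\<dots> \<le> partial_norm N x"
      unfolding partial_norm_def
      by (intro L2_set_mono mult_left_mono abs_le_gauge spaceD assms) auto
    also have "\<dots> \<le> inorm x"
      by (rule partial_norm_le_inorm[OF assms])
    finally show ?thesis .
  qed
  moreover have "(\<lambda>N. \<bar>x w\<bar> * sqrt (1 - (1 / 2) ^ N)) \<longlonglongrightarrow> \<bar>x w\<bar> * sqrt (1 - 0)"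
    by (intro tendsto_intros LIMSEQ_power_zero) auto
  ultimately show ?thesis
    using LIMSEQ_le_const2[of "\<lambda>N. \<bar>x w\<bar> * sqrt (1 - (1 / 2) ^ N)" "\<bar>x w\<bar>" "inorm x"] by auto
qed

text \<open>The unit ball is the polar of a set of finitely supported functionals, hence closed under
  pointwise limits.\<close>

lemma inorm_le_of_dual:
  assumes x: "bounded (range x)"
    and dual: "\<And>\<nu> Q. 0 \<le> Q \<Longrightarrow> (\<And>z. z \<in> space \<Longrightarrow> pairing \<nu> z \<le> Q * inorm z) \<Longrightarrow> pairing \<nu> x \<le> R * Q"
    and "0 \<le> R"
  shows "x \<in> space" "inorm x \<le> R"
proof -
  have "partial_norm N x \<le> R" for N
  proof -
    define Q where "Q = partial_norm N x"
    define K where "K = (\<Sum>n<N. \<theta> n * gauge n x)"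
    have "K \<ge> 0"
      unfolding K_def by (intro sum_nonneg mult_nonneg_nonneg gauge_nonneg x) auto
    have Q2: "Q\<^sup>2 = (\<Sum>n<N. \<theta> n * gauge n x * gauge n x)"
      by (simp add: Q_def partial_norm_def L2_set_def power_mult_distrib power2_eq_square[of "gauge _ _"]
          sum_nonneg mult.assoc)
    have bound: "Q\<^sup>2 \<le> R * Q + \<eta> * K" if "\<eta> > 0" for \<eta>
    proof -
      have "\<exists>\<nu>. dnorm n \<nu> \<le> 1 \<and> gauge n x - \<eta> < pairing \<nu> x" for n
      proof (rule ccontr)
        assume "\<not> ?thesis"
        then have "gauge n x \<le> gauge n x - \<eta>"
          by (intro gauge_le) force
        with \<open>\<eta> > 0\<close> show False by simp
      qed
      then obtain \<nu> where \<nu>: "\<And>n. dnorm n (\<nu> n) \<le> 1" "\<And>n. gauge n x - \<eta> < pairing (\<nu> n) x"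
        by metis
      \<comment> \<open>A functional almost norming \<open>x\<close> in the l2-sum: nearly optimal
        for each gauge, with the coefficients of the equality case of Cauchy-Schwarz. It is bounded
        by \<open>Q\<close> on the unit ball, and its value at \<open>x\<close> is at least
        \<open>Q\<^sup>2 - \<eta> * K\<close>.\<close>
      define \<tau> where "\<tau> = (\<Sum>n<N. (\<theta> n * gauge n x) *\<^sub>R \<nu> n)"
      have \<tau>: "pairing \<tau> z = (\<Sum>n<N. \<theta> n * gauge n x * pairing (\<nu> n) z)" for z
        by (simp add: \<tau>_def pairing_sum_left pairing_scaleR_left)
      have "pairing \<tau> z \<le> Q * inorm z" if z: "z \<in> space" for z
      proof -
        have "pairing \<tau> z \<le> (\<Sum>n<N. \<theta> n * gauge n x * gauge n z)"
          unfolding \<tau> by (intro sum_mono mult_left_mono gauge_upper spaceD z \<nu> mult_nonneg_nonneg gauge_nonneg x) auto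
        also have "\<dots> = (\<Sum>n<N. \<bar>sqrt (\<theta> n) * gauge n x\<bar> * \<bar>sqrt (\<theta> n) * gauge n z\<bar>)"
        proof (rule sum.cong)
          fix n
          have "sqrt (\<theta> n) * gauge n x * (sqrt (\<theta> n) * gauge n z) = (sqrt (\<theta> n))\<^sup>2 * gauge n x * gauge n z"
            by (simp only: power2_eq_square ac_simps)
          then show "\<theta> n * gauge n x * gauge n z = \<bar>sqrt (\<theta> n) * gauge n x\<bar> * \<bar>sqrt (\<theta> n) * gauge n z\<bar>"
            using gauge_nonneg[OF x, of n] gauge_nonneg[OF spaceD[OF z], of n] by (simp add: abs_mult)
        qed simp
        also have "\<dots> \<le> Q * partial_norm N z"
          unfolding Q_def partial_norm_def by (rule L2_set_mult_ineq)
        also have "\<dots> \<le> Q * inorm z"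
          using partial_norm_le_inorm[OF z] by (intro mult_left_mono) (auto simp: Q_def)
        finally show ?thesis .
      qed
      then have "pairing \<tau> x \<le> R * Q"
        by (intro dual) (auto simp: Q_def)
      moreover have "(\<Sum>n<N. \<theta> n * gauge n x * (gauge n x - \<eta>)) \<le> pairing \<tau> x"
        unfolding \<tau> by (intro sum_mono mult_left_mono mult_nonneg_nonneg gauge_nonneg x less_imp_le[OF \<nu>(2)]) auto
      moreover have "(\<Sum>n<N. \<theta> n * gauge n x * (gauge n x - \<eta>)) = Q\<^sup>2 - \<eta> * K"
        by (simp add: Q2 K_def right_diff_distrib sum_subtractf sum_distrib_left mult.commute mult.left_commute)
      ultimately show ?thesis by linarith
    qed
    have "Q\<^sup>2 \<le> R * Q"
    proof (rule field_le_epsilon)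
      fix e :: real assume "e > 0"
      then have "e / (K + 1) * K \<le> e"
        using \<open>K \<ge> 0\<close> by (simp add: field_simps)
      moreover have "e / (K + 1) > 0"
        using \<open>e > 0\<close> \<open>K \<ge> 0\<close> by simp
      ultimately show "Q\<^sup>2 \<le> R * Q + e"
        using bound[of "e / (K + 1)"] by linarith
    qed
    moreover have "0 \<le> Q" by (simp add: Q_def)
    ultimately have "Q \<le> R"
      using \<open>0 \<le> R\<close> mult_right_le_imp_le[of Q Q R] by (cases "Q = 0") (auto simp: power2_eq_square)
    then show ?thesis by (simp add: Q_def)
  qed
  with x show "x \<in> space" "inorm x \<le> R"
    by (auto intro: inorm_le)
qed

section \<open>The interpolation space as a Banach space\<close>

definition Y :: "('b \<Rightarrow> real) normed_structure"
  where "Y = \<lparr>carrier = space, mult = undefined, one = undefined, zero = (\<lambda>w. 0),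
    add = (\<lambda>x y w. x w + y w), smult = (\<lambda>c x w. c * x w), nrm = inorm\<rparr>"

lemma Y_simps [simp]:
  "carrier Y = space" "\<zero>\<^bsub>Y\<^esub> = (\<lambda>w. 0)" "x \<oplus>\<^bsub>Y\<^esub> y = (\<lambda>w. x w + y w)"
  "c \<odot>\<^bsub>Y\<^esub> x = (\<lambda>w. c * x w)" "nrm Y = inorm"
  by (auto simp: Y_def)

lemma abelian_group_Y: "abelian_group Y"
proof (rule abelian_groupI)
  fix x assume "x \<in> carrier Y"
  then show "\<exists>y\<in>carrier Y. y \<oplus>\<^bsub>Y\<^esub> x = \<zero>\<^bsub>Y\<^esub>"
    by (intro bexI[of _ "\<lambda>w. - x w"]) (auto intro: space_uminus)
qed (auto intro: space_add)

lemma minus_Y: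
  assumes "x \<in> space" "y \<in> space"
  shows "x \<ominus>\<^bsub>Y\<^esub> y = (\<lambda>w. x w - y w)"
proof -
  interpret Y: abelian_group Y by (rule abelian_group_Y)
  have "\<ominus>\<^bsub>Y\<^esub> y = (\<lambda>w. - y w)"
    by (rule Y.minus_equality) (use assms in \<open>auto intro: space_uminus\<close>)
  then show ?thesis
    by (simp add: a_minus_def)
qed

end

lemma cring_real_field: "cring real_field"
proof -
  have "\<exists>y. y + x = 0" for x :: real
    by (rule exI[of _ "-x"]) simp
  then show ?thesis
    by (intro cringI abelian_groupI comm_monoidI) (auto simp: real_field_def algebra_simps)
qed

context interpolation
begin

lemma normed_space_Y: "normed_space Y"
proof (rule normed_space.intro)
  have "module_axioms real_field Y"
    by (rule module_axioms.intro)
      (auto simp: real_field_def algebra_simps intro: space_cmult)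
  then show "Module.module real_field Y"
    by (intro Module.module.intro[OF cring_real_field abelian_group_Y])
  show "normed_space_axioms Y"
  proof (rule normed_space_axioms.intro)
    fix x assume "x \<in> carrier Y"
    then have x: "x \<in> space" by simp
    show "nrm Y x = 0 \<longleftrightarrow> x = \<zero>\<^bsub>Y\<^esub>"
    proof
      assume "nrm Y x = 0"
      then show "x = \<zero>\<^bsub>Y\<^esub>"
        using abs_le_inorm[OF x] by (simp add: fun_eq_iff)
    qed simp
  qed (auto intro: space_add space_cmult inorm_nonneg)
qed

text \<open>Coordinates converge because the norm dominates them. Finitely supported functionals
  commute with pointwise limits, so \<open>inorm_le_of_dual\<close> makes the norm lower
  semicontinuous and transfers the Cauchy estimate to the limit.\<close>

lemma banach_space_Y: "banach_space Y"
proof (rule banach_space.intro[OF normed_space_Y], rule banach_space_axioms.intro)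
  fix s :: "nat \<Rightarrow> 'b \<Rightarrow> real"
  assume "range s \<subseteq> carrier Y"
    and cauchy: "\<forall>e>0. \<exists>N. \<forall>m\<ge>N. \<forall>n\<ge>N. nrm Y (s m \<ominus>\<^bsub>Y\<^esub> s n) < e"
  then have s: "s n \<in> space" for n by auto
  have cauchy: "\<exists>N. \<forall>m\<ge>N. \<forall>n\<ge>N. inorm (\<lambda>w. s m w - s n w) < e" if "e > 0" for e
    using cauchy that by (simp add: minus_Y[OF s s])
  have "Cauchy (\<lambda>n. s n w)" for w
  proof (rule metric_CauchyI)
    fix e :: real assume "e > 0"
    then obtain N where "\<forall>m\<ge>N. \<forall>n\<ge>N. inorm (\<lambda>w. s m w - s n w) < e"
      using cauchy by blast
    then have "\<forall>m\<ge>N. \<forall>n\<ge>N. dist (s m w) (s n w) < e"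
      unfolding dist_real_def using le_less_trans[OF abs_le_inorm[OF space_diff[OF s s]]] by blast
    then show "\<exists>N. \<forall>m\<ge>N. \<forall>n\<ge>N. dist (s m w) (s n w) < e" ..
  qed
  then have "\<forall>w. \<exists>l. (\<lambda>n. s n w) \<longlonglongrightarrow> l"
    by (simp add: Cauchy_convergent_iff convergent_def)
  then obtain l where l: "\<And>w. (\<lambda>n. s n w) \<longlonglongrightarrow> l w"
    using choice[of "\<lambda>w l. (\<lambda>n. s n w) \<longlonglongrightarrow> l"] by blast
  have diff: "(\<lambda>w. s m w - l w) \<in> space \<and> inorm (\<lambda>w. s m w - l w) \<le> e"
    if N: "\<forall>m\<ge>N. \<forall>n\<ge>N. inorm (\<lambda>w. s m w - s n w) < e" and m: "m \<ge> N" and "e > 0" for e N m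
  proof -
    have lim: "(\<lambda>n. s m w - s n w) \<longlonglongrightarrow> s m w - l w" for w
      by (intro tendsto_intros l)
    have ev: "eventually (\<lambda>n. inorm (\<lambda>w. s m w - s n w) \<le> e) sequentially"
      using eventually_ge_at_top[of N] by eventually_elim (use N m in \<open>simp add: less_imp_le\<close>)
    have "\<bar>s m w - l w\<bar> \<le> e" for w
      using tendsto_rabs[OF lim] by (rule tendsto_upperbound)
        (use ev abs_le_inorm[OF space_diff[OF s s], where w = w] in \<open>auto elim!: eventually_mono intro: order_trans\<close>)
    then have bdd: "bounded (range (\<lambda>w. s m w - l w))"
      by (auto simp: bounded_iff)
    have "pairing \<nu> (\<lambda>w. s m w - l w) \<le> e * Q"
      if "0 \<le> Q" and Q: "\<And>z. z \<in> space \<Longrightarrow> pairing \<nu> z \<le> Q * inorm z" for \<nu> Q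
    proof (rule tendsto_upperbound)
      show "(\<lambda>n. pairing \<nu> (\<lambda>w. s m w - s n w)) \<longlonglongrightarrow> pairing \<nu> (\<lambda>w. s m w - l w)"
        unfolding pairing_def by (intro tendsto_intros l)
      show "eventually (\<lambda>n. pairing \<nu> (\<lambda>w. s m w - s n w) \<le> e * Q) sequentially"
        using ev
      proof eventually_elim
        case (elim n)
        have "pairing \<nu> (\<lambda>w. s m w - s n w) \<le> Q * inorm (\<lambda>w. s m w - s n w)"
          by (intro Q space_diff s)
        also have "\<dots> \<le> Q * e"
          using elim \<open>0 \<le> Q\<close> by (rule mult_left_mono)
        finally show ?case by (simp add: mult.commute)
      qed
    qed simp
    then show ?thesis
      using inorm_le_of_dual[OF bdd, of e] \<open>e > 0\<close> by auto
  qed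
  obtain N where "\<forall>m\<ge>N. \<forall>n\<ge>N. inorm (\<lambda>w. s m w - s n w) < 1"
    using cauchy[of 1] by auto
  then have "(\<lambda>w. s N w - l w) \<in> space"
    using diff[of N 1 N] by simp
  then have "(\<lambda>w. s N w - (s N w - l w)) \<in> space"
    by (rule space_diff[OF s])
  then have l_space: "l \<in> space" by simp
  have "(\<lambda>n. inorm (\<lambda>w. s n w - l w)) \<longlonglongrightarrow> 0"
  proof (rule LIMSEQ_I)
    fix e :: real assume "e > 0"
    then obtain N where N: "\<forall>m\<ge>N. \<forall>n\<ge>N. inorm (\<lambda>w. s m w - s n w) < e / 2"
      using cauchy[of "e / 2"] by auto
    have "norm (inorm (\<lambda>w. s n w - l w) - 0) < e" if "n \<ge> N" for n
      using diff[OF N that] \<open>e > 0\<close> inorm_nonneg[of "\<lambda>w. s n w - l w"] by auto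
    then show "\<exists>N. \<forall>n\<ge>N. norm (inorm (\<lambda>w. s n w - l w) - 0) < e" by blast
  qed
  then show "\<exists>l\<in>carrier Y. (\<lambda>n. nrm Y (s n \<ominus>\<^bsub>Y\<^esub> l)) \<longlonglongrightarrow> 0"
    using l_space by (intro bexI[of _ l]) (auto simp: minus_Y s)
qed

end

text \<open>Turns the coefficients that occur in \<open>finite_separation\<close> into a functional
  to which \<open>dnorm\<close> applies.\<close>

definition combination :: "'x set \<Rightarrow> ('x \<Rightarrow> real) \<Rightarrow> 'x \<Rightarrow>\<^sub>0 real"
  where "combination G c = (\<Sum>x\<in>G. Poly_Mapping.single x (c x))"

lemma pairing_combination: "pairing (combination G c) f = (\<Sum>x\<in>G. c x * f x)"
  by (simp add: combination_def pairing_sum_left)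

lemma lookup_combination: "finite G \<Longrightarrow> coeff (combination G c) x = (if x \<in> G then c x else 0)"
  by (simp add: combination_def lookup_sum lookup_single when_def sum.delta')

lemma norm_combination:
  assumes "finite G"
  shows "norm (combination G c) = (\<Sum>x\<in>G. \<bar>c x\<bar>)"
proof -
  have "Poly_Mapping.keys (combination G c) \<subseteq> G"
    using assms by (auto simp: in_keys_iff lookup_combination split: if_splits)
  then show ?thesis
    using assms by (simp add: norm_superset[of G] lookup_combination)
qed

lemma combination_keys: "combination (Poly_Mapping.keys \<nu>) (coeff \<nu>) = \<nu>"
  by (rule poly_mapping_eqI) (simp add: lookup_combination in_keys_iff)

lemma single_in_l1_ball: "x \<in> X \<Longrightarrow> \<bar>r\<bar> \<le> 1 \<Longrightarrow> Poly_Mapping.single x r \<in> l1_ball X"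
  by (auto simp: l1_ball_def split: if_splits)

lemma l1_ball_convex:
  assumes "\<mu> \<in> l1_ball X" "\<nu> \<in> l1_ball X" "0 \<le> t" "t \<le> 1"
  shows "(1 - t) *\<^sub>R \<mu> + t *\<^sub>R \<nu> \<in> l1_ball X"
proof -
  have "Poly_Mapping.keys ((1 - t) *\<^sub>R \<mu> + t *\<^sub>R \<nu>) \<subseteq> Poly_Mapping.keys \<mu> \<union> Poly_Mapping.keys \<nu>"
    using keys_add[of "(1 - t) *\<^sub>R \<mu>" "t *\<^sub>R \<nu>"] keys_scaleR[of "1 - t" \<mu>] keys_scaleR[of t \<nu>] by auto
  moreover have "norm ((1 - t) *\<^sub>R \<mu> + t *\<^sub>R \<nu>) \<le> (1 - t) * norm \<mu> + t * norm \<nu>"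
    using norm_triangle_ineq[of "(1 - t) *\<^sub>R \<mu>" "t *\<^sub>R \<nu>"] assms by simp
  moreover have "(1 - t) * norm \<mu> + t * norm \<nu> \<le> 1"
    using assms by (intro convex_bound_le) (auto simp: l1_ball_def)
  ultimately show ?thesis
    using assms by (auto simp: l1_ball_def)
qed

lemma l1_ball_uminus: "\<mu> \<in> l1_ball X \<Longrightarrow> - \<mu> \<in> l1_ball X"
  by (simp add: l1_ball_def)

section \<open>Tails of the norm, bounded functionals, and the position of the unit ball\<close>

context interpolation
begin

definition tail_norm :: "nat \<Rightarrow> nat \<Rightarrow> ('b \<Rightarrow> real) \<Rightarrow> real"
  where "tail_norm N M x = L2_set (\<lambda>n. sqrt (\<theta> n) * gauge n x) {N..<M}"

lemma partial_norm_split: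
  assumes "N \<le> M"
  shows "(partial_norm M x)\<^sup>2 = (partial_norm N x)\<^sup>2 + (tail_norm N M x)\<^sup>2"
proof -
  have "{..<M} = {..<N} \<union> {N..<M}" "{..<N} \<inter> {N..<M} = {}"
    using assms by auto
  then show ?thesis
    by (simp add: partial_norm_def tail_norm_def L2_set_def sum_nonneg sum.union_disjoint)
qed

lemma tail_norm_nonneg [simp]: "0 \<le> tail_norm N M x"
  by (simp add: tail_norm_def)

lemma tail_norm_triangle:
  assumes "bounded (range x)" "bounded (range y)"
  shows "tail_norm N M (\<lambda>w. x w + y w) \<le> tail_norm N M x + tail_norm N M y"
proof -
  have "tail_norm N M (\<lambda>w. x w + y w) \<le>
      L2_set (\<lambda>n. sqrt (\<theta> n) * gauge n x + sqrt (\<theta> n) * gauge n y) {N..<M}"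
    unfolding tail_norm_def distrib_left[symmetric]
    using assms by (intro L2_set_mono mult_left_mono gauge_triangle mult_nonneg_nonneg gauge_nonneg bounded_range_add) auto
  also have "\<dots> \<le> tail_norm N M x + tail_norm N M y"
    unfolding tail_norm_def by (rule L2_set_triangle_ineq)
  finally show ?thesis .
qed

lemma tail_norm_le:
  assumes "x \<in> space" "N \<le> M"
  shows "tail_norm N M x \<le> inorm x"
proof (rule power2_le_imp_le)
  have "(tail_norm N M x)\<^sup>2 \<le> (partial_norm M x)\<^sup>2"
    using partial_norm_split[OF assms(2), of x] by simp
  also have "\<dots> \<le> (inorm x)\<^sup>2"
    using partial_norm_le_inorm[OF assms(1)] by (intro power_mono) auto
  finally show "(tail_norm N M x)\<^sup>2 \<le> (inorm x)\<^sup>2" .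
qed (rule inorm_nonneg[OF assms(1)])

lemma small_tail:
  assumes x: "x \<in> space" and "\<delta> > 0"
  shows "\<exists>N. \<forall>M\<ge>N. tail_norm N M x \<le> \<delta>"
proof -
  \<comment> \<open>The squared tail is a difference of two squares, hence at most
    \<open>\<eta>\<close> times the sum of two numbers bounded by \<open>inorm x\<close>. The added
    1 keeps the denominator positive.\<close>
  define \<eta> where "\<eta> = \<delta>\<^sup>2 / (2 * (inorm x + 1))"
  have pos: "0 \<le> inorm x" "0 < \<eta>"
    using inorm_nonneg[OF x] \<open>\<delta> > 0\<close> by (auto simp: \<eta>_def)
  obtain N where N: "inorm x - \<eta> < partial_norm N x"
    using less_cSUP_iff[of UNIV "\<lambda>N. partial_norm N x" "inorm x - \<eta>"] x pos(2)
    by (auto simp: inorm_def space_def)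
  have "tail_norm N M x \<le> \<delta>" if "M \<ge> N" for M
  proof (rule power2_le_imp_le)
    have "(tail_norm N M x)\<^sup>2 = (partial_norm M x)\<^sup>2 - (partial_norm N x)\<^sup>2"
      using partial_norm_split[OF that, of x] by simp
    also have "\<dots> \<le> (inorm x)\<^sup>2 - (partial_norm N x)\<^sup>2"
      using partial_norm_le_inorm[OF x, of M] by (simp add: power_mono)
    also have "\<dots> = (inorm x - partial_norm N x) * (inorm x + partial_norm N x)"
      by (simp add: power2_eq_square algebra_simps)
    also have "\<dots> \<le> \<eta> * (2 * (inorm x + 1))"
      using N pos partial_norm_le_inorm[OF x, of N]
      by (intro mult_mono add_nonneg_nonneg) auto
    also have "\<dots> = \<delta>\<^sup>2"
      using pos by (simp add: \<eta>_def)
    finally show "(tail_norm N M x)\<^sup>2 \<le> \<delta>\<^sup>2" .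
  qed (use \<open>\<delta> > 0\<close> in simp)
  then show ?thesis by blast
qed

text \<open>Head and tail of the norm add in squares. As \<open>y\<close> has almost no tail, the
  tail of the perturbation enters only to second order, and to first order \<open>x\<close> is felt
  through its head alone.\<close>

lemma inorm_head_tail:
  assumes x: "x \<in> space" and y: "y \<in> space" and "inorm x \<le> 1" "inorm y \<le> 1" "0 \<le> \<sigma>"
    and tail: "\<And>M. N \<le> M \<Longrightarrow> tail_norm N M y \<le> \<delta>"
  shows "inorm (\<lambda>w. y w + \<sigma> * x w) \<le> 1 + \<sigma> * partial_norm N x + (\<delta> + \<sigma>)\<^sup>2 / 2"
proof (rule inorm_le(2))
  let ?z = "\<lambda>w. y w + \<sigma> * x w"
  have \<sigma>x: "(\<lambda>w. \<sigma> * x w) \<in> space" "inorm (\<lambda>w. \<sigma> * x w) \<le> \<sigma>"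
    using space_cmult[OF x, of \<sigma>] assms by (auto simp: mult_left_le)
  have z: "?z \<in> space"
    by (intro space_add y \<sigma>x)
  then show "bounded (range ?z)" by (rule spaceD)
  define u where "u = 1 + \<sigma> * partial_norm N x"
  have "u \<ge> 1" using \<open>0 \<le> \<sigma>\<close> by (simp add: u_def)
  have head: "partial_norm N ?z \<le> u"
    using partial_norm_triangle[OF spaceD[OF y] spaceD[OF \<sigma>x(1)], of N]
      partial_norm_le_inorm[OF y, of N] \<open>inorm y \<le> 1\<close> \<open>0 \<le> \<sigma>\<close>
    by (simp add: u_def partial_norm_cmult spaceD x)
  have "partial_norm M ?z \<le> u + (\<delta> + \<sigma>)\<^sup>2 / 2" if "N \<le> M" for M
  proof (rule power2_le_imp_le)
    have "tail_norm N M ?z \<le> \<delta> + \<sigma>"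
      using tail_norm_triangle[OF spaceD[OF y] spaceD[OF \<sigma>x(1)], of N M] tail[OF that]
        tail_norm_le[OF \<sigma>x(1) that] \<sigma>x(2) by linarith
    then have "(partial_norm M ?z)\<^sup>2 \<le> u\<^sup>2 + (\<delta> + \<sigma>)\<^sup>2"
      unfolding partial_norm_split[OF that] using head by (intro add_mono power_mono) auto
    also have "\<dots> \<le> u\<^sup>2 + u * (\<delta> + \<sigma>)\<^sup>2"
      using \<open>u \<ge> 1\<close> mult_right_mono[of 1 u "(\<delta> + \<sigma>)\<^sup>2"] by simp
    also have "\<dots> \<le> (u + (\<delta> + \<sigma>)\<^sup>2 / 2)\<^sup>2"
      by (simp add: power2_sum)
    finally show "(partial_norm M ?z)\<^sup>2 \<le> (u + (\<delta> + \<sigma>)\<^sup>2 / 2)\<^sup>2" .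
  qed (use \<open>u \<ge> 1\<close> in simp)
  then show "partial_norm M ?z \<le> 1 + \<sigma> * partial_norm N x + (\<delta> + \<sigma>)\<^sup>2 / 2" for M
    using partial_norm_mono[of M "max M N" ?z] by (simp add: u_def) (meson max.cobounded2 order_trans)
qed

text \<open>The \<open>n\<close>-th interpolating set contains \<open>\<theta> n\<close> times the
  unit ball, so a finite head is controlled by the supremum norm, with a constant that depends on
  \<open>N\<close>.\<close>

lemma partial_norm_le_sup:
  assumes "x \<in> space" "\<And>w. \<bar>x w\<bar> \<le> c"
  shows "partial_norm N x \<le> (\<Sum>n<N. sqrt (\<theta> n) / \<theta> n) * c"
proof -
  have "partial_norm N x \<le> (\<Sum>n<N. sqrt (\<theta> n) * gauge n x)"
    unfolding partial_norm_def
    by (rule L2_set_le_sum) (simp add: gauge_nonneg spaceD assms)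
  also have "\<dots> \<le> (\<Sum>n<N. sqrt (\<theta> n) * (c / \<theta> n))"
    by (intro sum_mono mult_left_mono gauge_le_sup assms) auto
  also have "\<dots> = (\<Sum>n<N. sqrt (\<theta> n) / \<theta> n) * c"
    by (simp add: sum_distrib_right)
  finally show ?thesis .
qed

lemma inorm_sum_le: "finite I \<Longrightarrow> (\<And>i. i \<in> I \<Longrightarrow> x i \<in> space) \<Longrightarrow> inorm (\<lambda>w. \<Sum>i\<in>I. c i * x i w) \<le> (\<Sum>i\<in>I. \<bar>c i\<bar> * inorm (x i))"
proof (induction I rule: finite_induct)
  case (insert i I)
  have "inorm (\<lambda>w. c i * x i w + (\<Sum>i\<in>I. c i * x i w)) \<le> inorm (\<lambda>w. c i * x i w) + inorm (\<lambda>w. \<Sum>i\<in>I. c i * x i w)"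
    using insert.prems by (intro space_add space_sum space_cmult) auto
  also have "\<dots> \<le> \<bar>c i\<bar> * inorm (x i) + (\<Sum>i\<in>I. \<bar>c i\<bar> * inorm (x i))"
    using insert by (simp add: space_cmult)
  finally show ?case
    using insert.hyps by simp
qed simp

text \<open>Since a vector almost attaining the norm of \<open>\<psi>\<close> has small tail, the \<open>\<ell>\<^sub>2\<close>-sum forces
  \<open>\<psi>\<close> to be controlled by the supremum norm up to a small multiple of the norm.\<close>

lemma functional_bound:
  assumes \<psi>: "bounded_functional Y \<psi>" and "\<tau> > 0"
  obtains \<kappa> where "\<kappa> \<ge> 1" "\<And>x c. x \<in> space \<Longrightarrow> (\<And>w. \<bar>x w\<bar> \<le> c) \<Longrightarrow> \<psi> x \<le> \<kappa> * c + \<tau> * inorm x"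
proof -
  have add: "\<psi> (\<lambda>w. x w + y w) = \<psi> x + \<psi> y" if "x \<in> space" "y \<in> space" for x y
    using \<psi> that by (simp add: bounded_functional_def)
  have cmult: "\<psi> (\<lambda>w. c * x w) = c * \<psi> x" if "x \<in> space" for x c
    using \<psi> that by (simp add: bounded_functional_def)
  obtain C where C: "\<And>x. x \<in> space \<Longrightarrow> \<bar>\<psi> x\<bar> \<le> C * inorm x"
    using \<psi> unfolding bounded_functional_def by (simp, blast)
  define ball where "ball = {x \<in> space. inorm x \<le> 1}"
  define S where "S = (SUP x\<in>ball. \<psi> x)"
  have bdd: "bdd_above (\<psi> ` ball)"
  proof (rule bdd_aboveI)
    fix r assume "r \<in> \<psi> ` ball"
    then obtain x where x: "x \<in> space" "inorm x \<le> 1" "r = \<psi> x" by (auto simp: ball_def)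
    have "\<psi> x \<le> C * inorm x" using C[OF x(1)] by linarith
    also have "\<dots> \<le> \<bar>C\<bar> * 1"
      using x inorm_nonneg[OF x(1)] by (intro mult_mono) auto
    finally show "r \<le> \<bar>C\<bar>" using x by simp
  qed
  have zero: "(\<lambda>w. 0) \<in> ball" by (simp add: ball_def)
  have S_upper: "\<psi> x \<le> S" if "x \<in> ball" for x
    unfolding S_def using bdd that by (rule cSUP_upper[rotated])
  have "S \<ge> 0"
    using S_upper[OF zero] C[OF zero_in_space] by simp
  have null: "\<psi> x = 0" if "x \<in> space" "inorm x = 0" for x
    using C[OF that(1)] that(2) by simp
  have scale: "(\<lambda>w. (1 / inorm x) * x w) \<in> ball" if "x \<in> space" "inorm x \<noteq> 0" for x
    using space_cmult[OF that(1), of "1 / inorm x"] inorm_nonneg[OF that(1)] that(2) by (simp add: ball_def)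
  have S: "\<psi> x \<le> S * inorm x" if x: "x \<in> space" for x
  proof (cases "inorm x = 0")
    case False
    then have "inorm x > 0" using inorm_nonneg[OF x] by simp
    then show ?thesis
      using S_upper[OF scale[OF x False]] unfolding cmult[OF x] by (simp add: field_simps)
  qed (use null x in simp)
  \<comment> \<open>With \<open>\<psi> y\<close> within \<open>\<sigma>\<^sup>2\<close> of the
    supremum \<open>S\<close>, comparing \<open>\<psi>\<close> at \<open>y\<close> and at
    \<open>y + \<sigma> * x\<close> leaves an error of
    \<open>\<sigma>\<^sup>2 * (1 + 2 * S)\<close>. Division by \<open>\<sigma>\<close> must bring
    this below \<open>\<tau>\<close>.\<close>
  define \<sigma> where "\<sigma> = min 1 (\<tau> / (1 + 2 * S))"
  have \<sigma>: "0 < \<sigma>" "\<sigma> \<le> 1" "\<sigma> * (1 + 2 * S) \<le> \<tau>"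
  proof -
    show "0 < \<sigma>" "\<sigma> \<le> 1" using \<open>\<tau> > 0\<close> \<open>S \<ge> 0\<close> by (auto simp: \<sigma>_def)
    have "\<sigma> \<le> \<tau> / (1 + 2 * S)" by (simp add: \<sigma>_def)
    then show "\<sigma> * (1 + 2 * S) \<le> \<tau>" using \<open>S \<ge> 0\<close> by (simp add: pos_le_divide_eq)
  qed
  have "S - \<sigma>\<^sup>2 < S" using \<sigma>(1) by simp
  then obtain y where y: "y \<in> ball" "S - \<sigma>\<^sup>2 < \<psi> y"
    unfolding S_def using less_cSUP_iff[OF _ bdd] zero by blast
  then have y_space: "y \<in> space" "inorm y \<le> 1" by (auto simp: ball_def)
  obtain N where N: "\<And>M. N \<le> M \<Longrightarrow> tail_norm N M y \<le> \<sigma>\<^sup>2"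
    using small_tail[OF y_space(1), of "\<sigma>\<^sup>2"] \<sigma>(1) by auto
  have unit: "\<psi> x \<le> S * partial_norm N x + \<tau>" if x: "x \<in> space" "inorm x \<le> 1" for x
  proof -
    have "\<sigma>\<^sup>2 \<le> \<sigma>" using \<sigma> by (simp add: power2_eq_square mult_left_le)
    then have "(\<sigma>\<^sup>2 + \<sigma>)\<^sup>2 \<le> (2 * \<sigma>)\<^sup>2"
      using \<sigma> by (intro power_mono) auto
    then have *: "(\<sigma>\<^sup>2 + \<sigma>)\<^sup>2 / 2 \<le> 2 * \<sigma>\<^sup>2" by (simp add: power_mult_distrib)
    have "\<psi> y + \<sigma> * \<psi> x = \<psi> (\<lambda>w. y w + \<sigma> * x w)"
      using add[OF y_space(1) space_cmult(1)[OF x(1), of \<sigma>]] cmult[OF x(1)] by simp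
    also have "\<dots> \<le> S * inorm (\<lambda>w. y w + \<sigma> * x w)"
      by (intro S space_add space_cmult x y_space)
    also have "\<dots> \<le> S * (1 + \<sigma> * partial_norm N x + (\<sigma>\<^sup>2 + \<sigma>)\<^sup>2 / 2)"
      using \<sigma> N x y_space \<open>S \<ge> 0\<close> by (intro mult_left_mono inorm_head_tail) auto
    also have "\<dots> \<le> S * (1 + \<sigma> * partial_norm N x + 2 * \<sigma>\<^sup>2)"
      using * \<open>S \<ge> 0\<close> by (intro mult_left_mono) auto
    finally have "\<sigma> * \<psi> x \<le> \<sigma> * (S * partial_norm N x + \<sigma> * (1 + 2 * S))"
      using y(2) by (simp add: algebra_simps power2_eq_square)
    then have "\<psi> x \<le> S * partial_norm N x + \<sigma> * (1 + 2 * S)"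
      using \<sigma>(1) by simp
    then show ?thesis using \<sigma>(3) by linarith
  qed
  define \<kappa> where "\<kappa> = S * (\<Sum>n<N. sqrt (\<theta> n) / \<theta> n)"
  have "\<kappa> \<ge> 0" unfolding \<kappa>_def using \<open>S \<ge> 0\<close> by (intro mult_nonneg_nonneg sum_nonneg) auto
  \<comment> \<open>The extra 1 makes the constant at least 1; functionals are divided by it
    later.\<close>
  have "\<psi> x \<le> (\<kappa> + 1) * c + \<tau> * inorm x" if x: "x \<in> space" and c: "\<And>w. \<bar>x w\<bar> \<le> c" for x c
  proof -
    have "0 \<le> c" using c by (meson abs_ge_zero order_trans)
    show ?thesis
    proof (cases "inorm x = 0")
      case True
      then show ?thesis using null[OF x True] \<open>0 \<le> c\<close> \<open>\<kappa> \<ge> 0\<close> by simp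
    next
      case False
      then have "inorm x > 0" using inorm_nonneg[OF x] by simp
      let ?x = "\<lambda>w. (1 / inorm x) * x w"
      have x': "?x \<in> space" "inorm ?x \<le> 1"
        using scale[OF x False] by (auto simp: ball_def)
      have "\<bar>?x w\<bar> \<le> c / inorm x" for w
        using c[of w] \<open>inorm x > 0\<close> by (simp add: abs_mult divide_right_mono)
      then have "partial_norm N ?x \<le> (\<Sum>n<N. sqrt (\<theta> n) / \<theta> n) * (c / inorm x)"
        by (rule partial_norm_le_sup[OF x'(1)])
      then have "S * partial_norm N ?x \<le> \<kappa> * (c / inorm x)"
        unfolding \<kappa>_def mult.assoc using \<open>S \<ge> 0\<close> by (rule mult_left_mono)
      then have "\<psi> ?x \<le> \<kappa> * (c / inorm x) + \<tau>"
        using unit[OF x'] by linarith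
      then have "\<psi> x \<le> \<kappa> * c + \<tau> * inorm x"
        unfolding cmult[OF x] using \<open>inorm x > 0\<close> by (simp add: field_simps)
      then show ?thesis using \<open>0 \<le> c\<close> by (simp add: algebra_simps)
    qed
  qed
  then show ?thesis
    using \<open>\<kappa> \<ge> 0\<close> by (intro that[of "\<kappa> + 1"]) auto
qed

text \<open>A single term of the l2-sum already places \<open>sqrt (\<theta> k)\<close> times the
  unit ball of \<open>Y\<close> in the closed \<open>k\<close>-th interpolating set; this is that
  inclusion, read through support functions.\<close>

lemma pairing_le_dnorm:
  assumes "z \<in> space" "inorm z \<le> 1"
  shows "sqrt (\<theta> k) * pairing \<nu> z \<le> dnorm k \<nu>"
proof -
  have "sqrt (\<theta> k) * gauge k z \<le> 1"
    using gauge_le_partial_norm[of k "Suc k" z] partial_norm_le_inorm[OF assms(1), of "Suc k"] assms(2)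
    by linarith
  then have le: "sqrt (\<theta> k) * gauge k z * dnorm k \<nu> \<le> 1 * dnorm k \<nu>"
    by (rule mult_right_mono) (rule dnorm_nonneg)
  have "sqrt (\<theta> k) * pairing \<nu> z \<le> sqrt (\<theta> k) * (gauge k z * dnorm k \<nu>)"
    by (intro mult_left_mono pairing_le_gauge spaceD assms) simp
  also have "\<dots> \<le> dnorm k \<nu>"
    using le by (simp only: mult.assoc mult_1)
  finally show ?thesis .
qed

text \<open>\<open>sqrt (\<theta> k) * z\<close> lies in the closure of \<open>(1 -
  \<theta>\<^sub>k) conv (A \<union> -A) + \<theta>\<^sub>k B\<close>. On finitely many coordinates
  separation produces an approximating element of the sum itself; its part in the ball is absorbed
  into the error.\<close>

lemma finite_decomposition:
  assumes z: "z \<in> space" "inorm z \<le> 1" and G: "finite G" and "\<eta> > 0"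
  shows "\<exists>\<alpha>\<in>l1_ball A. \<forall>w\<in>G. \<bar>sqrt (\<theta> k) * z w - (1 - \<theta> k) * pairing \<alpha> (\<lambda>a. a w)\<bar> \<le> \<theta> k + \<eta>"
proof -
  let ?P = "\<lambda>\<alpha> w. pairing \<alpha> (\<lambda>a. a w)"
  define D where "D = {d. \<exists>\<alpha>\<in>l1_ball A. \<exists>b. (\<forall>w. \<bar>b w\<bar> \<le> 1) \<and> (\<forall>w. d w = (1 - \<theta> k) * ?P \<alpha> w + \<theta> k * b w)}"
  have P_bound: "\<bar>?P \<alpha> w\<bar> \<le> 1" if "\<alpha> \<in> l1_ball A" for \<alpha> w
    using that A_bound by (intro abs_pairing_l1_ball_le) auto
  have "\<exists>d\<in>D. \<forall>w\<in>G. \<bar>d w - sqrt (\<theta> k) * z w\<bar> \<le> \<eta>"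
  proof (rule finite_separation[OF G _ _ _ _ \<open>\<eta> > 0\<close>])
    have "(\<lambda>w. 0) \<in> D"
      unfolding D_def mem_Collect_eq
      by (intro bexI[of _ 0] exI[of _ "\<lambda>w. 0"]) (auto simp: l1_ball_def)
    then show "D \<noteq> {}" by blast
  next
    fix d e :: "'b \<Rightarrow> real" and t :: real
    assume "d \<in> D" "e \<in> D" and t: "0 \<le> t" "t \<le> 1"
    then obtain \<alpha> b \<beta> c where \<alpha>: "\<alpha> \<in> l1_ball A" and \<beta>: "\<beta> \<in> l1_ball A"
      and b: "\<forall>w. \<bar>b w\<bar> \<le> 1" and c: "\<forall>w. \<bar>c w\<bar> \<le> 1"
      and d: "\<forall>w. d w = (1 - \<theta> k) * ?P \<alpha> w + \<theta> k * b w" and e: "\<forall>w. e w = (1 - \<theta> k) * ?P \<beta> w + \<theta> k * c w"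
      unfolding D_def by auto
    have h: "(\<lambda>w. (1 - t) * d w + t * e w) \<in> D"
      unfolding D_def mem_Collect_eq
    proof (intro bexI[of _ "(1 - t) *\<^sub>R \<alpha> + t *\<^sub>R \<beta>"] exI[of _ "\<lambda>w. (1 - t) * b w + t * c w"] conjI allI)
      fix w
      have "\<bar>(1 - t) * b w + t * c w\<bar> \<le> (1 - t) * \<bar>b w\<bar> + t * \<bar>c w\<bar>"
        using t abs_triangle_ineq[of "(1 - t) * b w" "t * c w"] by (simp add: abs_mult)
      also have "\<dots> \<le> 1"
        using b c t by (intro convex_bound_le) auto
      finally show "\<bar>(1 - t) * b w + t * c w\<bar> \<le> 1" .
      show "(1 - t) * d w + t * e w =
          (1 - \<theta> k) * ?P ((1 - t) *\<^sub>R \<alpha> + t *\<^sub>R \<beta>) w + \<theta> k * ((1 - t) * b w + t * c w)"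
        unfolding pairing_add_left pairing_scaleR_left d[rule_format] e[rule_format] by (simp add: algebra_simps)
    qed (rule l1_ball_convex[OF \<alpha> \<beta> t])
    show "\<exists>h\<in>D. \<forall>w\<in>G. h w = (1 - t) * d w + t * e w"
      by (rule bexI[OF _ h]) simp
  next
    fix d w assume "d \<in> D"
    then obtain \<alpha> b where "\<alpha> \<in> l1_ball A" and b: "\<bar>b w\<bar> \<le> 1" and d: "d w = (1 - \<theta> k) * ?P \<alpha> w + \<theta> k * b w"
      unfolding D_def by auto
    then have "(1 - \<theta> k) * \<bar>?P \<alpha> w\<bar> + \<theta> k * \<bar>b w\<bar> \<le> 1"
      using P_bound \<theta>_le[of k] by (intro convex_bound_le) auto
    then show "\<bar>d w\<bar> \<le> 1"
      using abs_triangle_ineq[of "(1 - \<theta> k) * ?P \<alpha> w" "\<theta> k * b w"] \<theta>_le[of k] by (simp add: d abs_mult)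
  next
    fix c :: "'b \<Rightarrow> real" and \<epsilon> :: real assume "\<epsilon> > 0"
    define \<nu> where "\<nu> = combination G c"
    have "\<exists>a\<in>A. A_norm \<nu> - \<epsilon> < \<bar>pairing \<nu> a\<bar>"
      using less_cSUP_iff[OF A_nonempty bdd_above_A, of "A_norm \<nu> - \<epsilon>" \<nu>] \<open>\<epsilon> > 0\<close> by (simp add: A_norm_def)
    then obtain a where a: "a \<in> A" "A_norm \<nu> - \<epsilon> < \<bar>pairing \<nu> a\<bar>" by blast
    \<comment> \<open>Each summand is chosen to maximise \<open>c\<close>: a near maximiser of
      \<open>A_norm\<close>, with its sign, and the sign pattern of \<open>c\<close>, which attains
      the l1 norm.\<close>
    define d where "d w = (1 - \<theta> k) * (sgn (pairing \<nu> a) * a w) + \<theta> k * sgn (c w)" for w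
    have "d \<in> D"
      unfolding D_def mem_Collect_eq
      by (intro bexI[of _ "Poly_Mapping.single a (sgn (pairing \<nu> a))"] exI[of _ "\<lambda>w. sgn (c w)"] single_in_l1_ball)
        (auto simp: d_def a abs_sgn_eq)
    have "(\<Sum>w\<in>G. c w * (sqrt (\<theta> k) * z w)) = sqrt (\<theta> k) * pairing \<nu> z"
      by (simp add: \<nu>_def pairing_combination sum_distrib_left mult.left_commute)
    also have "\<dots> \<le> dnorm k \<nu>"
      by (rule pairing_le_dnorm[OF z])
    also have "\<dots> \<le> (1 - \<theta> k) * (\<bar>pairing \<nu> a\<bar> + \<epsilon>) + \<theta> k * norm \<nu>"
      unfolding dnorm_def using a \<theta>_le[of k] by (intro add_right_mono mult_left_mono) auto
    also have "\<dots> \<le> (1 - \<theta> k) * \<bar>pairing \<nu> a\<bar> + \<theta> k * norm \<nu> + \<epsilon>"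
      using mult_right_mono[of "1 - \<theta> k" 1 \<epsilon>] \<open>\<epsilon> > 0\<close> by (simp add: algebra_simps)
    also have "\<bar>pairing \<nu> a\<bar> = sgn (pairing \<nu> a) * (\<Sum>w\<in>G. c w * a w)"
      using abs_sgn[of "pairing \<nu> a"] by (simp add: \<nu>_def pairing_combination mult.commute)
    also have "norm \<nu> = (\<Sum>w\<in>G. c w * sgn (c w))"
      by (simp add: \<nu>_def norm_combination[OF G] abs_sgn)
    also have "(1 - \<theta> k) * (sgn (pairing \<nu> a) * (\<Sum>w\<in>G. c w * a w)) + \<theta> k * (\<Sum>w\<in>G. c w * sgn (c w)) =
        (\<Sum>w\<in>G. c w * d w)"
      by (simp add: d_def sum_distrib_left distrib_left sum.distrib mult_ac)
    finally show "\<exists>d\<in>D. (\<Sum>w\<in>G. c w * (sqrt (\<theta> k) * z w)) \<le> (\<Sum>w\<in>G. c w * d w) + \<epsilon>"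
      using \<open>d \<in> D\<close> by blast
  qed
  then obtain d where "d \<in> D" and d: "\<And>w. w \<in> G \<Longrightarrow> \<bar>d w - sqrt (\<theta> k) * z w\<bar> \<le> \<eta>" by blast
  then obtain \<alpha> b where \<alpha>: "\<alpha> \<in> l1_ball A" and b: "\<forall>w. \<bar>b w\<bar> \<le> 1"
    and db: "\<forall>w. d w = (1 - \<theta> k) * ?P \<alpha> w + \<theta> k * b w"
    unfolding D_def by auto
  have "\<bar>sqrt (\<theta> k) * z w - (1 - \<theta> k) * ?P \<alpha> w\<bar> \<le> \<theta> k + \<eta>" if "w \<in> G" for w
  proof -
    have "\<bar>\<theta> k * b w\<bar> \<le> \<theta> k"
      using b by (simp add: abs_mult mult_left_le)
    moreover have "sqrt (\<theta> k) * z w - (1 - \<theta> k) * ?P \<alpha> w = \<theta> k * b w - (d w - sqrt (\<theta> k) * z w)"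
      using db by simp
    ultimately show ?thesis
      using d[OF that] by linarith
  qed
  with \<alpha> show ?thesis by blast
qed

lemma bounded_functional_pairing: "bounded_functional Y (\<lambda>x. pairing \<nu> x)"
proof -
  have "\<bar>pairing \<nu> x\<bar> \<le> norm \<nu> * inorm x" if "x \<in> space" for x
    using abs_pairing_le[of \<nu> x "inorm x"] abs_le_inorm[OF that] by (simp add: mult.commute)
  then show ?thesis
    by (auto simp: bounded_functional_def pairing_add_right pairing_mult_right)
qed

end

section \<open>Double limits on the unit ball, and density of the finitely supported
  functionals\<close>

locale reflexive_interpolation = interpolation A + free_ultrafilter U
  for A :: "('b \<Rightarrow> real) set" and U +
  assumes interchange_A: "interchange (\<lambda>a w. a w) A UNIV"
begin

lemma interchange_conv_A: "interchange (\<lambda>\<alpha> w. pairing \<alpha> (\<lambda>a. a w)) (l1_ball A) UNIV"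
  by (rule interchange_l1_ball[OF interchange_A, of 1]) (use A_bound in auto)

lemma abs_pairing_A_le_1: "\<alpha> \<in> l1_ball A \<Longrightarrow> \<bar>pairing \<alpha> (\<lambda>a. a w)\<bar> \<le> 1"
  using A_bound by (intro abs_pairing_l1_ball_le) auto

text \<open>Hulls are taken on one side at a time, with the roles exchanged in between. The order of
  the pairings is the one that \<open>uniform_approximation\<close> asks for.\<close>

lemma interchange_conv_conv:
  "interchange (\<lambda>\<nu> \<alpha>. pairing \<alpha> (\<lambda>a. pairing \<nu> a)) (l1_ball UNIV) (l1_ball A)"
proof -
  have "interchange (\<lambda>\<nu> \<alpha>. pairing \<nu> (\<lambda>w. pairing \<alpha> (\<lambda>a. a w))) (l1_ball UNIV) (l1_ball A)"
    by (rule interchange_l1_ball[OF interchange_flip[OF interchange_conv_A], of 1])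
      (use abs_pairing_A_le_1 in auto)
  moreover have "(\<lambda>\<nu> \<alpha>. pairing \<nu> (\<lambda>w. pairing \<alpha> (\<lambda>a. a w))) =
      (\<lambda>(\<nu> :: 'b \<Rightarrow>\<^sub>0 real) \<alpha>. pairing \<alpha> (\<lambda>a. pairing \<nu> a))"
    by (intro ext) (rule pairing_swap)
  ultimately show ?thesis by simp
qed

text \<open>Here compactness enters: the pointwise closure of \<open>conv (A \<union> -A)\<close> agrees with its
  norm closure.\<close>

lemma decomposition:
  assumes z: "z \<in> space" "inorm z \<le> 1"
  shows "\<exists>\<alpha>\<in>l1_ball A. \<forall>w. \<bar>z w - (1 - \<theta> k) / sqrt (\<theta> k) * pairing \<alpha> (\<lambda>a. a w)\<bar> \<le> 2 * sqrt (\<theta> k)"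
proof -
  let ?s = "1 - \<theta> k"
  have s: "?s > 0" by (simp add: \<theta>_def power_Suc_less_one del: power_Suc)
  \<comment> \<open>Approximation of \<open>\<psi>\<close> uniformly on \<open>l1_ball UNIV\<close>
    is approximation of \<open>z\<close> in the supremum norm, by evaluating at point masses. The
    whole ball replaces the point masses because \<open>uniform_approximation\<close> needs a convex
    symmetric domain.\<close>
  define \<psi> where "\<psi> \<nu> = sqrt (\<theta> k) * pairing \<nu> z / ?s" for \<nu>
  have \<psi>_bound: "\<bar>\<psi> \<nu>\<bar> \<le> sqrt (\<theta> k) * 1 / ?s" if "\<nu> \<in> l1_ball UNIV" for \<nu>
  proof -
    have "\<bar>pairing \<nu> z\<bar> \<le> 1"
      using abs_le_inorm[OF z(1)] z(2) by (intro abs_pairing_l1_ball_le[OF that]) (auto intro: order_trans)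
    then show ?thesis
      unfolding \<psi>_def using s by (simp add: abs_mult divide_right_mono mult_left_le)
  qed
  have "\<exists>\<alpha>\<in>l1_ball A. \<forall>\<nu>\<in>l1_ball UNIV. \<bar>\<psi> \<nu> - pairing \<alpha> (\<lambda>a. pairing \<nu> a)\<bar> \<le> 2 * \<theta> k / ?s"
  proof (rule uniform_approximation[OF _ _ \<psi>_bound])
    show "\<bar>pairing \<nu> a\<bar> \<le> 1" if "\<nu> \<in> l1_ball UNIV" "a \<in> A" for \<nu> a
      using that A_bound by (intro abs_pairing_l1_ball_le) auto
    show "l1_ball UNIV \<noteq> ({} :: ('b \<Rightarrow>\<^sub>0 real) set)"
      by (auto simp: l1_ball_def intro: exI[of _ 0])
    show "\<exists>\<nu>\<in>l1_ball UNIV. \<psi> \<nu> = (1 - t) * \<psi> \<mu> + t * \<psi> \<mu>' \<and>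
        (\<forall>a\<in>A. pairing \<nu> a = (1 - t) * pairing \<mu> a + t * pairing \<mu>' a)"
      if "\<mu> \<in> l1_ball UNIV" "\<mu>' \<in> l1_ball UNIV" "0 \<le> t" "t \<le> 1" for \<mu> \<mu>' t
      by (intro bexI[of _ "(1 - t) *\<^sub>R \<mu> + t *\<^sub>R \<mu>'"] l1_ball_convex that)
        (simp add: \<psi>_def pairing_add_left pairing_scaleR_left add_divide_distrib distrib_left mult_ac)
    show "free_ultrafilter U" by unfold_locales
    show "interchange (\<lambda>\<nu> \<alpha>. pairing \<alpha> (\<lambda>a. pairing \<nu> a)) (l1_ball UNIV) (l1_ball A)"
      by (rule interchange_conv_conv)
    show "\<exists>\<nu>'\<in>l1_ball UNIV. \<psi> \<nu>' = - \<psi> \<nu> \<and> (\<forall>a\<in>A. pairing \<nu>' a = - pairing \<nu> a)"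
      if "\<nu> \<in> l1_ball UNIV" for \<nu>
      by (intro bexI[of _ "- \<nu>"] l1_ball_uminus that) (simp add: \<psi>_def pairing_uminus_left)
    \<comment> \<open>The finite approximation has error \<open>\<theta> k\<close> plus the slack
      \<open>\<theta> k / 2\<close>, and the strict increase to \<open>2 * \<theta> k\<close> pays
      for uniformity. After rescaling by \<open>sqrt (\<theta> k)\<close> the error still tends to 0
      with \<open>k\<close>.\<close>
    show "(\<theta> k + \<theta> k / 2) / ?s < 2 * \<theta> k / ?s"
      using s \<theta>_pos(1)[of k] by (intro divide_strict_right_mono) auto
    fix F :: "('b \<Rightarrow>\<^sub>0 real) set" assume F: "finite F" "F \<subseteq> l1_ball UNIV"
    define G where "G = (\<Union>\<nu>\<in>F. Poly_Mapping.keys \<nu>)"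
    have "finite G" using F(1) by (simp add: G_def)
    then obtain \<alpha> where \<alpha>: "\<alpha> \<in> l1_ball A"
      "\<And>w. w \<in> G \<Longrightarrow> \<bar>sqrt (\<theta> k) * z w - ?s * pairing \<alpha> (\<lambda>a. a w)\<bar> \<le> \<theta> k + \<theta> k / 2"
      using finite_decomposition[OF z, of G "\<theta> k / 2" k] by auto
    have "\<bar>\<psi> \<nu> - pairing \<alpha> (\<lambda>a. pairing \<nu> a)\<bar> \<le> (\<theta> k + \<theta> k / 2) / ?s" if \<nu>: "\<nu> \<in> F" for \<nu>
    proof -
      have "\<bar>pairing \<nu> (\<lambda>w. sqrt (\<theta> k) * z w - ?s * pairing \<alpha> (\<lambda>a. a w))\<bar> \<le> (\<theta> k + \<theta> k / 2) * norm \<nu>"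
        using \<alpha>(2) \<nu> by (intro abs_pairing_le) (auto simp: G_def)
      also have "\<dots> \<le> \<theta> k + \<theta> k / 2"
        using F(2) \<nu> by (intro mult_left_le) (auto simp: l1_ball_def)
      finally have le: "\<bar>sqrt (\<theta> k) * pairing \<nu> z - ?s * pairing \<alpha> (\<lambda>a. pairing \<nu> a)\<bar> \<le> \<theta> k + \<theta> k / 2"
        by (simp add: pairing_diff_right pairing_mult_right pairing_swap[of \<nu> \<alpha> "\<lambda>w a. a w"])
      have eq: "\<psi> \<nu> - pairing \<alpha> (\<lambda>a. pairing \<nu> a) =
          (sqrt (\<theta> k) * pairing \<nu> z - ?s * pairing \<alpha> (\<lambda>a. pairing \<nu> a)) / ?s"
        using s by (simp add: \<psi>_def diff_divide_distrib)
      show ?thesis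
        unfolding eq abs_divide abs_of_pos[OF s] by (rule divide_right_mono[OF le less_imp_le[OF s]])
    qed
    with \<alpha>(1) show "\<exists>\<alpha>\<in>l1_ball A. \<forall>\<nu>\<in>F. \<bar>\<psi> \<nu> - pairing \<alpha> (\<lambda>a. pairing \<nu> a)\<bar> \<le> (\<theta> k + \<theta> k / 2) / ?s"
      by blast
  qed simp
  then obtain \<alpha> where \<alpha>: "\<alpha> \<in> l1_ball A"
    "\<And>\<nu>. \<nu> \<in> l1_ball UNIV \<Longrightarrow> \<bar>\<psi> \<nu> - pairing \<alpha> (\<lambda>a. pairing \<nu> a)\<bar> \<le> 2 * \<theta> k / ?s" by blast
  have "\<bar>z w - ?s / sqrt (\<theta> k) * pairing \<alpha> (\<lambda>a. a w)\<bar> \<le> 2 * sqrt (\<theta> k)" for w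
  proof -
    have "\<bar>sqrt (\<theta> k) * z w / ?s - pairing \<alpha> (\<lambda>a. a w)\<bar> \<le> 2 * \<theta> k / ?s"
      using \<alpha>(2)[of "Poly_Mapping.single w 1"] by (simp add: single_in_l1_ball \<psi>_def)
    then have le: "?s / sqrt (\<theta> k) * \<bar>sqrt (\<theta> k) * z w / ?s - pairing \<alpha> (\<lambda>a. a w)\<bar> \<le> ?s / sqrt (\<theta> k) * (2 * \<theta> k / ?s)"
      using s by (intro mult_left_mono) auto
    have "z w - ?s / sqrt (\<theta> k) * pairing \<alpha> (\<lambda>a. a w) =
        ?s / sqrt (\<theta> k) * (sqrt (\<theta> k) * z w / ?s - pairing \<alpha> (\<lambda>a. a w))"
      using s less_imp_neq[OF \<theta>_pos(1)[of k]] by (simp add: right_diff_distrib)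
    then have "\<bar>z w - ?s / sqrt (\<theta> k) * pairing \<alpha> (\<lambda>a. a w)\<bar> =
        ?s / sqrt (\<theta> k) * \<bar>sqrt (\<theta> k) * z w / ?s - pairing \<alpha> (\<lambda>a. a w)\<bar>"
      using s by (simp only: abs_mult) simp
    also note le
    also have "?s / sqrt (\<theta> k) * (2 * \<theta> k / ?s) = 2 * (\<theta> k / sqrt (\<theta> k))"
      using s by simp
    finally show ?thesis
      by (simp only: real_div_sqrt[OF \<theta>_pos(2)])
  qed
  with \<alpha>(1) show ?thesis by blast
qed

lemma ulim_close:
  assumes f: "\<And>n. \<bar>f n\<bar> \<le> B" and g: "\<And>n. \<bar>g n\<bar> \<le> C" and "\<And>n. \<bar>f n - g n\<bar> \<le> \<delta>"
  shows "\<bar>ulim f - ulim g\<bar> \<le> \<delta>"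
  unfolding ulim_diff[OF f g, symmetric] by (rule abs_ulim_le) fact

text \<open>Grothendieck's criterion: a set that for every \<open>k\<close> lies uniformly within
  \<open>2 * sqrt (\<theta> k)\<close> of a multiple of a set with the double limit condition has
  the condition itself. The multiples may grow, since only the errors enter the comparison.\<close>

lemma interchange_ball: "interchange (\<lambda>z w. z w) {z \<in> space. inorm z \<le> 1} UNIV"
  unfolding interchange_def
proof (intro allI impI)
  fix z :: "nat \<Rightarrow> 'b \<Rightarrow> real" and w :: "nat \<Rightarrow> 'b"
  assume "range z \<subseteq> {z \<in> space. inorm z \<le> 1}"
  then have z: "z m \<in> space" "inorm (z m) \<le> 1" for m by auto
  have z1: "\<bar>z m w\<bar> \<le> 1" for m w
    using abs_le_inorm[OF z(1)] z(2) by (rule order_trans)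
  let ?L = "ulim (\<lambda>m. ulim (\<lambda>n. z m (w n)))" and ?R = "ulim (\<lambda>n. ulim (\<lambda>m. z m (w n)))"
  have "\<bar>?L - ?R\<bar> \<le> 4 * sqrt (\<theta> k)" for k
  proof -
    define c where "c = (1 - \<theta> k) / sqrt (\<theta> k)"
    have "\<forall>m. \<exists>\<alpha>. \<alpha> \<in> l1_ball A \<and> (\<forall>w. \<bar>z m w - c * pairing \<alpha> (\<lambda>a. a w)\<bar> \<le> 2 * sqrt (\<theta> k))"
      using decomposition[OF z] unfolding c_def by blast
    then have "\<exists>\<alpha>. \<forall>m. \<alpha> m \<in> l1_ball A \<and> (\<forall>w. \<bar>z m w - c * pairing (\<alpha> m) (\<lambda>a. a w)\<bar> \<le> 2 * sqrt (\<theta> k))"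
      by (rule choice)
    then obtain \<alpha> where \<alpha>: "\<And>m. \<alpha> m \<in> l1_ball A"
      "\<And>m w. \<bar>z m w - c * pairing (\<alpha> m) (\<lambda>a. a w)\<bar> \<le> 2 * sqrt (\<theta> k)"
      by blast
    let ?p = "\<lambda>m n. pairing (\<alpha> m) (\<lambda>a. a (w n))"
    have p1: "\<bar>?p m n\<bar> \<le> 1" for m n
      using \<alpha>(1) by (rule abs_pairing_A_le_1)
    have pc: "\<bar>c * ?p m n\<bar> \<le> \<bar>c\<bar>" for m n
      using p1[of m n] by (simp add: abs_mult mult_left_le)
    have "\<bar>?L - ulim (\<lambda>m. ulim (\<lambda>n. c * ?p m n))\<bar> \<le> 2 * sqrt (\<theta> k)"
      by (rule ulim_close[OF abs_ulim_le abs_ulim_le ulim_close]) (rule z1 pc \<alpha>)+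
    moreover have "\<bar>?R - ulim (\<lambda>n. ulim (\<lambda>m. c * ?p m n))\<bar> \<le> 2 * sqrt (\<theta> k)"
      by (rule ulim_close[OF abs_ulim_le abs_ulim_le ulim_close]) (rule z1 pc \<alpha>)+
    moreover have "ulim (\<lambda>m. ulim (\<lambda>n. c * ?p m n)) = c * ulim (\<lambda>m. ulim (\<lambda>n. ?p m n))"
      using ulim_cmult[OF p1] ulim_cmult[OF abs_ulim_le[OF p1]] by simp
    moreover have "ulim (\<lambda>n. ulim (\<lambda>m. c * ?p m n)) = c * ulim (\<lambda>n. ulim (\<lambda>m. ?p m n))"
      using ulim_cmult[OF p1] ulim_cmult[OF abs_ulim_le[OF p1]] by simp
    moreover have "ulim (\<lambda>m. ulim (\<lambda>n. ?p m n)) = ulim (\<lambda>n. ulim (\<lambda>m. ?p m n))"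
      using interchangeD[OF interchange_conv_A \<alpha>(1)] by simp
    ultimately show ?thesis by (simp add: abs_le_iff)
  qed
  moreover have "(\<lambda>k. 4 * sqrt (\<theta> k)) \<longlonglongrightarrow> 4 * sqrt 0"
    unfolding \<theta>_def by (intro tendsto_intros LIMSEQ_Suc LIMSEQ_power_zero) auto
  ultimately have "\<bar>?L - ?R\<bar> \<le> 4 * sqrt 0"
    using LIMSEQ_le_const[of "\<lambda>k. 4 * sqrt (\<theta> k)" "4 * sqrt 0" "\<bar>?L - ?R\<bar>"] by blast
  then show "?L = ?R" by simp
qed

text \<open>The bound on \<open>\<psi>\<close> compares it with the support function of
  \<open>\<kappa>\<close> times the l1 ball plus \<open>\<tau>\<close> times the dual ball. On a
  finite subset of the unit ball, arbitrary functions bounded by \<open>\<tau>\<close> can stand in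
  for the latter, because the norm of a combination is at most the sum of its absolute
  coefficients.\<close>

lemma finite_functional_approximation:
  assumes \<psi>: "bounded_functional Y \<psi>" and "\<kappa> \<ge> 1" "\<tau> > 0"
    and \<kappa>: "\<And>x c. x \<in> space \<Longrightarrow> (\<And>w. \<bar>x w\<bar> \<le> c) \<Longrightarrow> \<psi> x \<le> \<kappa> * c + \<tau> * inorm x"
    and F: "finite F" "F \<subseteq> {z \<in> space. inorm z \<le> 1}"
  shows "\<exists>\<nu>\<in>l1_ball UNIV. \<forall>z\<in>F. \<bar>\<psi> z - \<kappa> * pairing \<nu> z\<bar> \<le> 2 * \<tau>"
proof -
  have add: "\<psi> (\<lambda>w. x w + y w) = \<psi> x + \<psi> y" if "x \<in> space" "y \<in> space" for x y
    using \<psi> that by (simp add: bounded_functional_def)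
  have cmult: "\<psi> (\<lambda>w. c * x w) = c * \<psi> x" if "x \<in> space" for x c
    using \<psi> that by (simp add: bounded_functional_def)
  define D :: "(('b \<Rightarrow> real) \<Rightarrow> real) set" where "D = {d. \<exists>\<nu>\<in>l1_ball UNIV. \<exists>e. (\<forall>z. \<bar>e z\<bar> \<le> \<tau>) \<and> (\<forall>z. d z = \<kappa> * pairing \<nu> z + e z)}"
  have "\<exists>d\<in>D. \<forall>z\<in>F. \<bar>d z - \<psi> z\<bar> \<le> \<tau>"
  proof (rule finite_separation[OF F(1) _ _ _ _ \<open>\<tau> > 0\<close>])
    have "(\<lambda>w. 0) \<in> D"
      unfolding D_def mem_Collect_eq using \<open>\<tau> > 0\<close>
      by (intro bexI[of _ 0] exI[of _ "\<lambda>w. 0"]) (auto simp: l1_ball_def)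
    then show "D \<noteq> {}" by blast
  next
    fix d e :: "('b \<Rightarrow> real) \<Rightarrow> real" and t :: real
    assume "d \<in> D" "e \<in> D" and t: "0 \<le> t" "t \<le> 1"
    then obtain \<alpha> b \<beta> c where \<alpha>: "\<alpha> \<in> l1_ball UNIV" and \<beta>: "\<beta> \<in> l1_ball UNIV"
      and b: "\<forall>z. \<bar>b z\<bar> \<le> \<tau>" and c: "\<forall>z. \<bar>c z\<bar> \<le> \<tau>"
      and d: "\<forall>z. d z = \<kappa> * pairing \<alpha> z + b z" and e: "\<forall>z. e z = \<kappa> * pairing \<beta> z + c z"
      unfolding D_def by auto
    have h: "(\<lambda>z. (1 - t) * d z + t * e z) \<in> D"
      unfolding D_def mem_Collect_eq
    proof (intro bexI[of _ "(1 - t) *\<^sub>R \<alpha> + t *\<^sub>R \<beta>"] exI[of _ "\<lambda>z. (1 - t) * b z + t * c z"] conjI allI)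
      fix z
      have "\<bar>(1 - t) * b z + t * c z\<bar> \<le> (1 - t) * \<bar>b z\<bar> + t * \<bar>c z\<bar>"
        using t abs_triangle_ineq[of "(1 - t) * b z" "t * c z"] by (simp add: abs_mult)
      also have "\<dots> \<le> \<tau>"
        using b c t by (intro convex_bound_le) auto
      finally show "\<bar>(1 - t) * b z + t * c z\<bar> \<le> \<tau>" .
      show "(1 - t) * d z + t * e z =
          \<kappa> * pairing ((1 - t) *\<^sub>R \<alpha> + t *\<^sub>R \<beta>) z + ((1 - t) * b z + t * c z)"
        unfolding pairing_add_left pairing_scaleR_left d[rule_format] e[rule_format] by (simp add: algebra_simps)
    qed (rule l1_ball_convex[OF \<alpha> \<beta> t])
    show "\<exists>h\<in>D. \<forall>z\<in>F. h z = (1 - t) * d z + t * e z"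
      by (rule bexI[OF _ h]) simp
  next
    fix d z assume "d \<in> D" and z: "z \<in> F"
    then obtain \<alpha> b where \<alpha>: "\<alpha> \<in> l1_ball UNIV" and b: "\<bar>b z\<bar> \<le> \<tau>" and d: "d z = \<kappa> * pairing \<alpha> z + b z"
      unfolding D_def by auto
    have "\<bar>pairing \<alpha> z\<bar> \<le> 1"
      using abs_le_inorm[of z] z F(2) by (intro abs_pairing_l1_ball_le[OF \<alpha>]) (auto intro: order_trans)
    then have "\<bar>\<kappa> * pairing \<alpha> z\<bar> \<le> \<kappa>"
      using \<open>\<kappa> \<ge> 1\<close> by (simp add: abs_mult mult_left_le)
    then show "\<bar>d z\<bar> \<le> \<kappa> + \<tau>"
      using b d by linarith
  next
    fix c :: "('b \<Rightarrow> real) \<Rightarrow> real" and \<epsilon> :: real assume "\<epsilon> > 0"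
    define x where "x = (\<lambda>w. \<Sum>z\<in>F. c z * z w)"
    have x: "x \<in> space"
      unfolding x_def using F(2) by (intro space_sum space_cmult) auto
    have \<psi>x: "\<psi> x = (\<Sum>z\<in>F. c z * \<psi> z)"
      unfolding x_def using F
    proof (induction F rule: finite_induct)
      case empty
      then show ?case using cmult[OF zero_in_space, of 0] by simp
    next
      case (insert z F)
      then have "\<psi> (\<lambda>w. c z * z w + (\<Sum>z\<in>F. c z * z w)) = c z * \<psi> z + (\<Sum>z\<in>F. c z * \<psi> z)"
        by (subst add) (auto intro!: space_sum space_cmult simp: cmult)
      then show ?case using insert.hyps by simp
    qed
    have x_norm: "inorm x \<le> (\<Sum>z\<in>F. \<bar>c z\<bar>)"
    proof -
      have "inorm x \<le> (\<Sum>z\<in>F. \<bar>c z\<bar> * inorm z)"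
        unfolding x_def using F by (intro inorm_sum_le) auto
      also have "\<dots> \<le> (\<Sum>z\<in>F. \<bar>c z\<bar>)"
        using F(2) by (intro sum_mono mult_left_le) auto
      finally show ?thesis .
    qed
    define s where "s = (SUP w. \<bar>x w\<bar>)"
    have bdd: "bdd_above (range (\<lambda>w. \<bar>x w\<bar>))"
      using abs_le_inorm[OF x] by (intro bdd_aboveI[of _ "inorm x"]) auto
    have s: "\<bar>x w\<bar> \<le> s" for w
      unfolding s_def using bdd by (intro cSUP_upper) auto
    have "s - \<epsilon> / \<kappa> < s"
      using \<open>\<epsilon> > 0\<close> \<open>\<kappa> \<ge> 1\<close> by simp
    then obtain w where w: "s - \<epsilon> / \<kappa> < \<bar>x w\<bar>"
      unfolding s_def using less_cSUP_iff[OF _ bdd] by auto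
    \<comment> \<open>The signed point mass at \<open>w\<close> almost attains the supremum norm of
      \<open>x\<close>, and the signs of \<open>c\<close> attain the sum of the absolute
      coefficients.\<close>
    define g where "g = sgn (x w)"
    define d where "d z = \<kappa> * (g * z w) + \<tau> * sgn (c z)" for z
    have "d \<in> D"
      unfolding D_def mem_Collect_eq using \<open>\<tau> > 0\<close>
      by (intro bexI[of _ "Poly_Mapping.single w g"] exI[of _ "\<lambda>z. \<tau> * sgn (c z)"] single_in_l1_ball)
        (auto simp: d_def g_def abs_sgn_eq abs_mult)
    have "(\<Sum>z\<in>F. c z * \<psi> z) \<le> \<kappa> * s + \<tau> * inorm x"
      unfolding \<psi>x[symmetric] by (rule \<kappa>[OF x s])
    also have "\<dots> \<le> \<kappa> * (\<bar>x w\<bar> + \<epsilon> / \<kappa>) + \<tau> * (\<Sum>z\<in>F. \<bar>c z\<bar>)"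
      using w x_norm \<open>\<kappa> \<ge> 1\<close> \<open>\<tau> > 0\<close> by (intro add_mono mult_left_mono) auto
    also have "\<dots> = \<kappa> * (g * x w) + \<tau> * (\<Sum>z\<in>F. c z * sgn (c z)) + \<epsilon>"
      using \<open>\<kappa> \<ge> 1\<close> by (simp add: distrib_left abs_sgn mult.commute g_def)
    also have "\<kappa> * (g * x w) + \<tau> * (\<Sum>z\<in>F. c z * sgn (c z)) = (\<Sum>z\<in>F. c z * d z)"
      by (simp add: d_def x_def sum_distrib_left distrib_left sum.distrib mult_ac)
    finally show "\<exists>d\<in>D. (\<Sum>z\<in>F. c z * \<psi> z) \<le> (\<Sum>z\<in>F. c z * d z) + \<epsilon>"
      using \<open>d \<in> D\<close> by blast
  qed
  then obtain d where "d \<in> D" and d: "\<And>z. z \<in> F \<Longrightarrow> \<bar>d z - \<psi> z\<bar> \<le> \<tau>" by blast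
  then obtain \<nu> e where \<nu>: "\<nu> \<in> l1_ball UNIV" and e: "\<forall>z. \<bar>e z\<bar> \<le> \<tau>"
    and de: "\<forall>z. d z = \<kappa> * pairing \<nu> z + e z"
    unfolding D_def by auto
  have "\<bar>\<psi> z - \<kappa> * pairing \<nu> z\<bar> \<le> 2 * \<tau>" if "z \<in> F" for z
    using d[OF that] e[rule_format, of z] de[rule_format, of z] by linarith
  with \<nu> show ?thesis by blast
qed

text \<open>The double limit condition on the unit ball turns approximation on finite sets into
  approximation in the dual norm. Working with \<open>\<psi> / \<kappa>\<close> brings the
  approximants into the l1 ball. Starting from \<open>\<epsilon> / 3\<close>, the finite
  approximation costs two thirds of \<open>\<epsilon>\<close> and leaves room for the strict
  loss.\<close>

lemma finitely_supported_dense: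
  assumes \<psi>: "bounded_functional Y \<psi>" and "\<epsilon> > 0"
  shows "\<exists>\<nu>. \<forall>z\<in>space. \<bar>\<psi> z - pairing \<nu> z\<bar> \<le> \<epsilon> * inorm z"
proof -
  have add: "\<psi> (\<lambda>w. x w + y w) = \<psi> x + \<psi> y" if "x \<in> space" "y \<in> space" for x y
    using \<psi> that by (simp add: bounded_functional_def)
  have cmult: "\<psi> (\<lambda>w. c * x w) = c * \<psi> x" if "x \<in> space" for x c
    using \<psi> that by (simp add: bounded_functional_def)
  obtain \<kappa> where \<kappa>: "\<kappa> \<ge> 1" "\<And>x c. x \<in> space \<Longrightarrow> (\<And>w. \<bar>x w\<bar> \<le> c) \<Longrightarrow> \<psi> x \<le> \<kappa> * c + \<epsilon> / 3 * inorm x"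
    using functional_bound[OF \<psi>, of "\<epsilon> / 3"] \<open>\<epsilon> > 0\<close> by auto
  let ?X = "{z \<in> space. inorm z \<le> 1}"
  have upper: "\<psi> z \<le> \<kappa> + \<epsilon> / 3" if "z \<in> ?X" for z
  proof -
    have "\<psi> z \<le> \<kappa> * 1 + \<epsilon> / 3 * inorm z"
      using that abs_le_inorm[of z] by (intro \<kappa>) (auto intro: order_trans)
    also have "\<epsilon> / 3 * inorm z \<le> \<epsilon> / 3"
      using that \<open>\<epsilon> > 0\<close> by (intro mult_left_le) auto
    finally show ?thesis by simp
  qed
  have \<psi>_bound: "\<bar>\<psi> z / \<kappa>\<bar> \<le> \<kappa> + \<epsilon> / 3" if z: "z \<in> ?X" for z
  proof -
    have "(\<lambda>w. - z w) \<in> ?X" "\<psi> (\<lambda>w. - z w) = - \<psi> z"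
      using z space_uminus cmult[of z "-1"] by auto
    then have "\<bar>\<psi> z\<bar> \<le> \<kappa> + \<epsilon> / 3"
      using upper[OF z] upper[of "\<lambda>w. - z w"] by simp
    moreover have "\<bar>\<psi> z / \<kappa>\<bar> \<le> \<bar>\<psi> z\<bar> / 1"
      unfolding abs_divide using \<kappa>(1) by (intro divide_left_mono) auto
    ultimately show ?thesis by simp
  qed
  have "\<exists>\<nu>\<in>l1_ball UNIV. \<forall>z\<in>?X. \<bar>\<psi> z / \<kappa> - pairing \<nu> z\<bar> \<le> \<epsilon> / \<kappa>"
  proof (rule uniform_approximation[OF _ _ \<psi>_bound])
    show "\<bar>z w\<bar> \<le> 1" if "z \<in> ?X" for z w
      using that abs_le_inorm[of z w] by auto
    show "?X \<noteq> {}"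
      using zero_in_space inorm_zero by (metis (mono_tags, lifting) empty_iff mem_Collect_eq zero_le_one)
    show "\<exists>z\<in>?X. \<psi> z / \<kappa> = (1 - t) * (\<psi> x / \<kappa>) + t * (\<psi> x' / \<kappa>) \<and> (\<forall>w\<in>UNIV. z w = (1 - t) * x w + t * x' w)"
      if x: "x \<in> ?X" "x' \<in> ?X" and t: "0 \<le> t" "t \<le> 1" for x x' t
    proof (intro bexI[of _ "\<lambda>w. (1 - t) * x w + t * x' w"])
      have sp: "(\<lambda>w. (1 - t) * x w) \<in> space" "(\<lambda>w. t * x' w) \<in> space"
        using x by (auto intro: space_cmult)
      have "inorm (\<lambda>w. (1 - t) * x w + t * x' w) \<le> (1 - t) * inorm x + t * inorm x'"
        using space_add(2)[OF sp] x t by (simp add: space_cmult)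
      also have "\<dots> \<le> 1"
        using x t by (intro convex_bound_le) auto
      finally show "(\<lambda>w. (1 - t) * x w + t * x' w) \<in> ?X"
        using space_add(1)[OF sp] by simp
      have "\<psi> (\<lambda>w. (1 - t) * x w + t * x' w) = (1 - t) * \<psi> x + t * \<psi> x'"
        using add[OF sp] x by (simp add: cmult)
      then show "\<psi> (\<lambda>w. (1 - t) * x w + t * x' w) / \<kappa> = (1 - t) * (\<psi> x / \<kappa>) + t * (\<psi> x' / \<kappa>) \<and>
          (\<forall>w\<in>UNIV. (1 - t) * x w + t * x' w = (1 - t) * x w + t * x' w)"
        by (simp add: add_divide_distrib)
    qed
    show "free_ultrafilter U" by unfold_locales
    have "interchange (\<lambda>w z. z w) UNIV ?X"
      by (rule interchange_flip[OF interchange_ball])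
    then have "interchange (\<lambda>\<nu> z. pairing \<nu> (\<lambda>w. z w)) (l1_ball UNIV) ?X"
      by (rule interchange_l1_ball[of _ _ _ 1]) (auto intro: order_trans[OF abs_le_inorm])
    then show "interchange (\<lambda>z \<nu>. pairing \<nu> (\<lambda>w. z w)) ?X (l1_ball UNIV)"
      by (rule interchange_flip)
    show "\<exists>z\<in>?X. \<psi> z / \<kappa> = - (\<psi> x / \<kappa>) \<and> (\<forall>w\<in>UNIV. z w = - x w)" if "x \<in> ?X" for x
      using that cmult[of x "-1"] by (intro bexI[of _ "\<lambda>w. - x w"]) (auto simp: space_uminus)
    show "\<exists>\<nu>\<in>l1_ball UNIV. \<forall>z\<in>F. \<bar>\<psi> z / \<kappa> - pairing \<nu> z\<bar> \<le> 2 * (\<epsilon> / 3) / \<kappa>"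
      if F: "finite F" "F \<subseteq> ?X" for F
    proof -
      have "\<epsilon> / 3 > 0" using \<open>\<epsilon> > 0\<close> by simp
      from finite_functional_approximation[OF \<psi> \<kappa>(1) this \<kappa>(2) F]
      obtain \<nu> where \<nu>: "\<nu> \<in> l1_ball UNIV" "\<And>z. z \<in> F \<Longrightarrow> \<bar>\<psi> z - \<kappa> * pairing \<nu> z\<bar> \<le> 2 * (\<epsilon> / 3)"
        by blast
      have "\<bar>\<psi> z / \<kappa> - pairing \<nu> z\<bar> \<le> 2 * (\<epsilon> / 3) / \<kappa>" if "z \<in> F" for z
      proof -
        have "\<kappa> > 0" using \<kappa>(1) by simp
        then have eq: "\<psi> z / \<kappa> - pairing \<nu> z = (\<psi> z - \<kappa> * pairing \<nu> z) / \<kappa>"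
          by (simp add: diff_divide_distrib)
        show ?thesis
          unfolding eq abs_divide abs_of_pos[OF \<open>\<kappa> > 0\<close>]
          by (rule divide_right_mono[OF \<nu>(2)[OF that] less_imp_le[OF \<open>\<kappa> > 0\<close>]])
      qed
      with \<nu>(1) show ?thesis by blast
    qed
    show "2 * (\<epsilon> / 3) / \<kappa> < \<epsilon> / \<kappa>"
      using \<open>\<epsilon> > 0\<close> \<kappa>(1) by (intro divide_strict_right_mono) auto
  qed simp
  then obtain \<nu> where \<nu>: "\<And>z. z \<in> ?X \<Longrightarrow> \<bar>\<psi> z / \<kappa> - pairing \<nu> z\<bar> \<le> \<epsilon> / \<kappa>" by blast
  have ball: "\<bar>\<psi> z - pairing (\<kappa> *\<^sub>R \<nu>) z\<bar> \<le> \<epsilon>" if "z \<in> ?X" for z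
  proof -
    have "\<psi> z - pairing (\<kappa> *\<^sub>R \<nu>) z = \<kappa> * (\<psi> z / \<kappa> - pairing \<nu> z)"
      using \<kappa>(1) by (simp add: pairing_scaleR_left right_diff_distrib)
    then have "\<bar>\<psi> z - pairing (\<kappa> *\<^sub>R \<nu>) z\<bar> = \<kappa> * \<bar>\<psi> z / \<kappa> - pairing \<nu> z\<bar>"
      using \<kappa>(1) by (simp add: abs_mult)
    also have "\<dots> \<le> \<kappa> * (\<epsilon> / \<kappa>)"
      using \<nu>[OF that] \<kappa>(1) by (intro mult_left_mono) auto
    finally show ?thesis using \<kappa>(1) by simp
  qed
  have "\<bar>\<psi> z - pairing (\<kappa> *\<^sub>R \<nu>) z\<bar> \<le> \<epsilon> * inorm z" if z: "z \<in> space" for z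
  proof (cases "inorm z = 0")
    case True
    then have z0: "z = (\<lambda>w. 0)"
      using abs_le_inorm[OF z] by (simp add: fun_eq_iff)
    have "\<psi> (\<lambda>w. 0) = 0"
      using cmult[OF zero_in_space, of 0] by simp
    then show ?thesis by (simp add: z0)
  next
    case False
    then have pos: "inorm z > 0" using inorm_nonneg[OF z] by simp
    have "(\<lambda>w. (1 / inorm z) * z w) \<in> ?X"
      using space_cmult[OF z, of "1 / inorm z"] pos by simp
    from ball[OF this] have "\<bar>(1 / inorm z) * (\<psi> z - pairing (\<kappa> *\<^sub>R \<nu>) z)\<bar> \<le> \<epsilon>"
      unfolding cmult[OF z] pairing_mult_right by (simp only: right_diff_distrib)
    then show ?thesis
      using pos by (simp add: abs_mult field_simps)
  qed
  then show ?thesis by blast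
qed

end

section \<open>Reflexivity\<close>

context interpolation
begin

abbreviation Y_dual :: "(('b \<Rightarrow> real) \<Rightarrow> real) normed_structure"
  where "Y_dual \<equiv> dual_space Y"

lemma Y_dual_simps:
  "carrier Y_dual = {\<phi> \<in> extensional space. bounded_functional Y \<phi>}"
  "\<phi> \<oplus>\<^bsub>Y_dual\<^esub> \<psi> = (\<lambda>x\<in>space. \<phi> x + \<psi> x)"
  "c \<odot>\<^bsub>Y_dual\<^esub> \<phi> = (\<lambda>x\<in>space. c * \<phi> x)"
  "nrm Y_dual \<phi> = (SUP x\<in>{x \<in> space. inorm x \<le> 1}. \<bar>\<phi> x\<bar>)"
  by (simp_all add: dual_space_def)

lemma bounded_functional_Y_iff:
  "bounded_functional Y \<phi> \<longleftrightarrow>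
    (\<forall>x\<in>space. \<forall>y\<in>space. \<phi> (\<lambda>w. x w + y w) = \<phi> x + \<phi> y) \<and>
    (\<forall>c. \<forall>x\<in>space. \<phi> (\<lambda>w. c * x w) = c * \<phi> x) \<and> (\<exists>C. \<forall>x\<in>space. \<bar>\<phi> x\<bar> \<le> C * inorm x)"
  by (simp add: bounded_functional_def)

lemma bounded_functional_YI:
  assumes "\<And>x y. x \<in> space \<Longrightarrow> y \<in> space \<Longrightarrow> \<phi> (\<lambda>w. x w + y w) = \<phi> x + \<phi> y"
    and "\<And>c x. x \<in> space \<Longrightarrow> \<phi> (\<lambda>w. c * x w) = c * \<phi> x"
    and "\<And>x. x \<in> space \<Longrightarrow> \<bar>\<phi> x\<bar> \<le> C * inorm x"
  shows "bounded_functional Y \<phi>"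
  using assms unfolding bounded_functional_Y_iff by blast

text \<open>The operations of the dual space return functions restricted to the carrier; this lets
  the restriction be dropped.\<close>

lemma bounded_functional_cong:
  assumes "\<And>x. x \<in> space \<Longrightarrow> \<phi> x = \<psi> x"
  shows "bounded_functional Y \<phi> \<longleftrightarrow> bounded_functional Y \<psi>"
  unfolding bounded_functional_Y_iff using assms by (simp add: space_add space_cmult cong: ball_cong)

lemma dual_norm_le:
  assumes "\<And>x. x \<in> space \<Longrightarrow> \<bar>\<phi> x\<bar> \<le> c * inorm x" "0 \<le> c"
  shows "nrm Y_dual \<phi> \<le> c"
  unfolding Y_dual_simps
proof (rule cSUP_least)
  show "{x \<in> space. inorm x \<le> 1} \<noteq> {}"
    using zero_in_space inorm_zero by (metis (mono_tags, lifting) empty_iff mem_Collect_eq zero_le_one)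
  fix x assume x: "x \<in> {x \<in> space. inorm x \<le> 1}"
  have "\<bar>\<phi> x\<bar> \<le> c * inorm x" using assms x by blast
  also have "\<dots> \<le> c" using x assms(2) by (intro mult_left_le) auto
  finally show "\<bar>\<phi> x\<bar> \<le> c" .
qed

lemma bdd_above_dual:
  assumes "bounded_functional Y \<phi>"
  shows "bdd_above ((\<lambda>x. \<bar>\<phi> x\<bar>) ` {x \<in> space. inorm x \<le> 1})"
proof -
  obtain C where C: "\<And>x. x \<in> space \<Longrightarrow> \<bar>\<phi> x\<bar> \<le> C * inorm x"
    using assms unfolding bounded_functional_Y_iff by blast
  have "\<bar>\<phi> z\<bar> \<le> \<bar>C\<bar>" if "z \<in> space" "inorm z \<le> 1" for z
  proof -
    have "\<bar>\<phi> z\<bar> \<le> \<bar>C\<bar> * inorm z"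
      using C[OF that(1)] inorm_nonneg[OF that(1)] by (meson abs_ge_self mult_right_mono order_trans)
    also have "\<dots> \<le> \<bar>C\<bar>" using that by (intro mult_left_le) auto
    finally show ?thesis .
  qed
  then show ?thesis
    by (intro bdd_aboveI[of _ "\<bar>C\<bar>"]) auto
qed

lemma abs_le_dual_norm:
  assumes \<phi>: "bounded_functional Y \<phi>" and x: "x \<in> space"
  shows "\<bar>\<phi> x\<bar> \<le> nrm Y_dual \<phi> * inorm x"
proof -
  obtain C where C: "\<And>x. x \<in> space \<Longrightarrow> \<bar>\<phi> x\<bar> \<le> C * inorm x"
    and cmult: "\<And>x c. x \<in> space \<Longrightarrow> \<phi> (\<lambda>w. c * x w) = c * \<phi> x"
    using \<phi> unfolding bounded_functional_Y_iff by blast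
  show ?thesis
  proof (cases "inorm x = 0")
    case True
    then show ?thesis using C[OF x] by simp
  next
    case False
    then have pos: "inorm x > 0" using inorm_nonneg[OF x] by simp
    have "(\<lambda>w. (1 / inorm x) * x w) \<in> {x \<in> space. inorm x \<le> 1}"
      using space_cmult[OF x, of "1 / inorm x"] pos by simp
    then have "\<bar>\<phi> (\<lambda>w. (1 / inorm x) * x w)\<bar> \<le> nrm Y_dual \<phi>"
      unfolding Y_dual_simps by (rule cSUP_upper) (rule bdd_above_dual[OF \<phi>])
    then show ?thesis
      unfolding cmult[OF x] using pos by (simp add: abs_mult field_simps)
  qed
qed

lemma dual_norm_nonneg:
  assumes "bounded_functional Y \<phi>"
  shows "0 \<le> nrm Y_dual \<phi>"
proof -
  have "\<bar>\<phi> (\<lambda>w. 0)\<bar> \<le> nrm Y_dual \<phi>"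
    unfolding Y_dual_simps using bdd_above_dual[OF assms] by (rule cSUP_upper[rotated]) simp
  then show ?thesis by linarith
qed

lemma dual_add:
  assumes "\<phi> \<in> carrier Y_dual" "\<psi> \<in> carrier Y_dual"
  shows "\<phi> \<oplus>\<^bsub>Y_dual\<^esub> \<psi> \<in> carrier Y_dual"
proof -
  obtain C D where "\<And>x. x \<in> space \<Longrightarrow> \<bar>\<phi> x\<bar> \<le> C * inorm x" "\<And>x. x \<in> space \<Longrightarrow> \<bar>\<psi> x\<bar> \<le> D * inorm x"
    using assms unfolding Y_dual_simps bounded_functional_Y_iff by blast
  then have "\<bar>\<phi> x + \<psi> x\<bar> \<le> (C + D) * inorm x" if "x \<in> space" for x
    using that abs_triangle_ineq[of "\<phi> x" "\<psi> x"] by (fastforce simp: distrib_right)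
  then have "bounded_functional Y (\<lambda>x. \<phi> x + \<psi> x)"
    by (rule bounded_functional_YI[rotated 2])
      (use assms in \<open>simp_all add: Y_dual_simps(1) bounded_functional_Y_iff distrib_left\<close>)
  then show ?thesis
    unfolding Y_dual_simps by (simp add: bounded_functional_cong[of "restrict _ _" "\<lambda>x. \<phi> x + \<psi> x"])
qed

lemma dual_smult:
  assumes "\<phi> \<in> carrier Y_dual"
  shows "c \<odot>\<^bsub>Y_dual\<^esub> \<phi> \<in> carrier Y_dual"
proof -
  obtain C where C: "\<And>x. x \<in> space \<Longrightarrow> \<bar>\<phi> x\<bar> \<le> C * inorm x"
    using assms unfolding Y_dual_simps bounded_functional_Y_iff by blast
  have "\<bar>c * \<phi> x\<bar> \<le> (\<bar>c\<bar> * C) * inorm x" if "x \<in> space" for x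
    using mult_left_mono[OF C[OF that], of "\<bar>c\<bar>"] by (simp add: abs_mult mult.assoc)
  then have "bounded_functional Y (\<lambda>x. c * \<phi> x)"
    by (rule bounded_functional_YI[rotated 2])
      (use assms in \<open>simp_all add: Y_dual_simps(1) bounded_functional_Y_iff distrib_left\<close>)
  then show ?thesis
    unfolding Y_dual_simps by (simp add: bounded_functional_cong[of "restrict _ _" "\<lambda>x. c * \<phi> x"])
qed

definition pairing_functional :: "('b \<Rightarrow>\<^sub>0 real) \<Rightarrow> ('b \<Rightarrow> real) \<Rightarrow> real"
  where "pairing_functional \<nu> = (\<lambda>x\<in>space. pairing \<nu> x)"

lemma pairing_functional_in_dual: "pairing_functional \<nu> \<in> carrier Y_dual"
  unfolding Y_dual_simps pairing_functional_def
  using bounded_functional_pairing[of \<nu>]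
  by (simp add: bounded_functional_cong[of "restrict _ _" "\<lambda>x. pairing \<nu> x"])

lemma canonical_embedding_in_bidual:
  assumes x: "x \<in> space"
  shows "canonical_embedding Y x \<in> carrier (dual_space Y_dual)"
proof -
  have "\<bar>\<phi> x\<bar> \<le> inorm x * nrm Y_dual \<phi>" if "\<phi> \<in> carrier Y_dual" for \<phi>
    using abs_le_dual_norm[OF _ x, of \<phi>] that by (simp add: Y_dual_simps(1) mult.commute)
  then have "bounded_functional Y_dual (canonical_embedding Y x)"
    unfolding bounded_functional_def canonical_embedding_def
    using dual_add dual_smult x by (auto simp: Y_dual_simps(2,3))
  then show ?thesis
    by (simp add: dual_space_def[of Y_dual] canonical_embedding_def)
qed

end

context reflexive_interpolation
begin

lemma bidual_is_evaluation:
  assumes \<Phi>: "\<Phi> \<in> carrier (dual_space Y_dual)"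
  shows "\<exists>y\<in>space. \<Phi> = canonical_embedding Y y"
proof -
  have ext: "\<Phi> \<in> extensional (carrier Y_dual)" and bf: "bounded_functional Y_dual \<Phi>"
    using \<Phi> by (auto simp: dual_space_def[of Y_dual])
  have add: "\<Phi> (\<phi> \<oplus>\<^bsub>Y_dual\<^esub> \<psi>) = \<Phi> \<phi> + \<Phi> \<psi>" if "\<phi> \<in> carrier Y_dual" "\<psi> \<in> carrier Y_dual" for \<phi> \<psi>
    using bf that unfolding bounded_functional_def by blast
  have smult: "\<Phi> (c \<odot>\<^bsub>Y_dual\<^esub> \<phi>) = c * \<Phi> \<phi>" if "\<phi> \<in> carrier Y_dual" for c \<phi>
    using bf that unfolding bounded_functional_def by blast
  obtain C where C: "\<And>\<phi>. \<phi> \<in> carrier Y_dual \<Longrightarrow> \<bar>\<Phi> \<phi>\<bar> \<le> C * nrm Y_dual \<phi>"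
    using bf unfolding bounded_functional_def by blast
  define R where "R = \<bar>C\<bar>"
  have "R \<ge> 0" by (simp add: R_def)
  have R: "\<bar>\<Phi> \<phi>\<bar> \<le> R * c"
    if \<phi>: "\<phi> \<in> carrier Y_dual" and c: "\<And>x. x \<in> space \<Longrightarrow> \<bar>\<phi> x\<bar> \<le> c * inorm x" "0 \<le> c" for \<phi> c
  proof -
    have "C * nrm Y_dual \<phi> \<le> R * nrm Y_dual \<phi>"
      using dual_norm_nonneg[of \<phi>] \<phi> by (intro mult_right_mono) (auto simp: R_def Y_dual_simps(1))
    also have "\<dots> \<le> R * c"
      using dual_norm_le[OF c] \<open>R \<ge> 0\<close> by (rule mult_left_mono)
    finally show ?thesis using C[OF \<phi>] by linarith
  qed
  define E where "E = pairing_functional"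
  have E: "E \<nu> \<in> carrier Y_dual" for \<nu>
    unfolding E_def by (rule pairing_functional_in_dual)
  have E_app: "E \<nu> x = pairing \<nu> x" if "x \<in> space" for \<nu> x
    using that by (simp add: E_def pairing_functional_def)
  have E_add: "E (\<mu> + \<nu>) = E \<mu> \<oplus>\<^bsub>Y_dual\<^esub> E \<nu>" for \<mu> \<nu>
    unfolding Y_dual_simps E_def pairing_functional_def by (rule restrict_ext) (simp add: pairing_add_left)
  have E_scale: "E (r *\<^sub>R \<nu>) = r \<odot>\<^bsub>Y_dual\<^esub> E \<nu>" for r \<nu>
    unfolding Y_dual_simps E_def pairing_functional_def by (rule restrict_ext) (simp add: pairing_scaleR_left)
  define y where "y w = \<Phi> (E (Poly_Mapping.single w 1))" for w
  have single: "\<Phi> (E (Poly_Mapping.single w c)) = c * y w" for w c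
  proof -
    have "Poly_Mapping.single w c = c *\<^sub>R Poly_Mapping.single w 1"
      by (rule poly_mapping_eqI) (simp add: lookup_single when_def)
    then show ?thesis
      by (simp add: E_scale smult[OF E] y_def)
  qed
  have zero: "\<Phi> (E 0) = 0"
    using E_scale[of 0 0] smult[OF E, of 0 0] by simp
  have "\<Phi> (E (combination G c)) = (\<Sum>w\<in>G. c w * y w)" if "finite G" for G c
    using that unfolding combination_def
    by (induction G rule: finite_induct) (simp_all add: zero E_add add[OF E E] single)
  from this[of "Poly_Mapping.keys \<nu>" "coeff \<nu>" for \<nu>] have \<Phi>E: "\<Phi> (E \<nu>) = pairing \<nu> y" for \<nu>
    by (simp add: combination_keys pairing_def)
  have "\<bar>y w\<bar> \<le> R" for w
    using R[OF E, of "Poly_Mapping.single w 1" 1] abs_le_inorm by (simp add: y_def E_app)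
  then have y_bdd: "bounded (range y)"
    by (auto simp: bounded_iff)
  have "pairing \<nu> y \<le> R * Q" if "0 \<le> Q" and Q: "\<And>z. z \<in> space \<Longrightarrow> pairing \<nu> z \<le> Q * inorm z" for \<nu> Q
  proof -
    have "\<bar>E \<nu> z\<bar> \<le> Q * inorm z" if z: "z \<in> space" for z
      using Q[OF z] Q[OF space_uminus(1)[OF z]] pairing_mult_right[of \<nu> "-1" z]
      by (simp add: E_app[OF z] space_uminus(2)[OF z] abs_le_iff)
    then have "\<bar>\<Phi> (E \<nu>)\<bar> \<le> R * Q"
      using \<open>0 \<le> Q\<close> by (intro R[OF E]) auto
    then show ?thesis by (simp add: \<Phi>E)
  qed
  then have y: "y \<in> space"
    using inorm_le_of_dual(1)[OF y_bdd _ \<open>R \<ge> 0\<close>] by blast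
  have "\<Phi> \<psi> = \<psi> y" if \<psi>: "\<psi> \<in> carrier Y_dual" for \<psi>
  proof -
    have "\<bar>\<Phi> \<psi> - \<psi> y\<bar> \<le> 0 + \<epsilon>" if "\<epsilon> > 0" for \<epsilon>
    proof -
      \<comment> \<open>\<open>\<Phi>\<close> and evaluation at \<open>y\<close> agree on the
        finitely supported functionals and have norms at most \<open>R\<close> and
        \<open>inorm y\<close>, so within distance \<open>\<delta>\<close> of such a functional they
        differ by at most \<open>\<delta> * (R + inorm y)\<close>. The 1 avoids division by
        zero.\<close>
      define \<delta> where "\<delta> = \<epsilon> / (R + inorm y + 1)"
      have pos: "R + inorm y + 1 > 0"
        using \<open>R \<ge> 0\<close> inorm_nonneg[OF y] by linarith
      then have "\<delta> > 0" using that by (simp add: \<delta>_def)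
      have "bounded_functional Y \<psi>" using \<psi> by (simp add: Y_dual_simps(1))
      then obtain \<nu> where \<nu>: "\<And>z. z \<in> space \<Longrightarrow> \<bar>\<psi> z - pairing \<nu> z\<bar> \<le> \<delta> * inorm z"
        using finitely_supported_dense \<open>\<delta> > 0\<close> by blast
      define \<xi> where "\<xi> = \<psi> \<oplus>\<^bsub>Y_dual\<^esub> ((-1) \<odot>\<^bsub>Y_dual\<^esub> E \<nu>)"
      have "\<xi> z = \<psi> z - pairing \<nu> z" if "z \<in> space" for z
        using that by (simp add: \<xi>_def Y_dual_simps(2,3) E_app)
      moreover have "\<xi> \<in> carrier Y_dual"
        unfolding \<xi>_def by (intro dual_add dual_smult \<psi> E)
      ultimately have "\<bar>\<Phi> \<xi>\<bar> \<le> R * \<delta>"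
        using \<nu> \<open>\<delta> > 0\<close> by (intro R) auto
      moreover have "\<Phi> \<xi> = \<Phi> \<psi> - pairing \<nu> y"
        unfolding \<xi>_def by (simp add: add[OF \<psi> dual_smult[OF E]] smult[OF E] \<Phi>E)
      ultimately have "\<bar>\<Phi> \<psi> - \<psi> y\<bar> \<le> R * \<delta> + \<delta> * inorm y"
        using \<nu>[OF y] by linarith
      also have "\<dots> \<le> \<delta> * (R + inorm y + 1)"
        using \<open>\<delta> > 0\<close> by (simp add: algebra_simps)
      also have "\<dots> = \<epsilon>" using pos by (simp add: \<delta>_def)
      finally show ?thesis by simp
    qed
    then have "\<bar>\<Phi> \<psi> - \<psi> y\<bar> \<le> 0" by (rule field_le_epsilon)
    then show ?thesis by simp
  qed
  then have "\<Phi> = canonical_embedding Y y"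
    unfolding canonical_embedding_def using ext by (intro extensionalityI[of _ "carrier Y_dual"]) auto
  with y show ?thesis by blast
qed

lemma reflexive_Y: "reflexive Y"
  unfolding reflexive_def
proof (intro equalityI subsetI)
  fix \<Phi> assume "\<Phi> \<in> carrier (dual_space Y_dual)"
  then show "\<Phi> \<in> canonical_embedding Y ` carrier Y"
    using bidual_is_evaluation[of \<Phi>] by auto
qed (auto intro: canonical_embedding_in_bidual)

end

section \<open>Stable metric spaces\<close>

context free_ultrafilter
begin

lemma iterated_ulim_cong:
  assumes P: "eventually P U" and Q: "eventually Q U"
    and eq: "\<And>m n. P m \<Longrightarrow> Q n \<Longrightarrow> f m n = g m n"
  shows "ulim (\<lambda>m. ulim (\<lambda>n. f m n)) = ulim (\<lambda>m. ulim (\<lambda>n. g m n))"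
proof (rule ulim_cong)
  show "eventually (\<lambda>m. ulim (\<lambda>n. f m n) = ulim (\<lambda>n. g m n)) U"
    using P
  proof eventually_elim
    case (elim m)
    show ?case
      by (rule ulim_cong) (use Q in \<open>eventually_elim, simp add: eq elim\<close>)
  qed
qed

text \<open>If \<open>s\<close> tends to infinity along \<open>U\<close>, every inner limit
  vanishes. Otherwise, \<open>U\<close> being an ultrafilter, \<open>s\<close> is bounded on a
  member of \<open>U\<close>, so \<open>r\<close> tends to infinity and the kernel vanishes on a
  rectangle of members of \<open>U\<close>.\<close>

lemma iterated_ulim_zero:
  fixes r s :: "nat \<Rightarrow> real"
  assumes zero: "\<And>m n. T < \<bar>r m - s n\<bar> \<Longrightarrow> f m n = 0"
    and unbounded: "(\<forall>R. eventually (\<lambda>m. R < r m) U) \<or> (\<forall>R. eventually (\<lambda>n. R < s n) U)"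
  shows "ulim (\<lambda>m. ulim (\<lambda>n. f m n)) = 0"
proof (cases "\<forall>R. eventually (\<lambda>n. R < s n) U")
  case True
  have "ulim (\<lambda>n. f m n) = 0" for m
  proof -
    have "eventually (\<lambda>n. r m + T < s n) U" using True by blast
    then have "eventually (\<lambda>n. f m n = 0) U"
      by eventually_elim (rule zero, linarith)
    then have "ulim (\<lambda>n. f m n) = ulim (\<lambda>n. 0)" by (rule ulim_cong)
    then show ?thesis by simp
  qed
  then show ?thesis by simp
next
  case False
  then obtain R where R: "eventually (\<lambda>n. \<not> R < s n) U"
    by (auto simp: not_eventually_U)
  have "eventually (\<lambda>m. R + T < r m) U" using False unbounded by blast
  then have "ulim (\<lambda>m. ulim (\<lambda>n. f m n)) = ulim (\<lambda>m. ulim (\<lambda>n. 0))"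
    using R by (rule iterated_ulim_cong) (rule zero, linarith)
  then show ?thesis by simp
qed

text \<open>Smallness uniform in \<open>n\<close> controls the inner limits in one order, and makes
  each inner limit vanish in the other.\<close>

lemma iterated_ulim_small:
  assumes small: "\<And>\<epsilon>. \<epsilon> > 0 \<Longrightarrow> eventually (\<lambda>m. \<forall>n. \<bar>f m n\<bar> \<le> \<epsilon>) U"
  shows "ulim (\<lambda>m. ulim (\<lambda>n. f m n)) = 0" "ulim (\<lambda>n. ulim (\<lambda>m. f m n)) = 0"
proof -
  have "((\<lambda>m. ulim (\<lambda>n. f m n)) \<longlongrightarrow> 0) U"
  proof (rule tendstoI)
    fix e :: real assume "e > 0"
    then show "eventually (\<lambda>m. dist (ulim (\<lambda>n. f m n)) 0 < e) U"
      using small[of "e / 2"]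
    proof (rule_tac eventually_mono)
      fix m assume "\<forall>n. \<bar>f m n\<bar> \<le> e / 2"
      then have "\<bar>ulim (\<lambda>n. f m n)\<bar> \<le> e / 2" by (intro abs_ulim_le) auto
      then show "dist (ulim (\<lambda>n. f m n)) 0 < e" using \<open>e > 0\<close> by (simp add: dist_real_def)
    qed auto
  qed
  then show "ulim (\<lambda>m. ulim (\<lambda>n. f m n)) = 0" by (rule ulim_eqI)
  have "ulim (\<lambda>m. f m n) = 0" for n
  proof (rule ulim_eqI, rule tendstoI)
    fix e :: real assume "e > 0"
    then show "eventually (\<lambda>m. dist (f m n) 0 < e) U"
      using small[of "e / 2"] by (auto elim!: eventually_mono simp: dist_real_def intro: le_less_trans[of _ "e / 2"])
  qed
  then show "ulim (\<lambda>n. ulim (\<lambda>m. f m n)) = 0" by simp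
qed

lemma stable_interchange:
  fixes x y :: "nat \<Rightarrow> 'a :: metric_space"
  assumes "stable TYPE('a)" "bounded (range x)" "bounded (range y)"
  shows "ulim (\<lambda>m. ulim (\<lambda>n. dist (x m) (y n))) = ulim (\<lambda>n. ulim (\<lambda>m. dist (x m) (y n)))"
  using assms nonprincipal unfolding stable_def ulim_def by blast

text \<open>If one of the sequences escapes along \<open>U\<close>, the tents, whose radius is at
  most \<open>T\<close>, vanish in the limit. Otherwise stability applies: the tent is a continuous
  function of the distance and of \<open>t n\<close>, and the latter depends on one index
  only.\<close>

lemma bump_interchange:
  fixes x q :: "nat \<Rightarrow> 'a :: metric_space" and t :: "nat \<Rightarrow> real"
  assumes st: "stable TYPE('a)" and t: "\<And>n. 0 \<le> t n" "\<And>n. t n \<le> T"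
  shows "ulim (\<lambda>m. ulim (\<lambda>n. max (t n - dist (q n) (x m)) 0)) =
    ulim (\<lambda>n. ulim (\<lambda>m. max (t n - dist (q n) (x m)) 0))"
proof -
  define b where "b = x 0"
  define r where "r m = dist b (x m)" for m
  define s where "s n = dist b (q n)" for n
  let ?f = "\<lambda>m n. max (t n - dist (q n) (x m)) 0"
  have zero: "?f m n = 0" if "T < \<bar>r m - s n\<bar>" for m n
  proof -
    have "\<bar>r m - s n\<bar> \<le> dist (q n) (x m)"
      unfolding r_def s_def using dist_triangle[of b "x m" "q n"] dist_triangle[of b "q n" "x m"]
      by (simp add: dist_commute abs_le_iff)
    then show ?thesis using that t(2)[of n] by simp
  qed
  have zero': "?f m n = 0" if "T < \<bar>s n - r m\<bar>" for m n
    using zero[of m n] that by (simp add: abs_minus_commute)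
  show ?thesis
  proof (cases "(\<forall>R. eventually (\<lambda>m. R < r m) U) \<or> (\<forall>R. eventually (\<lambda>n. R < s n) U)")
    case True
    then have "(\<forall>R. eventually (\<lambda>n. R < s n) U) \<or> (\<forall>R. eventually (\<lambda>m. R < r m) U)" by blast
    with True show ?thesis
      using iterated_ulim_zero[of T r s ?f] iterated_ulim_zero[of T s r "\<lambda>n m. ?f m n"] zero zero' by simp
  next
    case False
    then obtain R R' where R: "eventually (\<lambda>m. r m \<le> R) U" and R': "eventually (\<lambda>n. s n \<le> R') U"
      by (auto simp: not_eventually_U not_less)
    \<comment> \<open>Boundedness on a member of \<open>U\<close> is turned into boundedness of the
      whole sequence, as stability demands, without affecting the limits.\<close>
    define x' where "x' m = (if r m \<le> R then x m else b)" for m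
    define q' where "q' n = (if s n \<le> R' then q n else b)" for n
    let ?g = "\<lambda>m n. max (t n - dist (q' n) (x' m)) 0"
    have x'b: "dist b (x' m) \<le> \<bar>R\<bar>" and q'b: "dist b (q' n) \<le> \<bar>R'\<bar>" for m n
      by (auto simp: x'_def q'_def r_def s_def)
    then have bdd: "bounded (range x')" "bounded (range q')"
      by (auto simp: bounded_def)
    have D: "\<bar>dist (q' n) (x' m)\<bar> \<le> \<bar>R'\<bar> + \<bar>R\<bar>" for m n
      using dist_triangle[of "q' n" "x' m" b] x'b[of m] q'b[of n] by (simp add: dist_commute)
    have t_lim: "(t \<longlongrightarrow> ulim t) U"
      by (rule tendsto_ulim'[of _ T]) (use t in simp)
    have D_lim: "((\<lambda>n. dist (q' n) (x' m)) \<longlongrightarrow> ulim (\<lambda>n. dist (q' n) (x' m))) U"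
      "((\<lambda>m. dist (q' n) (x' m)) \<longlongrightarrow> ulim (\<lambda>m. dist (q' n) (x' m))) U"
      "((\<lambda>m. ulim (\<lambda>n. dist (q' n) (x' m))) \<longlongrightarrow> ulim (\<lambda>m. ulim (\<lambda>n. dist (q' n) (x' m)))) U"
      "((\<lambda>n. ulim (\<lambda>m. dist (q' n) (x' m))) \<longlongrightarrow> ulim (\<lambda>n. ulim (\<lambda>m. dist (q' n) (x' m)))) U" for m n
      by (intro tendsto_ulim'[of _ "\<bar>R'\<bar> + \<bar>R\<bar>"] abs_ulim_le D)+
    have "ulim (\<lambda>n. ?g m n) = max (ulim t - ulim (\<lambda>n. dist (q' n) (x' m))) 0" for m
      by (rule ulim_eqI) (intro tendsto_max tendsto_diff t_lim D_lim tendsto_const)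
    then have 1: "ulim (\<lambda>m. ulim (\<lambda>n. ?g m n)) = max (ulim t - ulim (\<lambda>m. ulim (\<lambda>n. dist (q' n) (x' m)))) 0"
      by (simp only:) (rule ulim_eqI, intro tendsto_max tendsto_diff t_lim D_lim tendsto_const)
    have "ulim (\<lambda>m. ?g m n) = max (t n - ulim (\<lambda>m. dist (q' n) (x' m))) 0" for n
      by (rule ulim_eqI) (intro tendsto_max tendsto_diff t_lim D_lim tendsto_const)
    then have 2: "ulim (\<lambda>n. ulim (\<lambda>m. ?g m n)) = max (ulim t - ulim (\<lambda>n. ulim (\<lambda>m. dist (q' n) (x' m)))) 0"
      by (simp only:) (rule ulim_eqI, intro tendsto_max tendsto_diff t_lim D_lim tendsto_const)
    have "ulim (\<lambda>m. ulim (\<lambda>n. ?f m n)) = ulim (\<lambda>m. ulim (\<lambda>n. ?g m n))"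
      using R R' by (rule iterated_ulim_cong) (simp add: x'_def q'_def)
    also have "\<dots> = ulim (\<lambda>n. ulim (\<lambda>m. ?g m n))"
      unfolding 1 2 using stable_interchange[OF st bdd(2,1)] by simp
    also have "\<dots> = ulim (\<lambda>n. ulim (\<lambda>m. ?f m n))"
      using R' R by (rule iterated_ulim_cong) (simp add: x'_def q'_def)
    finally show ?thesis .
  qed
qed

end

text \<open>The values 1, 2, and 3 for coinciding points, make the order of the pair recoverable.
  Coordinates indexed by such codes have the vector type prescribed by the theorem.\<close>

definition pair_code :: "'a \<times> 'a \<Rightarrow> 'a \<Rightarrow> real"
  where "pair_code = (\<lambda>(p, q) x. (if x = p then 1 else 0) + (if x = q then 2 else 0))"

lemma inj_pair_code: "inj pair_code"
proof (rule injI, clarify)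
  fix p q p' q' :: 'a
  assume "pair_code (p, q) = pair_code (p', q')"
  then have eq: "(if x = p then 1 else 0) + (if x = q then 2 else 0) =
      ((if x = p' then 1 else 0) + (if x = q' then 2 else 0) :: real)" for x
    by (simp add: pair_code_def fun_eq_iff)
  show "p = p' \<and> q = q'"
    using eq[of p] eq[of q] by (auto split: if_splits)
qed

text \<open>Functions that code no pair also receive some pair; this is harmless, as the estimates
  for coordinates hold for all pairs.\<close>

definition pair_of :: "('a \<Rightarrow> real) \<Rightarrow> 'a \<times> 'a"
  where "pair_of = inv_into UNIV pair_code"

lemma pair_of_code [simp]: "pair_of (pair_code pq) = pq"
  by (simp add: pair_of_def inj_pair_code)

section \<open>The coordinates, their normalised differences, and the double limit condition\<close>

locale moduli =
  fixes \<rho> \<omega> :: "real \<Rightarrow> real"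
  assumes \<rho>: "\<rho> \<in> class_P" and \<omega>: "\<omega> \<in> class_Omega"
begin

lemma \<rho>_nonneg: "0 \<le> t \<Longrightarrow> 0 \<le> \<rho> t"
  using \<rho> by (simp add: class_P_def)

lemma \<rho>_le: "0 \<le> t \<Longrightarrow> \<rho> t \<le> t"
  using \<rho> by (cases "t \<le> 1") (auto simp: class_P_def)

lemma \<rho>_zero: "\<rho> 0 = 0"
  using \<rho>_le[of 0] \<rho>_nonneg[of 0] by simp

text \<open>At \<open>t = 0\<close> the quotient is 0 by the convention for division, so degenerate
  pairs need no separate treatment; likewise for \<open>\<omega>_ratio\<close>.\<close>

lemma \<rho>_ratio: "0 \<le> t \<Longrightarrow> 0 \<le> \<rho> t / t" "0 \<le> t \<Longrightarrow> \<rho> t / t \<le> 1"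
  using \<rho>_nonneg[of t] \<rho>_le[of t] by (auto simp: divide_le_eq_1)

lemma \<omega>_ge: "0 \<le> t \<Longrightarrow> t \<le> \<omega> t"
  using \<omega> by (cases "t \<le> 1") (auto simp: class_Omega_def)

lemma \<omega>_zero: "\<omega> 0 = 0"
  using \<omega> by (simp add: class_Omega_def)

lemma \<omega>_ratio: "0 \<le> t \<Longrightarrow> 0 \<le> t / \<omega> t" "0 \<le> t \<Longrightarrow> t / \<omega> t \<le> 1"
  using \<omega>_ge[of t] by (auto simp: divide_le_eq_1)

lemma \<omega>_ratio_small:
  assumes "\<epsilon> > 0"
  shows "\<exists>b>0. \<forall>t. 0 \<le> t \<longrightarrow> t < b \<longrightarrow> t / \<omega> t \<le> \<epsilon>"
proof -
  have "filterlim (\<lambda>t. \<omega> t / t) at_top (at_right 0)"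
    using \<omega> by (simp add: class_Omega_def)
  then have "eventually (\<lambda>t. 1 / \<epsilon> \<le> \<omega> t / t) (at_right 0)"
    by (simp add: filterlim_at_top)
  then obtain b where b: "b > 0" "\<And>t. 0 < t \<Longrightarrow> t < b \<Longrightarrow> 1 / \<epsilon> \<le> \<omega> t / t"
    unfolding eventually_at_right_field by auto
  have "t / \<omega> t \<le> \<epsilon>" if "0 \<le> t" "t < b" for t
  proof (cases "t = 0")
    case False
    then have "t > 0" using that by simp
    then have "\<omega> t > 0" using \<omega>_ge[of t] by linarith
    then show ?thesis
      using b(2)[OF \<open>t > 0\<close> that(2)] \<open>t > 0\<close> assms by (simp add: field_simps)
  qed (use assms in simp)
  with b(1) show ?thesis by blast
qed

lemma \<rho>_ratio_small:
  assumes "\<epsilon> > 0"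
  shows "\<exists>b. \<forall>t>b. \<rho> t / t \<le> \<epsilon>"
proof -
  have "((\<lambda>t. \<rho> t / t) \<longlongrightarrow> 0) at_top"
    using \<rho> by (simp add: class_P_def)
  then have "eventually (\<lambda>t. \<rho> t / t < \<epsilon>) at_top"
    using assms by (rule order_tendstoD(2))
  then show ?thesis
    by (auto simp: eventually_at_top_dense intro: less_imp_le)
qed

definition bump :: "'a::metric_space \<Rightarrow> 'a \<Rightarrow> 'a \<Rightarrow> real"
  where "bump p q x = max (dist p q - dist q x) 0"

text \<open>The coordinates are indexed by all functions \<open>w\<close>, of which only the pair of points coded by
  \<open>w\<close> matters; this makes the resulting vectors elements of \<open>('a \<Rightarrow> real) \<Rightarrow> real\<close>.\<close>

definition coord :: "'a::metric_space \<Rightarrow> ('a \<Rightarrow> real) \<Rightarrow> real"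
  where "coord x w = (case pair_of w of (p, q) \<Rightarrow> \<rho> (dist p q) / dist p q * bump p q x)"

text \<open>For \<open>x = y\<close> the numerator is 0 and so is the quotient, hence the zero
  vector may belong to the generating set.\<close>

definition atom :: "'a::metric_space \<Rightarrow> 'a \<Rightarrow> ('a \<Rightarrow> real) \<Rightarrow> real"
  where "atom x y w = (coord x w - coord y w) / \<omega> (dist x y)"

lemma bump_bounds: "\<bar>bump p q x - bump p q y\<bar> \<le> dist x y"
  unfolding bump_def using dist_triangle[of q x y] dist_triangle[of q y x]
  by (auto simp: max_def dist_commute)

text \<open>An atom is bounded by the product of \<open>\<rho>(t)/t\<close> at the distance of
  \<open>p\<close> and \<open>q\<close> and \<open>t/\<omega>(t)\<close> at the distance of
  \<open>x\<close> and \<open>y\<close>, both at most 1. Dropping either factor gives a bound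
  uniform in \<open>w\<close>, or one uniform in \<open>x\<close> and \<open>y\<close>; they settle
  the two degenerate cases of the double limit.\<close>

lemma abs_atom_le:
  "\<bar>atom x y w\<bar> \<le> dist x y / \<omega> (dist x y)"
  "pair_of w = (p, q) \<Longrightarrow> \<bar>atom x y w\<bar> \<le> \<rho> (dist p q) / dist p q"
proof -
  obtain p' q' where pq: "pair_of w = (p', q')" by fastforce
  define c where "c = \<rho> (dist p' q') / dist p' q'"
  have c: "0 \<le> c" "c \<le> 1" using \<rho>_ratio[of "dist p' q'"] by (auto simp: c_def)
  have \<omega>: "0 \<le> \<omega> (dist x y)" using \<omega>_ge[of "dist x y"] zero_le_dist[of x y] by linarith
  have "coord x w - coord y w = c * (bump p' q' x - bump p' q' y)"
    by (simp only: coord_def pq c_def prod.case right_diff_distrib)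
  then have "\<bar>atom x y w\<bar> = c * (\<bar>bump p' q' x - bump p' q' y\<bar> / \<omega> (dist x y))"
    using c \<omega> by (simp add: atom_def abs_mult)
  also have "\<dots> \<le> c * (dist x y / \<omega> (dist x y))"
    using c \<omega> bump_bounds by (intro mult_left_mono divide_right_mono) auto
  finally have *: "\<bar>atom x y w\<bar> \<le> c * (dist x y / \<omega> (dist x y))" .
  also have "\<dots> \<le> 1 * (dist x y / \<omega> (dist x y))"
    using c \<omega>_ratio(1)[OF zero_le_dist] by (intro mult_right_mono) auto
  finally show "\<bar>atom x y w\<bar> \<le> dist x y / \<omega> (dist x y)" by simp
  have "c * (dist x y / \<omega> (dist x y)) \<le> c"
    using c \<omega>_ratio[OF zero_le_dist] by (intro mult_left_le) auto
  with * show "\<bar>atom x y w\<bar> \<le> \<rho> (dist p q) / dist p q" if "pair_of w = (p, q)"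
    using that by (simp add: pq c_def)
qed

lemma abs_atom_le_1: "\<bar>atom x y w\<bar> \<le> 1"
  using abs_atom_le(1)[of x y w] \<omega>_ratio(2)[OF zero_le_dist, of x y] by linarith

lemma atom_smult: "coord x w - coord y w = \<omega> (dist x y) * atom x y w"
proof (cases "x = y")
  case False
  then have "\<omega> (dist x y) > 0"
    using \<omega>_ge[of "dist x y"] zero_less_dist_iff[of x y] by linarith
  then show ?thesis by (simp add: atom_def)
qed (simp add: \<omega>_zero)

text \<open>The tent with \<open>p = x\<close> and \<open>q = y\<close> vanishes at \<open>x\<close>
  and has height \<open>dist x y\<close> at \<open>y\<close>, so its factor
  \<open>\<rho>(t)/t\<close> leaves exactly \<open>\<rho>(t)\<close>.\<close>

lemma coord_separates: "\<bar>coord x (pair_code (x, y)) - coord y (pair_code (x, y))\<bar> = \<rho> (dist x y)"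
  using \<rho>_nonneg[of "dist x y"] by (cases "x = y") (auto simp: coord_def bump_def dist_commute \<rho>_zero abs_mult)

text \<open>Along \<open>U\<close>, either the distances \<open>\<delta> m\<close> tend to 0, or the
  \<open>t n\<close> tend to infinity, or \<open>\<delta> m \<ge> \<sigma> > 0\<close> and
  \<open>t n \<le> T\<close> on members of \<open>U\<close>. In the first two cases the atoms become
  uniformly small. In the third they are a bounded factor in \<open>m\<close>, times a bounded
  factor in \<open>n\<close>, times a difference of two tents of bounded height, and stability
  applies.\<close>

lemma atom_interchange:
  fixes x y :: "nat \<Rightarrow> 'a :: metric_space"
  assumes U: "free_ultrafilter U" and st: "stable TYPE('a)"
  shows "free_ultrafilter.ulim U (\<lambda>m. free_ultrafilter.ulim U (\<lambda>n. atom (x m) (y m) (w n))) =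
    free_ultrafilter.ulim U (\<lambda>n. free_ultrafilter.ulim U (\<lambda>m. atom (x m) (y m) (w n)))"
proof -
  interpret free_ultrafilter U by (rule U)
  define p q where "p n = fst (pair_of (w n))" and "q n = snd (pair_of (w n))" for n
  have pq: "pair_of (w n) = (p n, q n)" for n by (simp add: p_def q_def)
  define t where "t n = dist (p n) (q n)" for n
  define c where "c n = \<rho> (t n) / t n" for n
  define \<delta> where "\<delta> m = dist (x m) (y m)" for m
  let ?K = "\<lambda>m n. atom (x m) (y m) (w n)"
  have t0: "0 \<le> t n" and \<delta>0: "0 \<le> \<delta> m" for n m by (simp_all add: t_def \<delta>_def)
  have c1: "\<bar>c n\<bar> \<le> 1" for n
    using \<rho>_ratio[OF t0, of n] by (simp add: c_def)
  consider "\<forall>\<sigma>>0. eventually (\<lambda>m. \<delta> m < \<sigma>) U" | "\<forall>T. eventually (\<lambda>n. T < t n) U"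
    | \<sigma> T where "\<sigma> > 0" "\<not> eventually (\<lambda>m. \<delta> m < \<sigma>) U" "\<not> eventually (\<lambda>n. T < t n) U"
    by blast
  then show ?thesis
  proof cases
    case 1
    have "eventually (\<lambda>m. \<forall>n. \<bar>?K m n\<bar> \<le> \<epsilon>) U" if \<epsilon>: "\<epsilon> > 0" for \<epsilon>
    proof -
      obtain b where b: "b > 0" "\<And>t. 0 \<le> t \<Longrightarrow> t < b \<Longrightarrow> t / \<omega> t \<le> \<epsilon>"
        using \<omega>_ratio_small[OF \<epsilon>] by blast
      have "eventually (\<lambda>m. \<delta> m < b) U" using 1 b(1) by blast
      then show ?thesis
      proof eventually_elim
        case (elim m)
        then show ?case
          using b(2)[OF \<delta>0, of m] abs_atom_le(1)[of "x m" "y m"] by (auto simp: \<delta>_def intro: order_trans)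
      qed
    qed
    then show ?thesis
      using iterated_ulim_small[of ?K] by simp
  next
    case 2
    have "eventually (\<lambda>n. \<forall>m. \<bar>?K m n\<bar> \<le> \<epsilon>) U" if \<epsilon>: "\<epsilon> > 0" for \<epsilon>
    proof -
      obtain b where b: "\<And>t. t > b \<Longrightarrow> \<rho> t / t \<le> \<epsilon>"
        using \<rho>_ratio_small[OF \<epsilon>] by blast
      have "eventually (\<lambda>n. b < t n) U" using 2 by blast
      then show ?thesis
      proof eventually_elim
        case (elim n)
        then show ?case
          using b[of "t n"] abs_atom_le(2)[OF pq, of _ _ n] by (auto simp: t_def intro: order_trans)
      qed
    qed
    then show ?thesis
      using iterated_ulim_small[of "\<lambda>n m. ?K m n"] by simp
  next
    case (3 \<sigma> T)
    note ev = 3(2,3)[unfolded not_eventually_U not_less]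
    \<comment> \<open>The cut-offs keep the factors bounded for all indices, as the rules for limits
      require, and change nothing on the members of \<open>U\<close> in \<open>ev\<close>.\<close>
    define u where "u m = (if \<sigma> \<le> \<delta> m then 1 / \<omega> (\<delta> m) else 0)" for m
    define t' where "t' n = (if t n \<le> T then t n else 0)" for n
    define F where "F z n = max (t' n - dist (q n) z) 0" for z n
    define G where "G m n = u m * (c n * (F (x m) n - F (y m) n))" for m n
    have t'0: "0 \<le> t' n" and t'T: "t' n \<le> \<bar>T\<bar>" for n
      using t0[of n] by (auto simp: t'_def)
    have u1: "\<bar>u m\<bar> \<le> 1 / \<sigma>" for m
      using \<omega>_ge[OF \<delta>0, of m] 3(1) by (auto simp: u_def frac_le)
    have F1: "\<bar>F z n\<bar> \<le> \<bar>T\<bar>" for z n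
    proof -
      have "t' n - dist (q n) z \<le> \<bar>T\<bar>"
        using t'T[of n] zero_le_dist[of "q n" z] by linarith
      then show ?thesis by (simp add: F_def max_def)
    qed
    have F2: "\<bar>ulim (\<lambda>n. F (z m) n)\<bar> \<le> \<bar>T\<bar>" "\<bar>ulim (\<lambda>m. F (z m) n)\<bar> \<le> \<bar>T\<bar>" for z :: "nat \<Rightarrow> 'a" and m n
      by (intro abs_ulim_le F1)+
    have FF: "\<bar>f - g\<bar> \<le> 2 * \<bar>T\<bar>" if "\<bar>f\<bar> \<le> \<bar>T\<bar>" "\<bar>g\<bar> \<le> \<bar>T\<bar>" for f g :: real
      using that by linarith
    have cFF: "\<bar>c n * d\<bar> \<le> 2 * \<bar>T\<bar>" if "\<bar>d\<bar> \<le> 2 * \<bar>T\<bar>" for d n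
      using mult_mono[OF c1[of n] that] by (simp add: abs_mult)
    have Fx: "ulim (\<lambda>m. ulim (\<lambda>n. F (z m) n)) = ulim (\<lambda>n. ulim (\<lambda>m. F (z m) n))" for z :: "nat \<Rightarrow> 'a"
      unfolding F_def by (rule bump_interchange[OF st t'0 t'T])
    have "ulim (\<lambda>n. G m n) = u m * (ulim c * (ulim (\<lambda>n. F (x m) n) - ulim (\<lambda>n. F (y m) n)))" for m
      unfolding G_def
      by (subst ulim_cmult[OF cFF[OF FF[OF F1 F1]]], subst ulim_mult[OF c1 FF[OF F1 F1]], subst ulim_diff[OF F1 F1])
        (rule refl)
    moreover have "ulim (\<lambda>m. u m * (ulim c * (ulim (\<lambda>n. F (x m) n) - ulim (\<lambda>n. F (y m) n)))) =
        ulim u * (ulim c * (ulim (\<lambda>m. ulim (\<lambda>n. F (x m) n)) - ulim (\<lambda>m. ulim (\<lambda>n. F (y m) n))))"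
    proof -
      have "\<bar>ulim c * (ulim (\<lambda>n. F (x m) n) - ulim (\<lambda>n. F (y m) n))\<bar> \<le> 1 * (2 * \<bar>T\<bar>)" for m
        unfolding abs_mult by (intro mult_mono abs_ulim_le c1 FF F2) auto
      then show ?thesis
        by (subst ulim_mult[OF u1], assumption, subst ulim_cmult[OF FF[OF F2(1) F2(1)]], subst ulim_diff[OF F2(1) F2(1)])
          (rule refl)
    qed
    ultimately have 1: "ulim (\<lambda>m. ulim (\<lambda>n. G m n)) =
        ulim u * (ulim c * (ulim (\<lambda>m. ulim (\<lambda>n. F (x m) n)) - ulim (\<lambda>m. ulim (\<lambda>n. F (y m) n))))"
      by simp
    have "ulim (\<lambda>m. G m n) = ulim u * (c n * (ulim (\<lambda>m. F (x m) n) - ulim (\<lambda>m. F (y m) n)))" for n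
      unfolding G_def
      by (subst ulim_mult[OF u1 cFF[OF FF[OF F1 F1]]], subst ulim_cmult[OF FF[OF F1 F1]], subst ulim_diff[OF F1 F1])
        (rule refl)
    moreover have "ulim (\<lambda>n. ulim u * (c n * (ulim (\<lambda>m. F (x m) n) - ulim (\<lambda>m. F (y m) n)))) =
        ulim u * (ulim c * (ulim (\<lambda>n. ulim (\<lambda>m. F (x m) n)) - ulim (\<lambda>n. ulim (\<lambda>m. F (y m) n))))"
      by (subst ulim_cmult[OF cFF[OF FF[OF F2(2) F2(2)]]], subst ulim_mult[OF c1 FF[OF F2(2) F2(2)]],
          subst ulim_diff[OF F2(2) F2(2)]) (rule refl)
    ultimately have 2: "ulim (\<lambda>n. ulim (\<lambda>m. G m n)) =
        ulim u * (ulim c * (ulim (\<lambda>n. ulim (\<lambda>m. F (x m) n)) - ulim (\<lambda>n. ulim (\<lambda>m. F (y m) n))))"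
      by simp
    have coord: "coord z (w n) = c n * F z n" if "t n \<le> T" for z n
      using that by (simp add: coord_def pq F_def t'_def bump_def c_def t_def)
    have KG: "?K m n = G m n" if "\<sigma> \<le> \<delta> m" "t n \<le> T" for m n
      using that(1) by (simp add: atom_def coord[OF that(2)] G_def u_def \<delta>_def right_diff_distrib diff_divide_distrib)
    have "ulim (\<lambda>m. ulim (\<lambda>n. ?K m n)) = ulim (\<lambda>m. ulim (\<lambda>n. G m n))"
      by (rule iterated_ulim_cong[OF ev KG])
    also have "\<dots> = ulim (\<lambda>n. ulim (\<lambda>m. G m n))"
      unfolding 1 2 Fx ..
    also have "\<dots> = ulim (\<lambda>n. ulim (\<lambda>m. ?K m n))"
      by (rule iterated_ulim_cong[OF ev(2,1)]) (simp add: KG)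
    finally show ?thesis .
  qed
qed

end

theorem theorem3:
  fixes \<rho> \<omega> :: "real \<Rightarrow> real"
  assumes "stable TYPE('a::metric_space)"
    and "\<rho> \<in> class_P" and "\<omega> \<in> class_Omega"
    and "mono_on {0..} \<rho>" and "mono_on {0..} \<omega>"
    and "antimono_on {0<..} (\<lambda>t. \<rho> t / t)" and "antimono_on {0<..} (\<lambda>t. \<omega> t / t)"
  shows "\<exists>(Y :: (('a \<Rightarrow> real) \<Rightarrow> real) normed_structure) (f :: 'a \<Rightarrow> (('a \<Rightarrow> real) \<Rightarrow> real)).
    banach_space Y \<and> reflexive Y \<and> range f \<subseteq> carrier Y \<and>
    (\<forall>x y. \<rho> (dist x y) \<le> nrm Y (f x \<ominus>\<^bsub>Y\<^esub> f y) \<and>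
           nrm Y (f x \<ominus>\<^bsub>Y\<^esub> f y) \<le> \<omega> (dist x y))"
proof -
  obtain U where "free_ultrafilter U"
    using free_ultrafilter_exists by blast
  then interpret free_ultrafilter U .
  interpret moduli \<rho> \<omega>
    by unfold_locales (fact assms)+
  define A where "A = range (\<lambda>(x :: 'a, y). atom x y)"
  interpret reflexive_interpolation A U
  proof unfold_locales
    show "A \<noteq> {}" by (simp add: A_def)
    show "\<bar>a w\<bar> \<le> 1" if "a \<in> A" for a w
      using that abs_atom_le_1 by (auto simp: A_def)
    show "interchange (\<lambda>a w. a w) A UNIV"
      unfolding interchange_def
    proof (intro allI impI)
      fix a :: "nat \<Rightarrow> ('a \<Rightarrow> real) \<Rightarrow> real" and w :: "nat \<Rightarrow> 'a \<Rightarrow> real"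
      assume "range a \<subseteq> A"
      then have "\<forall>m. \<exists>xy. a m = atom (fst xy) (snd xy)"
        by (force simp: A_def)
      then have "\<exists>xy. \<forall>m. a m = atom (fst (xy m)) (snd (xy m))"
        by (rule choice)
      then obtain xy where "a m = atom (fst (xy m)) (snd (xy m))" for m
        by blast
      then show "ulim (\<lambda>m. ulim (\<lambda>n. a m (w n))) = ulim (\<lambda>n. ulim (\<lambda>m. a m (w n)))"
        using atom_interchange[OF free_ultrafilter_axioms assms(1)] by simp
    qed
  qed
  \<comment> \<open>Any point will do as base point. Subtracting \<open>coord b\<close> is
    essential: \<open>coord x\<close> alone may be unbounded, whereas the difference is the multiple
    \<open>\<omega> (dist x b)\<close> of an atom and so lies in the space.\<close>
  fix b :: 'a
  define f :: "'a \<Rightarrow> ('a \<Rightarrow> real) \<Rightarrow> real" where "f x = (\<lambda>w. coord x w - coord b w)" for x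
  have atom_A: "atom x y \<in> A" for x y :: 'a
    by (auto simp: A_def)
  have \<omega>0: "0 \<le> \<omega> (dist x y)" for x y :: 'a
    using \<omega>_ge[of "dist x y"] zero_le_dist[of x y] by linarith
  have f: "f x \<in> space" for x
    unfolding f_def atom_smult by (intro space_cmult A_in_space atom_A)
  have diff: "f x \<ominus>\<^bsub>Y\<^esub> f y = (\<lambda>w. coord x w - coord y w)" for x y
    unfolding minus_Y[OF f f] by (simp add: f_def)
  have "inorm (\<lambda>w. coord x w - coord y w) \<le> \<omega> (dist x y)" for x y :: 'a
    unfolding atom_smult using space_cmult(2)[OF A_in_space(1)[OF atom_A], of "\<omega> (dist x y)" x y]
      mult_left_le[OF A_in_space(2)[OF atom_A] \<omega>0] \<omega>0[of x y] by simp
  moreover have "\<rho> (dist x y) \<le> inorm (\<lambda>w. coord x w - coord y w)" for x y :: 'a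
    using abs_le_inorm[of "\<lambda>w. coord x w - coord y w" "pair_code (x, y)"] space_diff[OF f f, of x y]
    by (simp add: coord_separates f_def)
  ultimately show ?thesis
    using banach_space_Y reflexive_Y f
    by (intro exI[of _ Y] exI[of _ f]) (auto simp: diff)
qed

end
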